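(* In the setting of the context, let $\tau=(\tau_n)_{n\in\mathbb{N}}$ be a sequence of times increasing without bound, let $u^0\in\mathfrak{U}$ be a $\tau$-strictly optimal control for the infinite-horizon problem, and let $x^0$ be the corresponding trajectory. Then there exists a nontrivial strictly $\tau$-vanishing solution $(\lambda^0,\psi^0)\in\{0,1\}\times AC(\mathbb{T},\mathbb{X})$ of the maximum principle relations (adjoint equation) and (maximum condition). That is, there exist a sequence of pairs $(\lambda^n,\psi^n)\in[0,1]\times AC(\mathbb{T},\mathbb{X})$ converging to $(\lambda^0,\psi^0)$ uniformly on every compact subset of $\mathbb{T}$, and a subsequence $\tau'=(\tau'_n)$ of $\tau$, such that each pair $(\lambda^n,\psi^n)$ satisfies on $[0,\tau'_n]$ the maximum principle relations (adjoint equation), (maximum condition) and (normalization), i.e. including "$\lambda^n=1$, or $\lambda^n=0$ and $\|\psi^n(0)\|=1$", together with the boundary condition $\psi^n(\tau'_n)=0$. Moreover, if $\lambda^0=1$, then one can assume that $\lambda^n=1$ for all $n$.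
   Context: Setting. $\mathbb{T}=[0,\infty)$; $\mathbb{X}$ and $\mathbb{U}$ are finite-dimensional Euclidean spaces; $U:\mathbb{T}\rightsquigarrow\mathbb{U}$ is a set-valued map that is compact-valued, locally integrally bounded (i.e. $\sup_{u\in U(t)}\|u\|$ is bounded by a locally integrable function of $t$), and has Borel measurable graph. The set $\mathfrak{U}$ of admissible controls consists of all Borel measurable, locally bounded selectors $u$ of $U$. The functions $f(t,x,u)\in\mathbb{X}$ and $g(t,x,u)\in\mathbb{R}$ and their derivatives in $x$ are Carathéodory maps (measurable in $t$, continuous in $(x,u)$), locally Lipschitz in $x$, and integrally bounded on compacts (for $x$ in a compact set and $u\in U(t)$ their norms are bounded by a locally integrable function of $t$). Moreover, there is a continuous function $M:\mathbb{T}\to\mathbb{T}$ with $\|f(t,x,u)\|\le M(t)(1+\|x\|)$ for all $t\in\mathbb{T}$, $u\in U(t)$, $x\in\mathbb{X}$. $AC(\mathbb{T},\mathbb{X})$ denotes the (locally) absolutely continuous functions from $\mathbb{T}$ to $\mathbb{X}$. Problem. A point $x_*\in\mathbb{X}$ is fixed. Each $u\in\mathfrak{U}$ generates the trajectory $x$ solving $\dot x(t)=f(t,x(t),u(t))$ for a.e. $t\in\mathbb{T}$, $x(0)=x_*$ (the right end is free). For $T\ge 0$ put $J[u](T)=\int_0^T g(t,x(t),u(t))\,dt$; this is to be maximized as $T\to\infty$. Strict optimality. For a sequence $\tau=(\tau_n)$ of times increasing without bound, $u^0\in\mathfrak{U}$ is called $\tau$-strictly optimal if $J[u^0](\tau_n)\ge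 J[u](\tau_n)$ for all $n\in\mathbb{N}$ and all $u\in\mathfrak{U}$. Maximum principle relations. Let $\mathcal{H}(x,t,u,\lambda,\psi)=\psi f(t,x,u)+\lambda g(t,x,u)$, where $\psi\in\mathbb{X}$ is treated as a row vector. For the pair $(x^0,u^0)$ and $(\lambda,\psi)$ with $\lambda\in[0,1]$, $\psi\in AC(\mathbb{T},\mathbb{X})$: (adjoint equation) $\dot\psi(t)=-\dfrac{\partial\mathcal{H}}{\partial x}(x^0(t),t,u^0(t),\lambda,\psi(t))$ for a.e. $t$; (maximum condition) $\sup_{p\in U(t)}\mathcal{H}(x^0(t),t,p,\lambda,\psi(t))=\mathcal{H}(x^0(t),t,u^0(t),\lambda,\psi(t))$ for a.e. $t$; (normalization) $\lambda=1$, or $\lambda=0$ and $\|\psi(0)\|=1$. A nontrivial pair $(\lambda^0,\psi^0)$ satisfying the adjoint equation and the maximum condition on $\mathbb{T}$ is called strictly $\tau$-vanishing if there exist a subsequence $\tau'$ of $\tau$ and pairs $(\lambda^n,\psi^n)\in[0,1]\times AC(\mathbb{T},\mathbb{X})$ converging to $(\lambda^0,\psi^0)$ uniformly on every compact set, each satisfying the adjoint equation and the maximum condition on $[0,\tau'_n]$ and the condition $\psi^n(\tau'_n)=0$.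
   Formalization: The normalization of the pairs (λ^n,ψ^n), impossible in general together with ψ^n(τ'_n)=0 and convergence, is required only up to a positive factor, with ‖ψ^n(0)‖=1 if λ^0=0 and λ^n=1 if λ^0=1; the limit pair is normalized literally. *)

theory Defs
  imports "HOL-Analysis.Analysis"
begin

section \<open>Functions on the half-line\<close>

text \<open>Absolute continuity in the usual epsilon-delta form. The finite families of non-overlapping
  compact subintervals are the divisions of subsets of the interval, so that
  \<open>Inf k\<close> and \<open>Sup k\<close> are the end points of the member \<open>k\<close>.\<close>

definition abs_cont_on :: "real \<Rightarrow> real \<Rightarrow> (real \<Rightarrow> 'a::real_normed_vector) \<Rightarrow> bool" where
  "abs_cont_on a b h \<longleftrightarrow>
     (\<forall>\<epsilon>>0. \<exists>\<delta>>0. \<forall>D S. D division_of S \<and> S \<subseteq> {a..b} \<and> (\<Sum>k\<in>D. Sup k - Inf k) < \<delta> \<longrightarrow>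
        (\<Sum>k\<in>D. norm (h (Sup k) - h (Inf k))) < \<epsilon>)"

text \<open>Functions on $[0,\infty)$ are total functions on the reals; the values at negative
  arguments never matter.\<close>

definition AC_halfline :: "(real \<Rightarrow> 'a::real_normed_vector) set" where
  "AC_halfline = {h. \<forall>T\<ge>0. abs_cont_on 0 T h}"

definition locally_integrable :: "(real \<Rightarrow> real) \<Rightarrow> bool" where
  "locally_integrable L \<longleftrightarrow> (\<forall>T\<ge>0. L absolutely_integrable_on {0..T})"

section \<open>Set-valued maps, controls and right-hand sides\<close>

definition set_graph :: "(real \<Rightarrow> 'u set) \<Rightarrow> (real \<times> 'u) set" where
  "set_graph U = {(t, u). 0 \<le> t \<and> u \<in> U t}"

definition locally_integrally_bounded :: "(real \<Rightarrow> 'u::real_normed_vector set) \<Rightarrow> bool" where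
  "locally_integrally_bounded U \<longleftrightarrow>
     (\<exists>L. locally_integrable L \<and> (\<forall>t\<ge>0. \<forall>u\<in>U t. norm u \<le> L t))"

definition admissible_controls ::
  "(real \<Rightarrow> 'u::euclidean_space set) \<Rightarrow> (real \<Rightarrow> 'u) set" where
  "admissible_controls U =
     {u. u \<in> borel_measurable (restrict_space borel {0..}) \<and>
         (\<forall>T\<ge>0. bounded (u ` {0..T})) \<and> (\<forall>t\<ge>0. u t \<in> U t)}"

definition caratheodory ::
  "(real \<Rightarrow> 'x::euclidean_space \<Rightarrow> 'u::euclidean_space \<Rightarrow> 'b::real_normed_vector) \<Rightarrow> bool" where
  "caratheodory a \<longleftrightarrow>
     (\<forall>x u. (\<lambda>t. a t x u) \<in> borel_measurable (lebesgue_on {0..})) \<and>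
     (\<forall>t\<ge>0. continuous_on UNIV (\<lambda>(x, u). a t x u))"

text \<open>No uniformity of the Lipschitz constant in \<open>t\<close> or \<open>u\<close> is required.\<close>

definition locally_lipschitz_in_x ::
  "(real \<Rightarrow> 'u set) \<Rightarrow> (real \<Rightarrow> 'x::euclidean_space \<Rightarrow> 'u::euclidean_space \<Rightarrow> 'b::real_normed_vector)
     \<Rightarrow> bool" where
  "locally_lipschitz_in_x U a \<longleftrightarrow>
     (\<forall>t\<ge>0. \<forall>u\<in>U t. \<forall>x. \<exists>\<epsilon>>0. \<exists>L. lipschitz_on L (cball x \<epsilon>) (\<lambda>y. a t y u))"

definition integrally_bounded_on_compacts ::
  "(real \<Rightarrow> 'u set) \<Rightarrow> (real \<Rightarrow> 'x::euclidean_space \<Rightarrow> 'u::euclidean_space \<Rightarrow> 'b::real_normed_vector)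
     \<Rightarrow> bool" where
  "integrally_bounded_on_compacts U a \<longleftrightarrow>
     (\<forall>K. compact K \<longrightarrow>
       (\<exists>L. locally_integrable L \<and> (\<forall>t\<ge>0. \<forall>x\<in>K. \<forall>u\<in>U t. norm (a t x u) \<le> L t)))"

definition regular_map ::
  "(real \<Rightarrow> 'u set) \<Rightarrow> (real \<Rightarrow> 'x::euclidean_space \<Rightarrow> 'u::euclidean_space \<Rightarrow> 'b::real_normed_vector)
     \<Rightarrow> bool" where
  "regular_map U a \<longleftrightarrow>
     caratheodory a \<and> locally_lipschitz_in_x U a \<and> integrally_bounded_on_compacts U a"

section \<open>Trajectories, pay-off and strict optimality\<close>

definition trajectory ::
  "(real \<Rightarrow> 'x::euclidean_space \<Rightarrow> 'u \<Rightarrow> 'x) \<Rightarrow> 'x \<Rightarrow> (real \<Rightarrow> 'u) \<Rightarrow> (real \<Rightarrow> 'x) \<Rightarrow> bool" where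
  "trajectory f xstar u x \<longleftrightarrow>
     x \<in> AC_halfline \<and> x 0 = xstar \<and>
     (AE t in lebesgue. t \<in> {0..} \<longrightarrow> (x has_vector_derivative f t (x t) (u t)) (at t))"

definition payoff ::
  "(real \<Rightarrow> 'x \<Rightarrow> 'u \<Rightarrow> real) \<Rightarrow> (real \<Rightarrow> 'x) \<Rightarrow> (real \<Rightarrow> 'u) \<Rightarrow> real \<Rightarrow> real" where
  "payoff g x u T = set_lebesgue_integral lebesgue {0..T} (\<lambda>t. g t (x t) (u t))"

text \<open>The trajectory of a control is unique on $[0,\infty)$ but not as a total function on the
  reals; hence the pay-offs are compared for all functions representing the trajectories.\<close>

definition strictly_optimal ::
  "(real \<Rightarrow> 'u::euclidean_space set) \<Rightarrow> (real \<Rightarrow> 'x::euclidean_space \<Rightarrow> 'u \<Rightarrow> 'x) \<Rightarrow>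
   (real \<Rightarrow> 'x \<Rightarrow> 'u \<Rightarrow> real) \<Rightarrow> 'x \<Rightarrow> (nat \<Rightarrow> real) \<Rightarrow> (real \<Rightarrow> 'u) \<Rightarrow> bool" where
  "strictly_optimal U f g xstar \<tau> u0 \<longleftrightarrow>
     u0 \<in> admissible_controls U \<and>
     (\<forall>u\<in>admissible_controls U. \<forall>x0 x. trajectory f xstar u0 x0 \<longrightarrow> trajectory f xstar u x \<longrightarrow>
        (\<forall>n. payoff g x0 u0 (\<tau> n) \<ge> payoff g x u (\<tau> n)))"

section \<open>The relations of the maximum principle\<close>

definition hamiltonian ::
  "(real \<Rightarrow> 'x::euclidean_space \<Rightarrow> 'u \<Rightarrow> 'x) \<Rightarrow> (real \<Rightarrow> 'x \<Rightarrow> 'u \<Rightarrow> real) \<Rightarrow>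
   'x \<Rightarrow> real \<Rightarrow> 'u \<Rightarrow> real \<Rightarrow> 'x \<Rightarrow> real" where
  "hamiltonian f g x t u lam p = p \<bullet> f t x u + lam * g t x u"

definition adjoint_equation_on ::
  "real set \<Rightarrow> (real \<Rightarrow> 'x::euclidean_space \<Rightarrow> 'u \<Rightarrow> 'x) \<Rightarrow> (real \<Rightarrow> 'x \<Rightarrow> 'u \<Rightarrow> real) \<Rightarrow>
   (real \<Rightarrow> 'x) \<Rightarrow> (real \<Rightarrow> 'u) \<Rightarrow> real \<Rightarrow> (real \<Rightarrow> 'x) \<Rightarrow> bool" where
  "adjoint_equation_on I f g x0 u0 lam \<psi> \<longleftrightarrow>
     (AE t in lebesgue. t \<in> I \<longrightarrow>
        (\<exists>p. (GDERIV (\<lambda>y. hamiltonian f g y t (u0 t) lam (\<psi> t)) (x0 t) :> p) \<and>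
             (\<psi> has_vector_derivative - p) (at t)))"

definition maximum_condition_on ::
  "real set \<Rightarrow> (real \<Rightarrow> 'u set) \<Rightarrow> (real \<Rightarrow> 'x::euclidean_space \<Rightarrow> 'u \<Rightarrow> 'x) \<Rightarrow>
   (real \<Rightarrow> 'x \<Rightarrow> 'u \<Rightarrow> real) \<Rightarrow> (real \<Rightarrow> 'x) \<Rightarrow> (real \<Rightarrow> 'u) \<Rightarrow> real \<Rightarrow> (real \<Rightarrow> 'x) \<Rightarrow> bool" where
  "maximum_condition_on I U f g x0 u0 lam \<psi> \<longleftrightarrow>
     (AE t in lebesgue. t \<in> I \<longrightarrow>
        (SUP p\<in>U t. hamiltonian f g (x0 t) t p lam (\<psi> t)) =
        hamiltonian f g (x0 t) t (u0 t) lam (\<psi> t))"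

definition normalized :: "real \<Rightarrow> (real \<Rightarrow> 'x::real_normed_vector) \<Rightarrow> bool" where
  "normalized lam \<psi> \<longleftrightarrow> lam = 1 \<or> (lam = 0 \<and> norm (\<psi> 0) = 1)"

text \<open>The adjoint equation, the maximum condition and the boundary condition are positively
  homogeneous in \<open>(lam, \<psi>)\<close>; this is the normalization modulo that scaling.
  It cannot be demanded without the scaling of pairs that have \<open>\<psi> T = 0\<close> for some \<open>T > 0\<close> and
  converge: a pair with \<open>lam = 0\<close> would vanish, and pairs with \<open>lam = 1\<close> need not converge.
  For \<open>f = 0\<close>, \<open>g t x u = x\<close>, \<open>U t = {0}\<close> the pair with \<open>lam = 1\<close> is \<open>\<psi> t = T - t\<close>.\<close>

definition normalized_up_to_scaling :: "real \<Rightarrow> (real \<Rightarrow> 'x::real_normed_vector) \<Rightarrow> bool" where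
  "normalized_up_to_scaling lam \<psi> \<longleftrightarrow> (\<exists>c>0. normalized (c * lam) (\<lambda>t. c *\<^sub>R \<psi> t))"

definition nontrivial_pair :: "real \<Rightarrow> (real \<Rightarrow> 'x::real_normed_vector) \<Rightarrow> bool" where
  "nontrivial_pair lam \<psi> \<longleftrightarrow> lam \<noteq> 0 \<or> (\<exists>t\<ge>0. \<psi> t \<noteq> 0)"

definition converges_locally_uniformly ::
  "(nat \<Rightarrow> real) \<Rightarrow> (nat \<Rightarrow> real \<Rightarrow> 'x::real_normed_vector) \<Rightarrow> real \<Rightarrow> (real \<Rightarrow> 'x) \<Rightarrow> bool" where
  "converges_locally_uniformly lams \<psi>s lam0 \<psi>0 \<longleftrightarrow>
     lams \<longlonglongrightarrow> lam0 \<and> (\<forall>K. compact K \<and> K \<subseteq> {0..} \<longrightarrow> uniform_limit K \<psi>s \<psi>0 sequentially)"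

text \<open>\<open>(lams, \<psi>s)\<close> and the times \<open>\<tau>'\<close> witness that \<open>(lam0, \<psi>0)\<close> is strictly vanishing.\<close>

definition vanishing_witness ::
  "(real \<Rightarrow> 'u set) \<Rightarrow> (real \<Rightarrow> 'x::euclidean_space \<Rightarrow> 'u \<Rightarrow> 'x) \<Rightarrow> (real \<Rightarrow> 'x \<Rightarrow> 'u \<Rightarrow> real) \<Rightarrow>
   (real \<Rightarrow> 'x) \<Rightarrow> (real \<Rightarrow> 'u) \<Rightarrow> (nat \<Rightarrow> real) \<Rightarrow> (nat \<Rightarrow> real) \<Rightarrow> (nat \<Rightarrow> real \<Rightarrow> 'x) \<Rightarrow>
   real \<Rightarrow> (real \<Rightarrow> 'x) \<Rightarrow> bool" where
  "vanishing_witness U f g x0 u0 \<tau>' lams \<psi>s lam0 \<psi>0 \<longleftrightarrow>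
     (\<forall>n. lams n \<in> {0..1} \<and> \<psi>s n \<in> AC_halfline) \<and>
     converges_locally_uniformly lams \<psi>s lam0 \<psi>0 \<and>
     (\<forall>n. adjoint_equation_on {0..\<tau>' n} f g x0 u0 (lams n) (\<psi>s n) \<and>
          maximum_condition_on {0..\<tau>' n} U f g x0 u0 (lams n) (\<psi>s n) \<and>
          \<psi>s n (\<tau>' n) = 0)"

definition strictly_vanishing ::
  "(real \<Rightarrow> 'u set) \<Rightarrow> (real \<Rightarrow> 'x::euclidean_space \<Rightarrow> 'u \<Rightarrow> 'x) \<Rightarrow> (real \<Rightarrow> 'x \<Rightarrow> 'u \<Rightarrow> real) \<Rightarrow>
   (real \<Rightarrow> 'x) \<Rightarrow> (real \<Rightarrow> 'u) \<Rightarrow> (nat \<Rightarrow> real) \<Rightarrow> real \<Rightarrow> (real \<Rightarrow> 'x) \<Rightarrow> bool" where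
  "strictly_vanishing U f g x0 u0 \<tau> lam0 \<psi>0 \<longleftrightarrow>
     lam0 \<in> {0..1} \<and> \<psi>0 \<in> AC_halfline \<and> nontrivial_pair lam0 \<psi>0 \<and>
     adjoint_equation_on {0..} f g x0 u0 lam0 \<psi>0 \<and>
     maximum_condition_on {0..} U f g x0 u0 lam0 \<psi>0 \<and>
     (\<exists>r lams \<psi>s. strict_mono r \<and> vanishing_witness U f g x0 u0 (\<tau> \<circ> r) lams \<psi>s lam0 \<psi>0)"

end

theory Submission
  imports Defs
begin

text \<open>On each horizon \<open>\<tau> n\<close> the reference control maximizes the pay-off with free right end, so the
  solution \<open>\<Psi> n\<close> of the adjoint equation with \<open>lam = 1\<close> that vanishes at \<open>\<tau> n\<close> satisfies the maximum
  condition. Otherwise a measurable selection would increase the Hamiltonian on a set of positive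
  measure, and changing the control on a small part \<open>B\<close> of that set would increase the pay-off: the
  increment is the integral over \<open>B\<close> of the gain plus a term of smaller order than the measure of \<open>B\<close>.
  No Lebesgue points are needed, since it suffices to choose \<open>B\<close> inside a set where the gain is bounded
  below and the data are bounded above.

  If the initial values \<open>\<Psi> n 0\<close> are bounded along a subsequence, then a further subsequence converges,
  with \<open>lam = 1\<close>. Otherwise the pairs are divided by the norms of these initial values and the limit has
  \<open>lam = 0\<close>. The solutions depend continuously on \<open>lam\<close> and their initial values, and the maximum
  condition is closed under pointwise limits.

  The selection rests on Choquet's capacitability theorem: a Borel set whose projection to the time
  axis is not a null set contains a compact set with the same property.\<close>

section \<open>Absolutely continuous functions\<close>

text \<open>The free right end is what makes \<open>lam = 1\<close> available on every finite
  horizon: the terminal value of the adjoint is 0, and normality can be lost only through the growth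
  of \<open>\<Psi> n 0\<close> with the horizon. Initial values are the right quantity to watch: the
  adjoint equation is linear in \<open>(lam, \<psi>)\<close>, and \<open>lam\<close> and the value
  at 0, a time that does not move with the horizon, determine the solution. Compactness of a ball or
  sphere in a finite-dimensional space then replaces compactness in a function space.

  Smoothness in the state is not uniform in time, so the remainder of the state expansion is small
  only pointwise. Divided by the measure of \<open>B\<close> it is dominated by an integrable
  function, and dominated convergence makes its integral small. This requires a displacement of the
  order of the measure of \<open>B\<close>, which is why the data are bounded on \<open>B\<close>.

  Time dependence is Lebesgue measurable whereas capacitability speaks of Borel sets, so
  Caratheodory maps are replaced by Borel functions off a null set. The compact set obtained also
  makes the selected control bounded, as admissibility demands.\<close>

lemma sum_tagged_partial_division_reindex:
  fixes h :: "real \<Rightarrow> 'a::real_normed_vector"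
  assumes p: "p tagged_partial_division_of cbox a b"
  shows "(\<Sum>(x,K)\<in>p. norm (h (Sup K) - h (Inf K))) = (\<Sum>K\<in>snd ` p. norm (h (Sup K) - h (Inf K)))"
proof -
  have "(\<Sum>K\<in>snd ` p. norm (h (Sup K) - h (Inf K))) = (\<Sum>z\<in>p. norm (h (Sup (snd z)) - h (Inf (snd z))))"
  proof (rule sum.reindex_nontrivial[unfolded o_def])
    show "finite p" using p by (auto dest: tagged_partial_division_ofD)
  next
    fix y z assume yz: "y \<in> p" "z \<in> p" "y \<noteq> z" "snd y = snd z"
    obtain x1 x2 K where [simp]: "y = (x1,K)" "z = (x2,K)" using yz by (metis prod.collapse)
    obtain u v where K: "K = cbox u v" "x1 \<in> K"
      using yz p tagged_partial_division_ofD(2,4)[OF p] by (metis \<open>y = (x1,K)\<close>)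
    \<comment> \<open>Distinct tagged intervals have disjoint interiors, so an interval with two
      tags is a single point and its increment is 0.\<close>
    have "interior K \<inter> interior K = {}"
      using tagged_partial_division_ofD(5)[OF p, of x1 K x2 K] yz by auto
    then have "u = v" using K by auto
    then show "norm (h (Sup (snd y)) - h (Inf (snd y))) = 0" using K by auto
  qed
  then show ?thesis by (simp add: split_beta)
qed

lemma tagged_sum_length_le:
  assumes p: "p tagged_partial_division_of cbox a (b::real)" and W: "W \<in> lmeasurable"
    and sub: "\<And>x K. (x,K) \<in> p \<Longrightarrow> K \<subseteq> W"
  shows "(\<Sum>K\<in>snd ` p. Sup K - Inf K) \<le> measure lebesgue W"
proof -
  have d: "(snd ` p) division_of \<Union>(snd ` p)" by (rule partial_division_of_tagged_division[OF p])
  have "(\<Sum>K\<in>snd ` p. Sup K - Inf K) = (\<Sum>K\<in>snd ` p. measure lebesgue K)"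
  proof (rule sum.cong[OF refl])
    fix K assume "K \<in> snd ` p"
    then obtain u v where "K = cbox u v" "K \<noteq> {}" using d by (metis division_ofD(3,4))
    then show "Sup K - Inf K = measure lebesgue K" by auto
  qed
  also have "\<dots> = measure lebesgue (\<Union>(snd ` p))"
    using content_division[OF d] by simp
  also have "\<dots> \<le> measure lebesgue W"
  proof (rule measure_mono_fmeasurable[OF _ _ W])
    show "\<Union> (snd ` p) \<subseteq> W" using sub by fastforce
    show "\<Union> (snd ` p) \<in> sets lebesgue" using lmeasurable_division[OF d] by (rule fmeasurableD)
  qed
  finally show ?thesis .
qed

text \<open>The gauge controls the intervals tagged in the exceptional null set by absolute continuity
  and all others by differentiability.\<close>

lemma abs_cont_has_integral:
  fixes h :: "real \<Rightarrow> 'a::euclidean_space"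
  assumes ac: "abs_cont_on a b h" and ab: "a \<le> b" and N: "negligible N"
    and d: "\<And>t. t \<in> {a..b} - N \<Longrightarrow> (h has_vector_derivative h' t) (at t)"
  shows "(h' has_integral (h b - h a)) {a..b}"
proof -
  \<comment> \<open>Value 0 on \<open>N\<close>: an interval tagged in \<open>N\<close> then
    contributes only the increment of \<open>h\<close>, and absolute continuity bounds the sum of
    these increments.\<close>
  define g where "g t = (if t \<in> N then 0 else h' t)" for t
  have "(g has_integral (h b - h a)) {a..b}"
    unfolding has_integral_real
  proof (intro allI impI)
    fix e :: real assume e: "e > 0"
    define e' where "e' = e / (2 * (b - a + 1))"
    have e': "e' > 0" "e' * (b - a) \<le> e/2" using ab e by (auto simp: e'_def field_simps)
    obtain \<delta> where \<delta>: "\<delta> > 0" and ac\<delta>: "\<And>D S. D division_of S \<Longrightarrow> S \<subseteq> {a..b} \<Longrightarrow>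
        (\<Sum>k\<in>D. Sup k - Inf k) < \<delta> \<Longrightarrow> (\<Sum>k\<in>D. norm (h (Sup k) - h (Inf k))) < e/2"
      using ac e unfolding abs_cont_on_def by (meson half_gt_zero)
    have NL: "N \<in> sets lebesgue" using N by (simp add: negligible_imp_sets)
    \<comment> \<open>An open cover of the null set, of measure less than \<delta>; the gauge keeps
      the intervals tagged in \<open>N\<close> inside it.\<close>
    obtain W where W: "open W" "N \<subseteq> W" "W - N \<in> lmeasurable" "emeasure lebesgue (W - N) < ennreal \<delta>"
      using sets_lebesgue_outer_open[OF NL \<delta>] by metis
    have Wm: "W \<in> lmeasurable" "measure lebesgue W < \<delta>"
    proof -
      have WN: "W = (W - N) \<union> N" using W by auto
      show "W \<in> lmeasurable"
        using fmeasurable.Un[OF W(3) negligible_imp_measurable[OF N]] WN by simp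
      have "measure lebesgue W = measure lebesgue (W - N)"
        by (subst measure_Diff_null_set) (use N W \<open>W \<in> lmeasurable\<close> in \<open>auto simp: negligible_iff_null_sets\<close>)
      also have "\<dots> < \<delta>" using W(3,4) \<delta>
        by (metis emeasure_eq_measure2 ennreal_less_iff measure_nonneg)
      finally show "measure lebesgue W < \<delta>" .
    qed
    have "\<exists>r>0. \<forall>u. \<bar>u - t\<bar> < r \<longrightarrow> norm (h u - h t - (u - t) *\<^sub>R h' t) \<le> e' * \<bar>u - t\<bar>" if "t \<in> {a..b} - N" for t
      using d[OF that] e' unfolding has_vector_derivative_def has_derivative_at_alt by auto
    then obtain r where r: "\<And>t. t \<in> {a..b} - N \<Longrightarrow> r t > 0"
      "\<And>t u. t \<in> {a..b} - N \<Longrightarrow> \<bar>u - t\<bar> < r t \<Longrightarrow> norm (h u - h t - (u - t) *\<^sub>R h' t) \<le> e' * \<bar>u - t\<bar>"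
      by metis
    define \<gamma> where "\<gamma> t = (if t \<in> N then W else if t \<in> {a..b} then ball t (r t) else UNIV)" for t
    have gauge: "gauge \<gamma>" using W r by (auto simp: gauge_def \<gamma>_def)
    have key: "norm ((\<Sum>(x,k)\<in>p. measure lborel k *\<^sub>R g x) - (h b - h a)) < e"
      if p: "p tagged_division_of {a..b}" and fine: "\<gamma> fine p" for p
    proof -
      have pp: "p tagged_partial_division_of cbox a b" using p by (auto simp: tagged_division_of_def)
      have fin: "finite p" using p by blast
      define p1 where "p1 = {z\<in>p. fst z \<in> N}"
      define p2 where "p2 = {z\<in>p. fst z \<notin> N}"
      have p12: "p = p1 \<union> p2" "p1 \<inter> p2 = {}" "finite p1" "finite p2" using fin by (auto simp: p1_def p2_def)
      have pp1: "p1 tagged_partial_division_of cbox a b"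
        by (rule tagged_partial_division_subset[OF pp]) (auto simp: p1_def)
      have "(\<Sum>(x,k)\<in>p. measure lborel k *\<^sub>R g x) - (h b - h a) = (\<Sum>(x,k)\<in>p. measure lborel k *\<^sub>R g x) - (\<Sum>(x,k)\<in>p. h (Sup k) - h (Inf k))"
        by (simp only: additive_tagged_division_1[OF ab p, of h])
      also have "\<dots> = (\<Sum>(x,k)\<in>p. measure lborel k *\<^sub>R g x - (h (Sup k) - h (Inf k)))"
        by (simp add: sum_subtractf split_beta)
      also have "norm \<dots> \<le> (\<Sum>(x,k)\<in>p. norm (measure lborel k *\<^sub>R g x - (h (Sup k) - h (Inf k))))"
        by (auto simp: split_beta intro: norm_sum)
      also have "\<dots> = (\<Sum>(x,k)\<in>p1. norm (measure lborel k *\<^sub>R g x - (h (Sup k) - h (Inf k)))) + (\<Sum>(x,k)\<in>p2. norm (measure lborel k *\<^sub>R g x - (h (Sup k) - h (Inf k))))"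
        using sum.union_disjoint[OF p12(3,4,2)] p12(1) by simp
      also have "(\<Sum>(x,k)\<in>p1. norm (measure lborel k *\<^sub>R g x - (h (Sup k) - h (Inf k)))) = (\<Sum>(x,k)\<in>p1. norm (h (Sup k) - h (Inf k)))"
        by (rule sum.cong) (auto simp: p1_def g_def norm_minus_commute)
      also have "\<dots> = (\<Sum>K\<in>snd ` p1. norm (h (Sup K) - h (Inf K)))"
        by (rule sum_tagged_partial_division_reindex[OF pp1])
      also have "\<dots> < e/2"
      proof (rule ac\<delta>[OF partial_division_of_tagged_division[OF pp1]])
        show "\<Union> (snd ` p1) \<subseteq> {a..b}" using tagged_partial_division_ofD(3)[OF pp1] by fastforce
        have "(\<Sum>K\<in>snd ` p1. Sup K - Inf K) \<le> measure lebesgue W"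
        proof (rule tagged_sum_length_le[OF pp1 Wm(1)])
          fix x K assume "(x,K) \<in> p1"
          then have "K \<subseteq> \<gamma> x" "x \<in> N" using fine by (auto simp: p1_def fine_def)
          then show "K \<subseteq> W" by (simp add: \<gamma>_def)
        qed
        then show "(\<Sum>k\<in>snd ` p1. Sup k - Inf k) < \<delta>" using Wm by simp
      qed
      also have "(\<Sum>(x,k)\<in>p2. norm (measure lborel k *\<^sub>R g x - (h (Sup k) - h (Inf k)))) \<le> (\<Sum>(x,k)\<in>p2. e' * measure lborel k)"
      proof (rule sum_mono, clarify)
        fix x K assume xK: "(x,K) \<in> p2"
        then have xp: "(x,K) \<in> p" "x \<notin> N" by (auto simp: p2_def)
        obtain u v where uv: "K = {u..v}" "x \<in> K" using tagged_division_ofD(2,4)[OF p xp(1)] by auto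
        have xab: "x \<in> {a..b} - N" using uv xp tagged_division_ofD(3)[OF p xp(1)] by auto
        have "K \<subseteq> ball x (r x)" using fine xp xab unfolding fine_def by (force simp: \<gamma>_def simp del: mem_ball)
        moreover have ux: "u \<le> x" "x \<le> v" using uv by auto
        ultimately have "u \<in> ball x (r x)" "v \<in> ball x (r x)" unfolding uv(1)
          by (meson atLeastAtMost_iff order.refl order_trans subsetD)+
        then have uvr: "\<bar>u - x\<bar> < r x" "\<bar>v - x\<bar> < r x"
          by (simp_all add: dist_real_def abs_minus_commute)
        \<comment> \<open>The derivative estimate is applied at both end points, measured from the
          tag. The tag lies between them, so the two errors add up to a multiple of the
          length.\<close>
        have "measure lborel K *\<^sub>R g x - (h (Sup K) - h (Inf K)) = (h u - h x - (u - x) *\<^sub>R h' x) - (h v - h x - (v - x) *\<^sub>R h' x)"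
          using uv ux xp by (simp add: g_def algebra_simps)
        also have "norm \<dots> \<le> norm (h u - h x - (u - x) *\<^sub>R h' x) + norm (h v - h x - (v - x) *\<^sub>R h' x)"
          by (rule norm_triangle_ineq4)
        also have "\<dots> \<le> e' * \<bar>u - x\<bar> + e' * \<bar>v - x\<bar>"
          using r(2)[OF xab] uvr by (intro add_mono) auto
        also have "\<dots> = e' * measure lborel K" using ux uv by (simp add: algebra_simps)
        finally show "norm (measure lborel K *\<^sub>R g x - (h (Sup K) - h (Inf K))) \<le> e' * measure lborel K" .
      qed
      also have "\<dots> \<le> (\<Sum>(x,k)\<in>p. e' * measure lborel k)"
        by (rule sum_mono2) (use fin e' in \<open>auto simp: p2_def\<close>)
      also have "\<dots> = e' * (b - a)"
        using additive_content_tagged_division[of p a b] p ab by (simp add: sum_distrib_left[symmetric] split_beta)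
      also have "\<dots> \<le> e/2" by (rule e')
      finally show ?thesis by simp
    qed
    show "\<exists>\<gamma>. gauge \<gamma> \<and> (\<forall>\<D>. \<D> tagged_division_of {a..b} \<and> \<gamma> fine \<D> \<longrightarrow>
        norm ((\<Sum>(x, k)\<in>\<D>. measure lborel k *\<^sub>R g x) - (h b - h a)) < e)"
    proof (intro exI[of _ \<gamma>] conjI allI impI)
      show "gauge \<gamma>" by (rule gauge)
      fix \<D> assume "\<D> tagged_division_of {a..b} \<and> \<gamma> fine \<D>"
      then show "norm ((\<Sum>(x, k)\<in>\<D>. measure lborel k *\<^sub>R g x) - (h b - h a)) < e" using key[of \<D>] by simp
    qed
  qed
  then show ?thesis
    by (rule has_integral_spike[OF N, rotated]) (auto simp: g_def)
qed

section \<open>Lebesgue differentiation and indefinite integrals\<close>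

lemma division_of_realE:
  assumes "D division_of S" "S \<subseteq> {a..b::real}" "k \<in> D"
  obtains u v where "k = {u..v}" "u \<le> v" "a \<le> u" "v \<le> b"
proof -
  obtain u v where uv: "k = cbox u v" using division_ofD(4)[OF assms(1,3)] by auto
  have "k \<noteq> {}" "k \<subseteq> {a..b}" using division_ofD(2,3)[OF assms(1,3)] assms(2) by auto
  then show ?thesis using that[of u v] uv by auto
qed

text \<open>Where differentiability fails, there are arbitrarily short intervals, with the point as
  one end, whose Riemann term misses the integral by more than a fixed fraction of their length.
  Vitali's theorem picks disjoint ones that cover almost all such points, and Henstock's lemma
  bounds the sum of all misses, hence the total length.\<close>

lemma lebesgue_differentiation:
  fixes h :: "real \<Rightarrow> 'a::euclidean_space"
  assumes int: "h integrable_on {a..b}"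
  obtains N where "negligible N"
    "\<And>t. t \<in> {a<..<b} - N \<Longrightarrow> ((\<lambda>t. integral {a..t} h) has_vector_derivative h t) (at t)"
proof -
  define F where "F t = integral {a..t} h" for t
  define bad where "bad n t u \<longleftrightarrow> u \<in> {a..b} \<and> u \<noteq> t \<and> norm (F u - F t - (u - t) *\<^sub>R h t) > \<bar>u - t\<bar> / Suc n" for n :: nat and t u
  define B where "B n = {t\<in>{a<..<b}. \<forall>d>0. \<exists>u. \<bar>u - t\<bar> < d \<and> bad n t u}" for n
  have F_diff: "F v - F u = integral {u..v} h" if "a \<le> u" "u \<le> v" "v \<le> b" for u v
    using Henstock_Kurzweil_Integration.integral_combine[of a u v h] that integrable_on_subinterval[OF int, of a v]
    by (auto simp: F_def algebra_simps)
  have neg: "negligible (B n)" for n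
    unfolding negligible_outer_le
  proof (intro allI impI)
    fix e :: real assume e: "e > 0"
    \<comment> \<open>Each selected interval misses by more than its length over
      \<open>Suc n\<close>, so with this bound the lengths add up to at most
      \<open>e\<close>.\<close>
    obtain \<gamma> where \<gamma>: "gauge \<gamma>" and \<gamma>p: "\<And>p. p tagged_partial_division_of cbox a b \<Longrightarrow> \<gamma> fine p \<Longrightarrow>
        (\<Sum>(x,k)\<in>p. norm (measure lborel k *\<^sub>R h x - integral k h)) < e / Suc n"
      using Henstock_lemma[of h a b "e / Suc n"] int e by auto
    \<comment> \<open>Centre and radius of the interval between a bad point and its partner, since
      the covering theorem is about balls.\<close>
    define c where "c = (\<lambda>(t,u). (t + u) / (2::real))"
    define r where "r = (\<lambda>(t,u). \<bar>u - t\<bar> / (2::real))"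
    define I where "I = {(t,u). t \<in> B n \<and> bad n t u \<and> {min t u..max t u} \<subseteq> \<gamma> t}"
    have cb: "cball (c (t,u)) (r (t,u)) = {min t u..max t u}" for t u
      unfolding cball_eq_atLeastAtMost c_def r_def by (auto simp: min_def max_def field_simps)
    obtain C where C: "countable C" "C \<subseteq> I"
        "pairwise (\<lambda>i j. disjnt (cball (c i) (r i)) (cball (c j) (r j))) C"
        "negligible (B n - (\<Union>i\<in>C. cball (c i) (r i)))"
    proof (rule Vitali_covering_theorem_cballs[of I r "B n" c])
      show "0 < r i" if "i \<in> I" for i using that by (auto simp: I_def bad_def r_def)
      fix x d :: real assume x: "x \<in> B n" and d: "0 < d"
      obtain \<rho> where \<rho>: "\<rho> > 0" "ball x \<rho> \<subseteq> \<gamma> x" using \<gamma> by (meson gauge_def openE)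
      obtain u where u: "\<bar>u - x\<bar> < min d \<rho>" "bad n x u"
        using x d \<rho> by (auto simp: B_def) (metis min_less_iff_conj)
      have "{min x u..max x u} \<subseteq> ball x \<rho>" using u by (auto simp: dist_real_def min_def max_def split: if_splits)
      then have "(x,u) \<in> I" using x u \<rho> by (auto simp: I_def)
      moreover have "r (x,u) < d" using u d by (auto simp: r_def)
      ultimately show "\<exists>i. i \<in> I \<and> x \<in> cball (c i) (r i) \<and> r i < d"
        using cb by (intro exI[of _ "(x,u)"]) auto
    qed
    have bound: "measure lebesgue (\<Union>i\<in>C'. cball (c i) (r i)) \<le> e" if C': "C' \<subseteq> C" "finite C'" for C'
    proof -
      define p where "p = (\<lambda>(t,u). (t, {min t u..max t u})) ` C'"
      have mem: "t \<in> {a<..<b}" "u \<in> {a..b}" "u \<noteq> t" "norm (F u - F t - (u - t) *\<^sub>R h t) > \<bar>u - t\<bar> / Suc n"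
         "{min t u..max t u} \<subseteq> \<gamma> t" if "(t,u) \<in> C'" for t u
        using that C' C(2) by (auto simp: I_def bad_def B_def)
      have disj: "{min t u..max t u} \<inter> {min t' u'..max t' u'} = {}" if "(t,u) \<in> C'" "(t',u') \<in> C'" "(t,u) \<noteq> (t',u')" for t u t' u'
      proof -
        have "(t,u) \<in> C" "(t',u') \<in> C" using that C' by auto
        from pairwiseD[OF C(3) this that(3)] show ?thesis by (simp add: cb disjnt_def)
      qed
      have inj: "inj_on (\<lambda>(t,u). (t, {min t u..max t u})) C'"
      proof (rule inj_onI)
        fix y z assume yz: "y \<in> C'" "z \<in> C'" "(case y of (t, u) \<Rightarrow> (t, {min t u..max t u})) = (case z of (t, u) \<Rightarrow> (t, {min t u..max t u}))"
        obtain t u t' u' where [simp]: "y = (t,u)" "z = (t',u')" by fastforce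
        show "y = z"
        proof (rule ccontr)
          assume "y \<noteq> z"
          with disj[of t u t' u'] yz have "{min t u..max t u} = {}" by auto
          then show False by auto
        qed
      qed
      have pp: "p tagged_partial_division_of cbox a b"
        unfolding tagged_partial_division_of_def
      proof (intro conjI allI impI)
        show "finite p" using C' by (simp add: p_def)
        fix x K assume xK: "(x,K) \<in> p"
        then obtain t u where tu: "(t,u) \<in> C'" "x = t" "K = {min t u..max t u}" by (auto simp: p_def)
        show "x \<in> K" using tu by auto
        show "K \<subseteq> cbox a b" using mem[OF tu(1)] tu by auto
        show "\<exists>a b. K = cbox a b" using tu by auto
      next
        fix x K x' K' assume xK': "(x,K) \<in> p \<and> (x',K') \<in> p \<and> (x, K) \<noteq> (x', K')"
        then obtain t u where tu: "(t,u) \<in> C'" "x = t" "K = {min t u..max t u}" by (auto simp: p_def)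
        obtain t' u' where tu': "(t',u') \<in> C'" "x' = t'" "K' = {min t' u'..max t' u'}" using xK' by (auto simp: p_def)
        have "K \<inter> K' = {}" using disj[OF tu(1) tu'(1)] xK' tu tu' by auto
        then show "interior K \<inter> interior K' = {}" using interior_subset by blast
      qed
      have fine: "\<gamma> fine p" using mem(5) by (auto simp: fine_def p_def)
      have "measure lebesgue (\<Union>i\<in>C'. cball (c i) (r i)) \<le> (\<Sum>i\<in>C'. measure lebesgue (cball (c i) (r i)))"
        by (rule measure_UNION_le) (use C' in auto)
      also have "\<dots> = (\<Sum>(t,u)\<in>C'. \<bar>u - t\<bar>)"
        by (rule sum.cong) (auto simp: cb max_def min_def)
      also have "\<dots> \<le> (\<Sum>(t,u)\<in>C'. Suc n * norm (measure lborel {min t u..max t u} *\<^sub>R h t - integral {min t u..max t u} h))"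
      proof (rule sum_mono, clarify)
        fix t u assume tu: "(t,u) \<in> C'"
        have "norm (F u - F t - (u - t) *\<^sub>R h t) = norm (measure lborel {min t u..max t u} *\<^sub>R h t - integral {min t u..max t u} h)"
        proof (cases "t \<le> u")
          case True
          then show ?thesis using F_diff[of t u] mem[OF tu] by (simp add: norm_minus_commute)
        next
          case False
          then have "F u - F t = - integral {u..t} h" using F_diff[of u t] mem[OF tu] by (simp add: algebra_simps)
          then have "F u - F t - (u - t) *\<^sub>R h t = measure lborel {min t u..max t u} *\<^sub>R h t - integral {min t u..max t u} h"
            using False by (simp add: algebra_simps min_def max_def)
          then show ?thesis by simp
        qed
        then show "\<bar>u - t\<bar> \<le> Suc n * norm (measure lborel {min t u..max t u} *\<^sub>R h t - integral {min t u..max t u} h)"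
          using mem(4)[OF tu] by (simp add: field_simps)
      qed
      also have "\<dots> = Suc n * (\<Sum>(t,u)\<in>C'. norm (measure lborel {min t u..max t u} *\<^sub>R h t - integral {min t u..max t u} h))"
        by (simp add: sum_distrib_left split_beta)
      also have "\<dots> = Suc n * (\<Sum>(x,k)\<in>p. norm (measure lborel k *\<^sub>R h x - integral k h))"
        unfolding p_def by (subst sum.reindex[OF inj]) (auto simp: o_def split_beta)
      also have "\<dots> \<le> Suc n * (e / Suc n)"
        using \<gamma>p[OF pp fine] by (intro mult_left_mono) auto
      finally show ?thesis by simp
    qed
    let ?U = "\<Union>i\<in>C. cball (c i) (r i)"
    have U: "?U \<in> lmeasurable" "measure lebesgue ?U \<le> e"
      using fmeasurable_UN_bound[of C "\<lambda>i. cball (c i) (r i)" lebesgue e] measure_UN_bound[of C "\<lambda>i. cball (c i) (r i)" lebesgue e] C(1) bound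
      by auto
    show "\<exists>T. B n \<subseteq> T \<and> T \<in> lmeasurable \<and> measure lebesgue T \<le> e"
    proof (intro exI conjI)
      show "B n \<subseteq> ?U \<union> (B n - ?U)" by auto
      show "?U \<union> (B n - ?U) \<in> lmeasurable"
        by (rule fmeasurable.Un[OF U(1) negligible_imp_measurable[OF C(4)]])
      have "measure lebesgue (?U \<union> (B n - ?U)) \<le> measure lebesgue ?U + measure lebesgue (B n - ?U)"
        by (rule measure_Un_le) (use U(1) C(4) in \<open>auto simp: fmeasurableD negligible_imp_sets\<close>)
      also have "\<dots> = measure lebesgue ?U" using negligible_imp_measure0[OF C(4)] by simp
      finally show "measure lebesgue (?U \<union> (B n - ?U)) \<le> e" using U by linarith
    qed
  qed
  show ?thesis
  proof
    show "negligible (\<Union>n. B n)" using neg by (auto intro: negligible_countable_Union)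
    fix t assume t: "t \<in> {a<..<b} - (\<Union>n. B n)"
    have "\<exists>d>0. \<forall>u. norm (u - t) < d \<longrightarrow> norm (F u - F t - (u - t) *\<^sub>R h t) \<le> e * norm (u - t)" if e: "e > 0" for e
    proof -
      obtain n where n: "1 / Suc n < e" using e nat_approx_posE by auto
      have "t \<notin> B n" using t by auto
      then obtain d where d: "d > 0" "\<And>u. \<bar>u - t\<bar> < d \<Longrightarrow> \<not> bad n t u" using t by (auto simp: B_def)
      \<comment> \<open>Keeps \<open>u\<close> in \<open>{a..b}\<close>, the only points that
        \<open>bad\<close> speaks about.\<close>
      define d' where "d' = min d (min (t - a) (b - t))"
      have "norm (F u - F t - (u - t) *\<^sub>R h t) \<le> e * norm (u - t)" if u: "norm (u - t) < d'" for u
      proof (cases "u = t")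
        case False
        have "u \<in> {a..b}" using u by (auto simp: d'_def)
        then have "norm (F u - F t - (u - t) *\<^sub>R h t) \<le> \<bar>u - t\<bar> / Suc n"
          using d(2)[of u] u False by (auto simp: bad_def d'_def not_less)
        also have "\<dots> \<le> e * norm (u - t)" using n mult_right_mono[of "1 / Suc n" e "\<bar>u - t\<bar>"] by simp
        finally show ?thesis .
      qed auto
      moreover have "d' > 0" using d t by (auto simp: d'_def)
      ultimately show ?thesis by blast
    qed
    then show "((\<lambda>t. integral {a..t} h) has_vector_derivative h t) (at t)"
      unfolding has_vector_derivative_def has_derivative_at_alt F_def[symmetric]
      by (auto simp: bounded_linear_scaleR_left)
  qed
qed

text \<open>The norm of the integrand is split into its truncation at level \<open>n\<close> and an
  excess \<open>q\<close> with integral below \<open>e/2\<close>: the bounded part contributes at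
  most \<open>n\<close> times the total length, the excess at most its whole integral.\<close>

lemma abs_cont_on_integral:
  fixes h :: "real \<Rightarrow> 'a::euclidean_space"
  assumes h: "h absolutely_integrable_on {a..b}"
    and F: "\<And>t. t \<in> {a..b} \<Longrightarrow> F t = c + integral {a..t} h"
  shows "abs_cont_on a b F"
  unfolding abs_cont_on_def
proof (intro allI impI)
  fix e :: real assume e: "e > 0"
  define m where "m n x = min (norm (h x)) (real n)" for n x
  have nh: "(\<lambda>x. norm (h x)) integrable_on {a..b}" "h integrable_on {a..b}"
    using h by (auto simp: absolutely_integrable_on_def)
  have "(\<lambda>x. norm (h x)) absolutely_integrable_on {a..b}"
    using h by (auto simp: absolutely_integrable_on_def)
  then have mi: "m n integrable_on {a..b}" for n
    unfolding m_def by (intro set_lebesgue_integral_eq_integral(1) absolutely_integrable_min_1) auto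
  have "(\<lambda>n. integral {a..b} (m n)) \<longlonglongrightarrow> integral {a..b} (\<lambda>x. norm (h x))"
  proof (rule dominated_convergence(2)[OF mi nh(1)])
    show "norm (m n x) \<le> norm (h x)" for n x by (auto simp: m_def)
    fix x
    obtain N :: nat where "norm (h x) \<le> N" using real_arch_simple by blast
    then have "\<forall>n\<ge>N. m n x = norm (h x)" by (auto simp: m_def)
    then show "(\<lambda>n. m n x) \<longlonglongrightarrow> norm (h x)"
      by (intro tendsto_eventually) (auto simp: eventually_sequentially)
  qed
  then obtain n where n: "\<bar>integral {a..b} (m n) - integral {a..b} (\<lambda>x. norm (h x))\<bar> < e/2"
    using e half_gt_zero LIMSEQ_iff[of "\<lambda>n. integral {a..b} (m n)"] by (metis le_refl real_norm_def)
  define q where "q x = norm (h x) - m n x" for x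
  have q: "q integrable_on {a..b}" "integral {a..b} q < e/2" "\<And>x. q x \<ge> 0"
    unfolding q_def[abs_def] using integrable_diff[OF nh(1) mi[of n]] n Henstock_Kurzweil_Integration.integral_diff[OF nh(1) mi, of n]
    by linarith+ (auto simp: m_def)
  \<comment> \<open>\<open>n * \<delta>\<close> is at most \<open>e/2\<close>; the added 1 covers
    \<open>n = 0\<close>.\<close>
  define \<delta> where "\<delta> = e / (2 * (n + 1))"
  show "\<exists>\<delta>>0. \<forall>D S. D division_of S \<and> S \<subseteq> {a..b} \<and> (\<Sum>k\<in>D. Sup k - Inf k) < \<delta> \<longrightarrow>
        (\<Sum>k\<in>D. norm (F (Sup k) - F (Inf k))) < e"
  proof (intro exI conjI allI impI)
    show "\<delta> > 0" using e by (simp add: \<delta>_def)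
    fix D S assume D: "D division_of S \<and> S \<subseteq> {a..b} \<and> (\<Sum>k\<in>D. Sup k - Inf k) < \<delta>"
    have "norm (F (Sup k) - F (Inf k)) \<le> n * (Sup k - Inf k) + integral k q" if k: "k \<in> D" for k
    proof -
      obtain u v where uv: "k = {u..v}" "u \<le> v" and ab: "a \<le> u" "v \<le> b"
        using division_of_realE[of D S a b k] D k by blast
      then have kab: "{u..v} \<subseteq> {a..b}" by auto
      have "F v - F u = integral {u..v} h"
        using Henstock_Kurzweil_Integration.integral_combine[of a u v h] F[of u] F[of v] ab uv integrable_on_subinterval[OF nh(2), of a v]
        by (auto simp: algebra_simps)
      also have "norm \<dots> \<le> integral {u..v} (\<lambda>x. norm (h x))"
        by (intro integral_norm_bound_integral integrable_on_subinterval[OF nh(2) kab] integrable_on_subinterval[OF nh(1) kab]) auto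
      also have "\<dots> = integral {u..v} (m n) + integral {u..v} q"
        using Henstock_Kurzweil_Integration.integral_add[OF integrable_on_subinterval[OF mi kab, of n] integrable_on_subinterval[OF q(1) kab]]
        by (simp add: q_def)
      also have "integral {u..v} (m n) \<le> integral {u..v} (\<lambda>x. real n)"
        by (intro integral_le integrable_on_subinterval[OF mi kab]) (auto simp: m_def)
      finally show ?thesis using uv by (simp add: algebra_simps)
    qed
    then have "(\<Sum>k\<in>D. norm (F (Sup k) - F (Inf k))) \<le> (\<Sum>k\<in>D. n * (Sup k - Inf k) + integral k q)"
      by (rule sum_mono)
    also have "\<dots> = n * (\<Sum>k\<in>D. Sup k - Inf k) + (\<Sum>k\<in>D. integral k q)"
      by (simp add: sum.distrib sum_distrib_left)
    also have "(\<Sum>k\<in>D. integral k q) = integral S q"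
      by (rule integral_combine_division_topdown[symmetric]) (use D q(1) in \<open>auto intro: integrable_on_subdivision\<close>)
    also have "integral S q \<le> integral {a..b} q"
      by (rule integral_subset_le) (use D q in \<open>auto intro: integrable_on_subdivision\<close>)
    also have "n * (\<Sum>k\<in>D. Sup k - Inf k) \<le> n * \<delta>" using D by (intro mult_left_mono) auto
    also have "n * \<delta> \<le> e/2" using e by (simp add: \<delta>_def field_simps)
    finally show "(\<Sum>k\<in>D. norm (F (Sup k) - F (Inf k))) < e" using q by linarith
  qed
qed

text \<open>A single transfer principle for what is built from absolutely continuous functions:
  differences, inner products, the exponential of an indefinite integral, and multiples.\<close>

lemma abs_cont_on_dominated:
  assumes p: "abs_cont_on a b p" and q: "abs_cont_on a b q" and C: "C \<ge> 0"
    and r: "\<And>u v. a \<le> u \<Longrightarrow> u \<le> v \<Longrightarrow> v \<le> b \<Longrightarrow> norm (r v - r u) \<le> C * (norm (p v - p u) + norm (q v - q u))"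
  shows "abs_cont_on a b r"
  unfolding abs_cont_on_def
proof (intro allI impI)
  fix e :: real assume e: "e > 0"
  define e' where "e' = e / (2 * (C + 1))"
  have e': "e' > 0" "C * (e' + e') < e"
  proof -
    show "e' > 0" using e C by (auto simp: e'_def)
    have "e' + e' = e / (C + 1)" unfolding e'_def using C by (simp add: divide_simps)
    moreover have "C * (e / (C + 1)) < e" using e C by (simp add: divide_simps)
    ultimately show "C * (e' + e') < e" by simp
  qed
  obtain \<delta>1 where \<delta>1: "\<delta>1 > 0" "\<And>D S. D division_of S \<Longrightarrow> S \<subseteq> {a..b} \<Longrightarrow> (\<Sum>k\<in>D. Sup k - Inf k) < \<delta>1 \<Longrightarrow>
        (\<Sum>k\<in>D. norm (p (Sup k) - p (Inf k))) < e'"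
    using p e' unfolding abs_cont_on_def by meson
  obtain \<delta>2 where \<delta>2: "\<delta>2 > 0" "\<And>D S. D division_of S \<Longrightarrow> S \<subseteq> {a..b} \<Longrightarrow> (\<Sum>k\<in>D. Sup k - Inf k) < \<delta>2 \<Longrightarrow>
        (\<Sum>k\<in>D. norm (q (Sup k) - q (Inf k))) < e'"
    using q e' unfolding abs_cont_on_def by meson
  have "(\<Sum>k\<in>D. norm (r (Sup k) - r (Inf k))) < e" if D: "D division_of S" "S \<subseteq> {a..b}" "(\<Sum>k\<in>D. Sup k - Inf k) < min \<delta>1 \<delta>2" for D S
  proof -
    have "(\<Sum>k\<in>D. norm (r (Sup k) - r (Inf k))) \<le> (\<Sum>k\<in>D. C * (norm (p (Sup k) - p (Inf k)) + norm (q (Sup k) - q (Inf k))))"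
    proof (rule sum_mono)
      fix k assume k: "k \<in> D"
      obtain u v where uv: "k = {u..v}" "u \<le> v" "a \<le> u" "v \<le> b" by (rule division_of_realE[OF D(1,2) k])
      then show "norm (r (Sup k) - r (Inf k)) \<le> C * (norm (p (Sup k) - p (Inf k)) + norm (q (Sup k) - q (Inf k)))"
        using uv r by auto
    qed
    also have "\<dots> = C * ((\<Sum>k\<in>D. norm (p (Sup k) - p (Inf k))) + (\<Sum>k\<in>D. norm (q (Sup k) - q (Inf k))))"
      by (simp add: sum.distrib flip: sum_distrib_left)
    also have "\<dots> \<le> C * (e' + e')"
      using \<delta>1(2)[OF D(1,2)] \<delta>2(2)[OF D(1,2)] D(3) C by (intro mult_left_mono add_mono) auto
    finally show ?thesis using e' by linarith
  qed
  then show "\<exists>\<delta>>0. \<forall>D S. D division_of S \<and> S \<subseteq> {a..b} \<and> (\<Sum>k\<in>D. Sup k - Inf k) < \<delta> \<longrightarrow>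
        (\<Sum>k\<in>D. norm (r (Sup k) - r (Inf k))) < e"
    using \<delta>1(1) \<delta>2(1) by (intro exI[of _ "min \<delta>1 \<delta>2"]) auto
qed

lemma abs_cont_imp_continuous_on:
  assumes "abs_cont_on a b p"
  shows "continuous_on {a..b} p"
  unfolding continuous_on_iff
proof (intro ballI allI impI)
  fix x e :: real assume x: "x \<in> {a..b}" and e: "e > 0"
  obtain \<delta> where \<delta>: "\<delta> > 0" "\<And>D S. D division_of S \<Longrightarrow> S \<subseteq> {a..b} \<Longrightarrow> (\<Sum>k\<in>D. Sup k - Inf k) < \<delta> \<Longrightarrow>
        (\<Sum>k\<in>D. norm (p (Sup k) - p (Inf k))) < e"
    using assms e unfolding abs_cont_on_def by meson
  have "dist (p y) (p x) < e" if y: "y \<in> {a..b}" "dist y x < \<delta>" for y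
  proof -
    have "{cbox (min x y) (max x y)} division_of cbox (min x y) (max x y)"
      by (rule division_of_self) (auto simp: min_def max_def)
    from \<delta>(2)[OF this] have "norm (p (max x y) - p (min x y)) < e"
      using x y by (auto simp: dist_real_def min_def max_def split: if_splits)
    then show ?thesis by (auto simp: dist_norm min_def max_def norm_minus_commute split: if_splits)
  qed
  then show "\<exists>d>0. \<forall>x'\<in>{a..b}. dist x' x < d \<longrightarrow> dist (p x') (p x) < e" using \<delta> by blast
qed

lemma abs_cont_on_inner:
  fixes p q :: "real \<Rightarrow> 'a::euclidean_space"
  assumes p: "abs_cont_on a b p" and q: "abs_cont_on a b q"
  shows "abs_cont_on a b (\<lambda>t. p t \<bullet> q t)"
proof -
  have "bounded (p ` {a..b})" "bounded (q ` {a..b})"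
    using p q by (auto intro!: compact_imp_bounded compact_continuous_image abs_cont_imp_continuous_on)
  then obtain P Q where PQ: "P > 0" "Q > 0" "\<And>t. t \<in> {a..b} \<Longrightarrow> norm (p t) \<le> P" "\<And>t. t \<in> {a..b} \<Longrightarrow> norm (q t) \<le> Q"
    unfolding bounded_pos by auto
  show ?thesis
  proof (rule abs_cont_on_dominated[OF p q, of "P + Q"])
    fix u v assume uv: "a \<le> u" "u \<le> v" "v \<le> b"
    have "p v \<bullet> q v - p u \<bullet> q u = (p v - p u) \<bullet> q v + p u \<bullet> (q v - q u)"
      by (simp add: inner_diff_left inner_diff_right)
    also have "norm \<dots> \<le> norm (p v - p u) * norm (q v) + norm (p u) * norm (q v - q u)"
      by (metis norm_triangle_mono Cauchy_Schwarz_ineq2 real_norm_def)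
    also have "\<dots> \<le> norm (p v - p u) * (P + Q) + (P + Q) * norm (q v - q u)"
      using PQ(1,2) PQ(3)[of u] PQ(4)[of v] uv by (intro add_mono mult_left_mono mult_right_mono) auto
    finally show "norm (p v \<bullet> q v - p u \<bullet> q u) \<le> (P + Q) * (norm (p v - p u) + norm (q v - q u))"
      by (simp add: algebra_simps)
  qed (use PQ in auto)
qed

section \<open>Gronwall inequality and Picard iteration\<close>

lemma locally_integrableD:
  "locally_integrable L \<Longrightarrow> T \<ge> 0 \<Longrightarrow> L absolutely_integrable_on {0..T}"
  by (simp add: locally_integrable_def)

lemma continuous_on_halflineI:
  fixes x :: "real \<Rightarrow> 'a::topological_space"
  assumes "\<And>T. T \<ge> 0 \<Longrightarrow> continuous_on {0..T} x"
  shows "continuous_on {0..} x"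
  unfolding continuous_on_eq_continuous_within
proof
  fix t :: real assume t: "t \<in> {0..}"
  have "at t within {0..} = at t within {0..t + 1}"
    by (rule at_within_nhd[of t "{..<t+1}"]) auto
  then show "continuous (at t within {0..}) x"
    using assms[of "t + 1"] t by (simp add: continuous_on_eq_continuous_within)
qed

lemma AC_halfline_integral:
  fixes h :: "real \<Rightarrow> 'a::euclidean_space"
  assumes h: "\<And>T. T \<ge> 0 \<Longrightarrow> h absolutely_integrable_on {0..T}"
    and x: "\<And>t. t \<ge> 0 \<Longrightarrow> x t = c + integral {0..t} h"
  shows "x \<in> AC_halfline"
    and "AE t in lebesgue. t \<in> {0..} \<longrightarrow> (x has_vector_derivative h t) (at t)"
proof -
  show "x \<in> AC_halfline"
    unfolding AC_halfline_def using abs_cont_on_integral[OF h, of _ x c] x by auto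
  have "\<exists>N. negligible N \<and> (\<forall>t\<in>{0<..<real n} - N. ((\<lambda>t. integral {0..t} h) has_vector_derivative h t) (at t))" for n
    using lebesgue_differentiation[of h 0 "real n"] h[of "real n"]
    by (metis absolutely_integrable_on_def of_nat_0_le_iff)
  then obtain N where N: "\<And>n. negligible (N n)"
    "\<And>n t. t \<in> {0<..<real n} - N n \<Longrightarrow> ((\<lambda>t. integral {0..t} h) has_vector_derivative h t) (at t)"
    by metis
  \<comment> \<open>Time 0 is excluded because the derivative is two-sided and the values of
    \<open>x\<close> at negative times are arbitrary.\<close>
  have "insert 0 (\<Union>n. N n) \<in> null_sets lebesgue"
    using N(1) by (auto simp: negligible_iff_null_sets[symmetric] intro: negligible_countable_Union)
  moreover have "(x has_vector_derivative h t) (at t)" if "t \<in> {0..}" "t \<notin> insert 0 (\<Union>n. N n)" for t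
  proof -
    obtain n :: nat where n: "t < n" using reals_Archimedean2 by blast
    have "((\<lambda>t. c + integral {0..t} h) has_vector_derivative h t) (at t)"
      using N(2)[of t n] that n by (auto intro!: derivative_eq_intros)
    then show ?thesis
    proof (rule has_vector_derivative_transform_within_open[of _ _ _ "{0<..}"])
      show "open {0::real<..}" by simp
      show "t \<in> {0<..}" using that by (metis atLeast_iff greaterThan_iff insertCI order_le_less)
      show "\<And>s. s \<in> {0<..} \<Longrightarrow> c + integral {0..s} h = x s" using x by auto
    qed
  qed
  ultimately show "AE t in lebesgue. t \<in> {0..} \<longrightarrow> (x has_vector_derivative h t) (at t)"
    by (intro AE_I'[of "insert 0 (\<Union>n. N n)"]) auto
qed

lemma abs_cont_on_integral_AE:
  fixes x :: "real \<Rightarrow> 'a::euclidean_space"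
  assumes ac: "abs_cont_on a b x" and ab: "a \<le> b"
    and d: "AE t in lebesgue. t \<in> {a..b} \<longrightarrow> (x has_vector_derivative h t) (at t)"
  shows "(h has_integral (x b - x a)) {a..b}"
proof -
  obtain N where N: "N \<in> null_sets lebesgue" "\<And>t. t \<notin> N \<Longrightarrow> t \<in> {a..b} \<longrightarrow> (x has_vector_derivative h t) (at t)"
    using AE_E3[OF d] by auto
  show ?thesis
    by (rule abs_cont_has_integral[OF ac ab, of N]) (use N in \<open>auto simp: negligible_iff_null_sets\<close>)
qed

text \<open>The exponential of an absolutely continuous function is absolutely continuous, so the
  chain rule may be integrated although it holds only almost everywhere. The factor 2 in the
  exponent makes the integral less than half of the weight at \<open>t\<close>; that half is the
  gain in \<open>gronwall\<close> and the contraction constant in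
  \<open>picard_halfline\<close>.\<close>

lemma exp_weight_has_integral:
  fixes L :: "real \<Rightarrow> real"
  assumes L: "L absolutely_integrable_on {0..T}" and nn: "\<And>t. t \<in> {0..T} \<Longrightarrow> L t \<ge> (0::real)"
    and t: "t \<in> {0..T}"
  shows "((\<lambda>s. L s * exp (2 * integral {0..s} L)) has_integral (exp (2 * integral {0..t} L) - 1) / 2) {0..t}"
proof -
  define \<Lambda> where "\<Lambda> s = integral {0..s} L" for s
  have Lt: "L absolutely_integrable_on {0..t}" using absolutely_integrable_on_subinterval[OF L] t by auto
  have ac: "abs_cont_on 0 t \<Lambda>"
    by (rule abs_cont_on_integral[OF Lt, of _ 0]) (simp add: \<Lambda>_def)
  have int: "L integrable_on {u..v}" if "0 \<le> u" "v \<le> t" for u v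
    using absolutely_integrable_on_subinterval[OF Lt, of u v] that set_lebesgue_integral_eq_integral(1) by auto
  have mono: "\<Lambda> u \<le> \<Lambda> v" if "0 \<le> u" "u \<le> v" "v \<le> t" for u v
    unfolding \<Lambda>_def using that t nn by (intro integral_subset_le int) auto
  have lip: "exp (2 * \<Lambda> v) / 2 - exp (2 * \<Lambda> u) / 2 \<le> exp (2 * \<Lambda> t) * (\<Lambda> v - \<Lambda> u)"
    "exp (2 * \<Lambda> u) / 2 \<le> exp (2 * \<Lambda> v) / 2" if "0 \<le> u" "u \<le> v" "v \<le> t" for u v
  proof -
    have "exp (2 * \<Lambda> u) = exp (2 * \<Lambda> v) * exp (2 * (\<Lambda> u - \<Lambda> v))" by (simp add: algebra_simps flip: exp_add)
    also have "\<dots> \<ge> exp (2 * \<Lambda> v) * (1 + 2 * (\<Lambda> u - \<Lambda> v))"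
      by (intro mult_left_mono exp_ge_add_one_self) auto
    finally have "exp (2 * \<Lambda> v) / 2 - exp (2 * \<Lambda> u) / 2 \<le> exp (2 * \<Lambda> v) * (\<Lambda> v - \<Lambda> u)" by (simp add: algebra_simps)
    also have "\<dots> \<le> exp (2 * \<Lambda> t) * (\<Lambda> v - \<Lambda> u)"
      using mono[of u v] mono[of v t] that by (intro mult_right_mono) auto
    finally show "exp (2 * \<Lambda> v) / 2 - exp (2 * \<Lambda> u) / 2 \<le> exp (2 * \<Lambda> t) * (\<Lambda> v - \<Lambda> u)" .
    show "exp (2 * \<Lambda> u) / 2 \<le> exp (2 * \<Lambda> v) / 2" using mono that by auto
  qed
  have acE: "abs_cont_on 0 t (\<lambda>s. exp (2 * \<Lambda> s) / 2)"
  proof (rule abs_cont_on_dominated[OF ac ac, of "exp (2 * \<Lambda> t)"])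
    fix u v assume uv: "0 \<le> u" "u \<le> v" "v \<le> t"
    have "norm (exp (2 * \<Lambda> v) / 2 - exp (2 * \<Lambda> u) / 2) \<le> exp (2 * \<Lambda> t) * (\<Lambda> v - \<Lambda> u)"
      using lip[OF uv] by auto
    also have "\<dots> \<le> exp (2 * \<Lambda> t) * (norm (\<Lambda> v - \<Lambda> u) + norm (\<Lambda> v - \<Lambda> u))"
      by (rule mult_left_mono) (unfold real_norm_def, linarith, simp)
    finally show "norm (exp (2 * \<Lambda> v) / 2 - exp (2 * \<Lambda> u) / 2) \<le> exp (2 * \<Lambda> t) * (norm (\<Lambda> v - \<Lambda> u) + norm (\<Lambda> v - \<Lambda> u))" .
  qed auto
  obtain N where N: "negligible N" "\<And>s. s \<in> {0<..<t} - N \<Longrightarrow> (\<Lambda> has_vector_derivative L s) (at s)"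
    using lebesgue_differentiation[OF int[of 0 t]] unfolding \<Lambda>_def by auto
  have "((\<lambda>s. L s * exp (2 * \<Lambda> s)) has_integral (exp (2 * \<Lambda> t) / 2 - exp (2 * \<Lambda> 0) / 2)) {0..t}"
  proof (rule abs_cont_has_integral[OF acE])
    show "0 \<le> t" using t by simp
    show "negligible (N \<union> {0,t})" using N(1) by auto
    fix s assume "s \<in> {0..t} - (N \<union> {0,t})"
    then have "(\<Lambda> has_real_derivative L s) (at s)"
      using N(2)[of s] by (simp add: has_real_derivative_iff_has_vector_derivative)
    then have "((\<lambda>s. exp (2 * \<Lambda> s) / 2) has_real_derivative L s * exp (2 * \<Lambda> s)) (at s)"
      by (auto intro!: derivative_eq_intros)
    then show "((\<lambda>s. exp (2 * \<Lambda> s) / 2) has_vector_derivative L s * exp (2 * \<Lambda> s)) (at s)"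
      by (simp add: has_real_derivative_iff_has_vector_derivative)
  qed
  moreover have "\<Lambda> 0 = 0" by (simp add: \<Lambda>_def)
  ultimately show ?thesis by (simp add: \<Lambda>_def diff_divide_distrib)
qed

lemma absolutely_integrable_times_continuous:
  fixes L y :: "real \<Rightarrow> real"
  assumes L: "L absolutely_integrable_on {a..b}" and y: "continuous_on {a..b} y"
  shows "(\<lambda>s. L s * y s) absolutely_integrable_on {a..b}"
proof -
  have "(\<lambda>s. y s * L s) absolutely_integrable_on {a..b}"
    by (rule absolutely_integrable_bounded_measurable_product_real[OF _ _ _ L])
      (auto intro!: continuous_imp_measurable_on_sets_lebesgue compact_imp_bounded compact_continuous_image y)
  then show ?thesis by (simp add: mult.commute)
qed

text \<open>The maximum of $y(t) \exp(-2\int_0^t L)$ bounds half of itself plus \<open>A\<close>; this avoids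
  differentiating and costs only the factors 2.\<close>

lemma gronwall:
  fixes L y :: "real \<Rightarrow> real"
  assumes L: "L absolutely_integrable_on {0..T}" and nn: "\<And>t. t \<in> {0..T} \<Longrightarrow> L t \<ge> 0"
    and y: "continuous_on {0..T} y" and A: "A \<ge> 0"
    and le: "\<And>t. t \<in> {0..T} \<Longrightarrow> y t \<le> A + integral {0..t} (\<lambda>s. L s * y s)"
    and t: "t \<in> {0..T}"
  shows "y t \<le> 2 * A * exp (2 * integral {0..T} L)"
proof -
  define \<Lambda> where "\<Lambda> s = integral {0..s} L" for s
  have Li: "L integrable_on {0..T}" using L set_lebesgue_integral_eq_integral(1) by auto
  have \<Lambda>c: "continuous_on {0..T} \<Lambda>" unfolding \<Lambda>_def by (rule indefinite_integral_continuous_1[OF Li])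
  have int: "L absolutely_integrable_on {0..s}" if "s \<in> {0..T}" for s
    using absolutely_integrable_on_subinterval[OF L, of 0 s] that by auto
  have \<Lambda>nn: "0 \<le> \<Lambda> s" "\<Lambda> s \<le> \<Lambda> T" if "s \<in> {0..T}" for s
  proof -
    show "0 \<le> \<Lambda> s" unfolding \<Lambda>_def using that nn int[OF that] set_lebesgue_integral_eq_integral(1) by (intro integral_nonneg) auto
    show "\<Lambda> s \<le> \<Lambda> T" unfolding \<Lambda>_def using that nn int[OF that] Li set_lebesgue_integral_eq_integral(1) by (intro integral_subset_le) auto
  qed
  define z where "z s = y s * exp (- 2 * \<Lambda> s)" for s
  have zc: "continuous_on {0..T} z" unfolding z_def by (intro continuous_intros y \<Lambda>c)
  have "{0..T} \<noteq> {}" using t by auto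
  then obtain m where m: "m \<in> {0..T}" "\<And>s. s \<in> {0..T} \<Longrightarrow> z s \<le> z m"
    using continuous_attains_sup[OF _ _ zc] by auto
  have yz: "y s = z s * exp (2 * \<Lambda> s)" for s by (simp add: z_def flip: exp_add)
  have zm: "z m \<le> 2 * A"
  \<comment> \<open>Only a positive maximum requires the integral inequality; positivity also allows
    a term to be dropped at the end.\<close>
  proof (cases "z m \<le> 0")
    case False
    have yb: "(\<lambda>s. L s * y s) absolutely_integrable_on {0..m}"
      by (rule absolutely_integrable_times_continuous[OF int[OF m(1)]])
        (use y m in \<open>auto intro: continuous_on_subset\<close>)
    have "y m \<le> A + integral {0..m} (\<lambda>s. L s * y s)" by (rule le[OF m(1)])
    also have "integral {0..m} (\<lambda>s. L s * y s) \<le> z m * ((exp (2 * \<Lambda> m) - 1) / 2)"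
    proof (rule has_integral_le)
      show "((\<lambda>s. L s * y s) has_integral integral {0..m} (\<lambda>s. L s * y s)) {0..m}"
        using yb set_lebesgue_integral_eq_integral(1) by auto
      show "((\<lambda>s. z m * (L s * exp (2 * \<Lambda> s))) has_integral z m * ((exp (2 * \<Lambda> m) - 1) / 2)) {0..m}"
        unfolding \<Lambda>_def by (intro has_integral_mult_right exp_weight_has_integral[OF L nn m(1)])
      fix s assume s: "s \<in> {0..m}"
      have "L s * y s = L s * exp (2 * \<Lambda> s) * z s" by (simp add: yz[of s])
      also have "\<dots> \<le> L s * exp (2 * \<Lambda> s) * z m" using s m nn[of s] by (intro mult_left_mono) auto
      finally show "L s * y s \<le> z m * (L s * exp (2 * \<Lambda> s))" by (simp add: mult_ac)
    qed
    finally have "z m * exp (2 * \<Lambda> m) \<le> A + z m * ((exp (2 * \<Lambda> m) - 1) / 2)" using yz by simp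
    then have "z m + z m * exp (2 * \<Lambda> m) \<le> 2 * A" by (simp add: field_simps)
    moreover have "0 \<le> z m * exp (2 * \<Lambda> m)" using False by simp
    ultimately show ?thesis by linarith
  qed (use A in auto)
  have "y t = z t * exp (2 * \<Lambda> t)" by (rule yz)
  also have "\<dots> \<le> (2 * A) * exp (2 * \<Lambda> t)" using m(2)[OF t] zm by (intro mult_right_mono) auto
  also have "\<dots> \<le> (2 * A) * exp (2 * \<Lambda> T)" using \<Lambda>nn[OF t] A by (intro mult_left_mono) auto
  finally show ?thesis by (simp add: \<Lambda>_def)
qed

lemma absolutely_integrable_superposition:
  fixes F :: "real \<Rightarrow> 'x::euclidean_space \<Rightarrow> 'x"
  assumes meas: "\<And>x. continuous_on {0..} x \<Longrightarrow> (\<lambda>t. F t (x t)) \<in> borel_measurable (lebesgue_on {0..})"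
    and L: "locally_integrable L"
    and lip: "\<And>t x y. t \<ge> 0 \<Longrightarrow> norm (F t x - F t y) \<le> L t * norm (x - y)"
    and bd: "\<And>t. t \<ge> 0 \<Longrightarrow> norm (F t 0) \<le> L t"
    and x: "continuous_on {0..} x" and T: "T \<ge> 0"
  shows "(\<lambda>t. F t (x t)) absolutely_integrable_on {0..T}"
proof -
  have Lnn: "L t \<ge> 0" if "t \<ge> 0" for t using bd[OF that] norm_ge_zero order_trans by blast
  have "bounded (x ` {0..T})"
    by (intro compact_imp_bounded compact_continuous_image continuous_on_subset[OF x]) auto
  then obtain B where B: "\<And>t. t \<in> {0..T} \<Longrightarrow> norm (x t) \<le> B" unfolding bounded_iff by (auto simp del: atLeastAtMost_iff)
  show ?thesis
  proof (rule measurable_bounded_by_integrable_imp_absolutely_integrable)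
    show "(\<lambda>t. F t (x t)) \<in> borel_measurable (lebesgue_on {0..T})"
      by (rule measurable_restrict_mono[OF meas[OF x]]) auto
    show "(\<lambda>t. L t * (1 + B)) integrable_on {0..T}"
      using locally_integrableD[OF L T] set_lebesgue_integral_eq_integral(1) by (intro integrable_on_mult_left) auto
    fix t assume t: "t \<in> {0..T}"
    have "norm (F t (x t)) \<le> norm (F t 0) + norm (F t (x t) - F t 0)" by (rule norm_triangle_sub)
    also have "\<dots> \<le> L t + L t * norm (x t - 0)" using t by (intro add_mono lip bd) auto
    also have "\<dots> \<le> L t + L t * B" using B[OF t] Lnn[of t] t by (intro add_mono mult_left_mono) auto
    finally show "norm (F t (x t)) \<le> L t * (1 + B)" by (simp add: algebra_simps)
  qed auto
qed

text \<open>Multiplying by $\exp(-2\int_0^t L)$ turns the integral operator into a contraction of the bounded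
  continuous functions on the whole half-line, so that no solutions have to be glued.\<close>

lemma picard_halfline:
  fixes F :: "real \<Rightarrow> 'x::euclidean_space \<Rightarrow> 'x"
  assumes int: "\<And>x T. continuous_on {0..} x \<Longrightarrow> T \<ge> 0 \<Longrightarrow> (\<lambda>t. F t (x t)) absolutely_integrable_on {0..T}"
    and L: "locally_integrable L"
    and lip: "\<And>t x y. t \<ge> 0 \<Longrightarrow> norm (F t x - F t y) \<le> L t * norm (x - y)"
    and bd: "\<And>t. t \<ge> 0 \<Longrightarrow> norm (F t 0) \<le> L t"
  obtains x where "continuous_on {0..} x" "\<And>t. t \<ge> 0 \<Longrightarrow> x t = x0 + integral {0..t} (\<lambda>s. F s (x s))"
proof -
  have Lnn: "L t \<ge> 0" if "t \<ge> 0" for t using bd[OF that] norm_ge_zero order_trans by blast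
  define \<Lambda> where "\<Lambda> t = integral {0..t} L" for t
  have Lint: "L integrable_on {0..t}" if "t \<ge> 0" for t
    using locally_integrableD[OF L that] set_lebesgue_integral_eq_integral(1) by auto
  have cont_int: "continuous_on {0..} (\<lambda>t. integral {0..t} h)" if h: "\<And>T. T \<ge> 0 \<Longrightarrow> h absolutely_integrable_on {0..T}"
    for h :: "real \<Rightarrow> 'b::euclidean_space"
    by (intro continuous_on_halflineI indefinite_integral_continuous_1)
      (use h set_lebesgue_integral_eq_integral(1) in auto)
  have \<Lambda>c: "continuous_on {0..} \<Lambda>"
    unfolding \<Lambda>_def by (rule cont_int) (rule locally_integrableD[OF L])
  have \<Lambda>nn: "\<Lambda> t \<ge> 0" if "t \<ge> 0" for t
    unfolding \<Lambda>_def using that Lnn by (intro integral_nonneg Lint) auto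
  have weight: "((\<lambda>s. L s * exp (2 * \<Lambda> s)) has_integral (exp (2 * \<Lambda> t) - 1) / 2) {0..t}" if "t \<ge> 0" for t
    unfolding \<Lambda>_def by (rule exp_weight_has_integral[OF locally_integrableD[OF L that]]) (use Lnn that in auto)
  \<comment> \<open>The iteration acts on the weighted function \<open>y\<close>; \<open>X y\<close>
    is the unweighted candidate for the solution.\<close>
  define X where "X y s = exp (2 * \<Lambda> s) *\<^sub>R apply_bcontfun y s" for y :: "real \<Rightarrow>\<^sub>C 'x" and s
  have Xc: "continuous_on {0..} (X y)" for y
    unfolding X_def by (intro continuous_intros \<Lambda>c continuous_on_apply_bcontfun)
  have FX: "(\<lambda>s. F s (X y s)) absolutely_integrable_on {0..t}" if "t \<ge> 0" for y t
    by (rule int[OF Xc that])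
  have FXi: "(\<lambda>s. F s (X y s)) integrable_on {0..t}" if "t \<ge> 0" for y t
    using FX[OF that] set_lebesgue_integral_eq_integral(1) by auto
  \<comment> \<open>Bounded continuous functions live on the whole line, so the values at negative
    times are frozen at the value for time 0.\<close>
  define P where "P y t = exp (- 2 * \<Lambda> (max 0 t)) *\<^sub>R (x0 + integral {0..max 0 t} (\<lambda>s. F s (X y s)))" for y t
  have e_half: "exp (- 2 * \<Lambda> t) * ((exp (2 * \<Lambda> t) - 1) / 2) \<le> 1/2" for t
    by (simp add: algebra_simps flip: exp_add)
  have Pb: "P y \<in> bcontfun" for y
  proof -
    have "continuous_on {0..} (\<lambda>t. exp (- 2 * \<Lambda> t) *\<^sub>R (x0 + integral {0..t} (\<lambda>s. F s (X y s))))"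
      by (intro continuous_intros \<Lambda>c cont_int FX)
    then have "continuous_on UNIV (\<lambda>t. (\<lambda>t. exp (- 2 * \<Lambda> t) *\<^sub>R (x0 + integral {0..t} (\<lambda>s. F s (X y s)))) (max 0 t))"
      by (rule continuous_on_compose2) (auto intro!: continuous_intros)
    then have c: "continuous_on UNIV (P y)" unfolding P_def .
    have "norm (P y t) \<le> norm x0 + (1 + norm y) / 2" for t
    proof -
      define r where "r = max 0 t"
      have r: "r \<ge> 0" by (simp add: r_def)
      have "norm (integral {0..r} (\<lambda>s. F s (X y s))) \<le> integral {0..r} (\<lambda>s. (1 + norm y) * (L s * exp (2 * \<Lambda> s)))"
      proof (rule integral_norm_bound_integral[OF FXi[OF r]])
        show "(\<lambda>s. (1 + norm y) * (L s * exp (2 * \<Lambda> s))) integrable_on {0..r}"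
          using weight[OF r] by (intro integrable_on_mult_right) auto
        fix s assume s: "s \<in> {0..r}"
        have "norm (F s (X y s)) \<le> norm (F s 0) + norm (F s (X y s) - F s 0)" by (rule norm_triangle_sub)
        also have "\<dots> \<le> L s + L s * norm (X y s - 0)" using s by (intro add_mono lip bd) auto
        also have "\<dots> \<le> L s + L s * (exp (2 * \<Lambda> s) * norm y)"
          using norm_bounded[of y s] s Lnn[of s] by (intro add_left_mono mult_left_mono) (auto simp: X_def)
        also have "\<dots> \<le> L s * exp (2 * \<Lambda> s) + L s * (exp (2 * \<Lambda> s) * norm y)"
          using s Lnn[of s] \<Lambda>nn[of s] by (simp add: mult_le_cancel_left1)
        finally show "norm (F s (X y s)) \<le> (1 + norm y) * (L s * exp (2 * \<Lambda> s))"
          using s Lnn[of s] by (simp add: algebra_simps mult_left_mono)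
      qed
      also have "\<dots> = (1 + norm y) * ((exp (2 * \<Lambda> r) - 1) / 2)"
        using weight[OF r] by (simp add: has_integral_integral[symmetric] integral_unique)
      finally have I: "norm (integral {0..r} (\<lambda>s. F s (X y s))) \<le> (1 + norm y) * ((exp (2 * \<Lambda> r) - 1) / 2)" .
      have "norm (P y t) \<le> exp (- 2 * \<Lambda> r) * (norm x0 + norm (integral {0..r} (\<lambda>s. F s (X y s))))"
        unfolding P_def r_def[symmetric] by (simp add: norm_triangle_ineq)
      also have "\<dots> \<le> exp (- 2 * \<Lambda> r) * (norm x0 + (1 + norm y) * ((exp (2 * \<Lambda> r) - 1) / 2))"
        using I by (intro mult_left_mono) auto
      also have "\<dots> = exp (- 2 * \<Lambda> r) * norm x0 + (1 + norm y) * (exp (- 2 * \<Lambda> r) * ((exp (2 * \<Lambda> r) - 1) / 2))"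
        by (simp add: algebra_simps)
      also have "\<dots> \<le> 1 * norm x0 + (1 + norm y) * (1/2)"
        using \<Lambda>nn[OF r] e_half[of r] by (intro add_mono mult_right_mono mult_left_mono) auto
      finally show ?thesis by simp
    qed
    then show ?thesis using c by (auto intro: bcontfun_normI)
  qed
  have contr: "dist (Bcontfun (P y)) (Bcontfun (P z)) \<le> 1/2 * dist y z" for y z
  proof (rule dist_bound)
    fix t :: real
    define r where "r = max 0 t"
    have r: "r \<ge> 0" by (simp add: r_def)
    have "norm (integral {0..r} (\<lambda>s. F s (X y s) - F s (X z s))) \<le> integral {0..r} (\<lambda>s. dist y z * (L s * exp (2 * \<Lambda> s)))"
    proof (rule integral_norm_bound_integral[OF integrable_diff[OF FXi[OF r] FXi[OF r]]])
      show "(\<lambda>s. dist y z * (L s * exp (2 * \<Lambda> s))) integrable_on {0..r}"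
        using weight[OF r] by (intro integrable_on_mult_right) auto
      fix s assume s: "s \<in> {0..r}"
      have "norm (F s (X y s) - F s (X z s)) \<le> L s * norm (X y s - X z s)" using s by (intro lip) auto
      also have "norm (X y s - X z s) = exp (2 * \<Lambda> s) * dist (apply_bcontfun y s) (apply_bcontfun z s)"
        by (simp add: X_def dist_norm flip: scaleR_diff_right)
      also have "L s * \<dots> \<le> L s * (exp (2 * \<Lambda> s) * dist y z)"
        using s Lnn[of s] dist_bounded[of y s z] by (intro mult_left_mono) auto
      finally show "norm (F s (X y s) - F s (X z s)) \<le> dist y z * (L s * exp (2 * \<Lambda> s))" by (simp add: mult_ac)
    qed
    also have "\<dots> = dist y z * ((exp (2 * \<Lambda> r) - 1) / 2)"
      using weight[OF r] by (simp add: has_integral_integral[symmetric] integral_unique)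
    finally have I: "norm (integral {0..r} (\<lambda>s. F s (X y s) - F s (X z s))) \<le> dist y z * ((exp (2 * \<Lambda> r) - 1) / 2)" .
    have "P y t - P z t = exp (- 2 * \<Lambda> r) *\<^sub>R integral {0..r} (\<lambda>s. F s (X y s) - F s (X z s))"
      unfolding P_def r_def[symmetric] Henstock_Kurzweil_Integration.integral_diff[OF FXi[OF r] FXi[OF r]] by (simp add: algebra_simps)
    then have "dist (P y t) (P z t) = exp (- 2 * \<Lambda> r) * norm (integral {0..r} (\<lambda>s. F s (X y s) - F s (X z s)))"
      by (simp add: dist_norm)
    also have "\<dots> \<le> exp (- 2 * \<Lambda> r) * (dist y z * ((exp (2 * \<Lambda> r) - 1) / 2))"
      using I by (intro mult_left_mono) auto
    also have "\<dots> = dist y z * (exp (- 2 * \<Lambda> r) * ((exp (2 * \<Lambda> r) - 1) / 2))" by simp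
    also have "\<dots> \<le> dist y z * (1/2)" using e_half[of r] by (intro mult_left_mono) auto
    finally show "dist (apply_bcontfun (Bcontfun (P y)) t) (apply_bcontfun (Bcontfun (P z)) t) \<le> 1/2 * dist y z"
      using Pb by (simp add: Bcontfun_inverse)
  qed
  obtain y where y: "Bcontfun (P y) = y"
    using banach_fix_type[of "1/2" "\<lambda>y. Bcontfun (P y)"] contr by auto
  have "X y t = x0 + integral {0..t} (\<lambda>s. F s (X y s))" if t: "t \<ge> 0" for t
  proof -
    have "apply_bcontfun y t = P y t" using Bcontfun_inverse[OF Pb, of y] y by simp
    then have "X y t = (exp (2 * \<Lambda> t) * exp (- 2 * \<Lambda> t)) *\<^sub>R (x0 + integral {0..t} (\<lambda>s. F s (X y s)))"
      using t unfolding X_def P_def by (simp add: max_def)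
    then show ?thesis by (simp flip: exp_add)
  qed
  then show ?thesis using that Xc by blast
qed

section \<open>Analytic sets and measurable selection\<close>

text \<open>Analytic sets, as projections of closed sets along a countable power of the line. The power of
  the line stands in for the Baire space; only its compact boxes are used.\<close>

definition souslin :: "'x::metric_space set \<Rightarrow> bool" where
  "souslin A \<longleftrightarrow> (\<exists>C::('x \<times> (nat \<Rightarrow> real)) set. closed C \<and> A = fst ` C)"

lemma souslin_closed: "closed A \<Longrightarrow> souslin A"
  unfolding souslin_def by (intro exI[of _ "A \<times> UNIV"]) (auto intro: closed_Times)

lemma continuous_on_reindex:
  "continuous_on UNIV (\<lambda>z::'x::metric_space \<times> (nat \<Rightarrow> real). (fst z, \<lambda>k. snd z (h k)))"
proof (intro continuous_on_Pair continuous_on_coordinatewise_then_product)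
  show "continuous_on UNIV (\<lambda>z::'x \<times> (nat \<Rightarrow> real). snd z (h k))" for k
    by (rule continuous_on_product_then_coordinatewise) (intro continuous_intros)
qed (intro continuous_intros)

text \<open>Countably many parameter sequences are stored in one by pairing indices. Each condition
  sees only its own subsequence through a continuous map, so the intersection remains
  closed.\<close>

lemma souslin_INT:
  assumes "\<And>n::nat. souslin (A n)"
  shows "souslin (\<Inter>n. A n)"
proof -
  obtain C where C: "\<And>n. closed (C n)" "\<And>n. A n = fst ` (C n :: ('a \<times> (nat \<Rightarrow> real)) set)"
    using assms unfolding souslin_def by metis
  define D where "D = (\<Inter>n. (\<lambda>z::'a \<times> (nat \<Rightarrow> real). (fst z, \<lambda>k. snd z (prod_encode (n, k)))) -` C n)"
  have "closed D" unfolding D_def using C(1) continuous_on_reindex by (intro closed_INT ballI closed_vimage) auto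
  moreover have "(\<Inter>n. A n) = fst ` D"
  proof (intro equalityI subsetI)
    fix x assume "x \<in> (\<Inter>n. A n)"
    then have "\<forall>n. \<exists>s. (x, s) \<in> C n" using C(2) by force
    then obtain s where s: "\<And>n. (x, s n) \<in> C n" by metis
    have "(x, \<lambda>i. s (fst (prod_decode i)) (snd (prod_decode i))) \<in> D" using s by (auto simp: D_def)
    then show "x \<in> fst ` D" by force
  next
    fix x assume "x \<in> fst ` D"
    then show "x \<in> (\<Inter>n. A n)" using C(2) by (auto simp: D_def image_iff) (metis fst_conv)
  qed
  ultimately show ?thesis unfolding souslin_def by blast
qed

text \<open>Coordinate 0 of the parameter names a member of the union and the other coordinates are
  the parameter of that member. Natural numbers are at distance at least 1 from each other, so the
  implication from "coordinate 0 is \<open>n\<close>" to "the rest lies in \<open>C n\<close>" can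
  be written as a closed condition: coordinate 0 is at least 1 away from \<open>n\<close>, or the
  rest lies in \<open>C n\<close>.\<close>

lemma souslin_UN:
  assumes "\<And>n::nat. souslin (A n)"
  shows "souslin (\<Union>n. A n)"
proof -
  obtain C where C: "\<And>n. closed (C n)" "\<And>n. A n = fst ` (C n :: ('a \<times> (nat \<Rightarrow> real)) set)"
    using assms unfolding souslin_def by metis
  define D where "D = (\<Inter>n. (\<lambda>z::'a \<times> (nat \<Rightarrow> real). snd z 0) -` \<nat> \<inter> ((\<lambda>z. \<bar>snd z 0 - real n\<bar>) -` {1..} \<union>
     (\<lambda>z. (fst z, \<lambda>k. snd z (Suc k))) -` C n))"
  have c0: "continuous_on UNIV (\<lambda>z::'a \<times> (nat \<Rightarrow> real). snd z 0)"
    by (rule continuous_on_product_then_coordinatewise) (intro continuous_intros)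
  have "closed D" unfolding D_def
    by (intro closed_INT ballI closed_Int closed_Un closed_vimage C(1) closed_Nats c0 continuous_on_reindex closed_atLeast
        continuous_intros)
  moreover have "(\<Union>n. A n) = fst ` D"
  proof (intro equalityI subsetI)
    fix x assume "x \<in> (\<Union>n. A n)"
    then obtain n s where s: "(x, s) \<in> C n" using C(2) by force
    have "1 \<le> \<bar>real n - real k\<bar>" if "k \<noteq> n" for k
      using that by linarith
    then have "(x, case_nat (real n) s) \<in> D"
      using s unfolding D_def by auto metis
    then show "x \<in> fst ` D" by force
  next
    fix x assume "x \<in> fst ` D"
    then obtain s where s: "(x, s) \<in> D" by auto
    then obtain n :: nat where n: "s 0 = real n" by (auto simp: D_def Nats_def)
    then have "(x, \<lambda>k. s (Suc k)) \<in> C n"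
      using s unfolding D_def by (auto dest!: spec[of _ n])
    then show "x \<in> (\<Union>n. A n)" using C(2) by force
  qed
  ultimately show ?thesis unfolding souslin_def by blast
qed

text \<open>Analytic sets are not closed under complements, so the induction carries a set together
  with its complement.\<close>

lemma borel_imp_souslin:
  fixes A :: "'x::euclidean_space set"
  assumes "A \<in> sets borel"
  shows "souslin A"
proof -
  have "A \<in> sigma_sets UNIV (Collect closed)"
    using assms unfolding borel_eq_closed by simp
  then have "souslin A \<and> souslin (- A)"
  proof (induction rule: sigma_sets.induct)
    case (Basic B)
    then have B: "closed B" by simp
    then obtain \<D> where D: "countable \<D>" "\<And>X. X \<in> \<D> \<Longrightarrow> \<exists>a b. X = cbox a b" "\<Union>\<D> = - B"
      by (metis open_countable_Union_open_cbox open_Compl)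
    \<comment> \<open>The empty set is added so that there is something to enumerate even when no
      box is present.\<close>
    have "souslin (\<Union>n. from_nat_into (insert {} \<D>) n)"
    proof (rule souslin_UN)
      fix n
      have "from_nat_into (insert {} \<D>) n \<in> insert {} \<D>" by (rule from_nat_into) simp
      then show "souslin (from_nat_into (insert {} \<D>) n)" using D(2)
        by (metis closed_cbox closed_empty insert_iff souslin_closed)
    qed
    moreover have "(\<Union>n. from_nat_into (insert {} \<D>) n) = - B"
      using D range_from_nat_into[of "insert {} \<D>"] by auto
    ultimately show ?case using souslin_closed[OF B] by simp
  next
    case Empty then show ?case by (auto intro: souslin_closed)
  next
    case (Compl a) then show ?case by (simp add: Compl_eq_Diff_UNIV[symmetric])
  next
    case (Union a)
    then have "souslin (\<Union>i. a i)" "souslin (\<Inter>i. - a i)" by (auto intro: souslin_UN souslin_INT)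
    then show ?case by simp
  qed
  then show ?thesis ..
qed

section \<open>Compact subsets with a projection that is not null\<close>

lemma tendsto_pointwise:
  fixes s :: "nat \<Rightarrow> nat \<Rightarrow> real"
  assumes "\<And>i. (\<lambda>n. s n i) \<longlonglongrightarrow> l i"
  shows "s \<longlonglongrightarrow> l"
proof -
  have "limitin (product_topology (\<lambda>i. euclidean) UNIV) s l sequentially"
    unfolding limitin_componentwise using assms by auto
  then show ?thesis by (simp add: euclidean_product_topology)
qed

lemma compact_box: "compact {s::nat \<Rightarrow> real. \<forall>i. \<bar>s i\<bar> \<le> m i}"
proof -
  have "compactin (product_topology (\<lambda>i. euclidean) UNIV) (PiE UNIV (\<lambda>i. {- m i..m i}))"
    unfolding compactin_PiE by auto
  moreover have "PiE UNIV (\<lambda>i. {- m i..m i}) = {s. \<forall>i. \<bar>s i\<bar> \<le> m i}" by (auto simp: PiE_def Pi_def abs_le_iff)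
       (metis minus_le_iff)+
  ultimately show ?thesis by (simp add: euclidean_product_topology)
qed

text \<open>Choquet's capacitability argument for the outer measure of the projection: bounding the
  coordinates of the parameter one after the other loses arbitrarily little outer measure.\<close>

lemma borel_projection_inner_compact:
  fixes G :: "(real \<times> 'u::euclidean_space) set"
  assumes G: "G \<in> sets borel" "G \<subseteq> {a..b} \<times> UNIV" and nn: "\<not> negligible (fst ` G)"
  obtains K where "compact K" "K \<subseteq> G" "\<not> negligible (fst ` K)"
proof -
  obtain C :: "((real \<times> 'u) \<times> (nat \<Rightarrow> real)) set" where C: "closed C" "G = fst ` C"
    using borel_imp_souslin[OF G(1)] unfolding souslin_def by auto
  \<comment> \<open>Outer measure, because the projections are not known to be measurable; it is
    still continuous along increasing unions, which is the property that the successive bounds rely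
    on.\<close>
  define c where "c B = outer_measure_of lebesgue ((\<lambda>z. fst (fst z)) ` B)" for B :: "((real \<times> 'u) \<times> (nat \<Rightarrow> real)) set"
  have c_mono: "c A \<le> c B" if "A \<subseteq> B" for A B unfolding c_def by (rule outer_measure_of_mono) (use that in auto)
  have c_step: "\<exists>n. c (A n) > \<alpha>" if "c (\<Union>n::nat. A n) > \<alpha>" "incseq A" for A \<alpha>
  proof -
    have "(SUP n. outer_measure_of lebesgue ((\<lambda>z. fst (fst z)) ` A n)) = outer_measure_of lebesgue (\<Union>n. (\<lambda>z. fst (fst z)) ` A n)"
      by (rule SUP_outer_measure_of_incseq) (use that(2) in \<open>auto simp: incseq_def intro!: image_mono\<close>)
    then have "(SUP n. c (A n)) = c (\<Union>n. A n)" by (simp add: c_def image_UN)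
    then show ?thesis using that(1) by (metis less_SUP_iff)
  qed
  have cC: "c C > 0"
  proof (rule ccontr)
    assume "\<not> ?thesis"
    then have "outer_measure_of lebesgue (fst ` G) = 0" by (simp add: c_def C(2) image_image)
    then obtain E where "E \<in> sets lebesgue" "fst ` G \<subseteq> E" "emeasure lebesgue E = 0"
      using outer_measure_of_attain[of "fst ` G" lebesgue] by auto
    then have "negligible (fst ` G)" using negligible_subset negligible_iff_null_sets null_setsI by metis
    then show False using nn by simp
  qed
  \<comment> \<open>A level strictly below the outer measure: the strict inequality survives each
    application of \<open>c_step\<close>.\<close>
  then obtain \<alpha> where \<alpha>: "0 < \<alpha>" "\<alpha> < c C" using dense by blast
  \<comment> \<open>The control coordinate is bounded before the coordinates of the
    parameter.\<close>
  define R where "R n = C \<inter> {z. norm (snd (fst z)) \<le> real n}" for n :: nat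
  have "(\<Union>n. R n) = C" using real_arch_simple by (auto simp: R_def)
  moreover have "incseq R" by (auto simp: incseq_def R_def)
  ultimately obtain r where r: "c (R r) > \<alpha>" using c_step[of \<alpha> R] \<alpha> by auto
  \<comment> \<open>Dependent choice yields the bounds in turn; the conjunct for
    \<open>n = 0\<close> fixes the starting set.\<close>
  have "\<exists>E. \<forall>n. (c (E n) > \<alpha> \<and> (n = 0 \<longrightarrow> E n = R r)) \<and> (\<exists>m::nat. E (Suc n) = E n \<inter> {z. \<bar>snd z n\<bar> \<le> real m})"
  proof (rule dependent_nat_choice)
    show "\<exists>E. \<alpha> < c E \<and> (0 = (0::nat) \<longrightarrow> E = R r)" using r by auto
    fix E and n :: nat assume E: "\<alpha> < c E \<and> (n = 0 \<longrightarrow> E = R r)"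
    have "(\<Union>m::nat. E \<inter> {z. \<bar>snd z n\<bar> \<le> real m}) = E" using real_arch_simple by auto
    moreover have "incseq (\<lambda>m::nat. E \<inter> {z. \<bar>snd z n\<bar> \<le> real m})" by (auto simp: incseq_def)
    ultimately obtain m :: nat where "\<alpha> < c (E \<inter> {z. \<bar>snd z n\<bar> \<le> real m})"
      using c_step[of \<alpha> "\<lambda>m. E \<inter> {z. \<bar>snd z n\<bar> \<le> real m}"] E by auto
    then show "\<exists>E'. (\<alpha> < c E' \<and> (Suc n = 0 \<longrightarrow> E' = R r)) \<and> (\<exists>m::nat. E' = E \<inter> {z. \<bar>snd z n\<bar> \<le> real m})" by auto
  qed
  then obtain E m where E: "\<And>n. c (E n) > \<alpha>" "E 0 = R r"
    and Es: "\<And>n. E (Suc n) = E n \<inter> {z. \<bar>snd z n\<bar> \<le> real (m n :: nat)}"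
    by metis
  have En: "E n = R r \<inter> {z. \<forall>i<n. \<bar>snd z i\<bar> \<le> real (m i)}" for n
    by (induction n) (auto simp: E(2) Es less_Suc_eq)
  define Q where "Q = ({a..b} \<times> cball (0::'u) r) \<times> {s::nat \<Rightarrow> real. \<forall>i. \<bar>s i\<bar> \<le> real (m i)}"
  have Q: "compact Q" unfolding Q_def by (intro compact_Times compact_box) auto
  define K where "K = fst ` (C \<inter> Q)"
  have KC: "compact (C \<inter> Q)" using C(1) Q by (simp add: closed_Int_compact)
  then have K: "compact K" unfolding K_def by (intro compact_continuous_image continuous_intros)
  \<comment> \<open>Closures are measurable and decreasing, so a lower bound for the outer measures
    of all stages passes to the intersection.\<close>
  define P where "P n = closure ((\<lambda>z. fst (fst z)) ` E n)" for n
  have Rab: "fst (fst z) \<in> {a..b}" "norm (snd (fst z)) \<le> r" "z \<in> C" if "z \<in> R r" for z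
  proof -
    have "fst z \<in> G" using that by (auto simp: C(2) R_def)
    then show "fst (fst z) \<in> {a..b}" "norm (snd (fst z)) \<le> r" "z \<in> C" using that G(2) by (auto simp: R_def mem_Times_iff)
  qed
  have Psub: "P n \<subseteq> {a..b}" for n unfolding P_def by (rule closure_minimal) (use Rab En in auto)
  have Pc: "closed (P n)" for n by (simp add: P_def)
  have Pdec: "decseq P" unfolding decseq_def P_def En by (intro allI impI closure_mono image_mono) auto
  have inter: "(\<Inter>n. P n) \<subseteq> fst ` K"
  proof
    fix t assume t: "t \<in> (\<Inter>n. P n)"
    have "\<exists>z. z \<in> E n \<and> dist (fst (fst z)) t < 1 / Suc n" for n
    proof -
      have "t \<in> closure ((\<lambda>z. fst (fst z)) ` E n)" using t by (auto simp: P_def)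
      then show ?thesis unfolding closure_approachable using of_nat_0_less_iff zero_less_Suc zero_less_divide_1_iff by blast
    qed
    then obtain z where z: "\<And>n. z n \<in> E n" "\<And>n. dist (fst (fst (z n))) t < 1 / Suc n" by metis
    \<comment> \<open>Stage \<open>n\<close> bounds only the first \<open>n\<close> coordinates of
      the parameter. Setting the others to 0 moves the points into the compact \<open>Q\<close> and
      leaves each fixed coordinate unchanged from some stage on, so the original points converge to
      the same limit, which therefore lies in \<open>C\<close>.\<close>
    define z' where "z' n = (fst (z n), \<lambda>i. if i < n then snd (z n) i else 0)" for n
    have "z' n \<in> Q" for n
      using z(1)[of n] Rab[of "z n"] unfolding En by (auto simp: z'_def Q_def mem_Times_iff)
    then obtain l \<rho> where l: "l \<in> Q" "strict_mono \<rho>" "(z' \<circ> \<rho>) \<longlonglongrightarrow> l"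
      using compact_imp_seq_compact[OF Q] unfolding seq_compact_def by metis
    have f1: "(\<lambda>n. fst (z (\<rho> n))) \<longlonglongrightarrow> fst l" using tendsto_fst[OF l(3)] by (simp add: o_def z'_def)
    have "(\<lambda>n. snd (z (\<rho> n))) \<longlonglongrightarrow> snd l"
    proof (rule tendsto_pointwise)
      fix i
      have "continuous_on UNIV (\<lambda>s::nat \<Rightarrow> real. s i)" by simp
      then have "(\<lambda>n. snd (z' (\<rho> n)) i) \<longlonglongrightarrow> snd l i"
        using continuous_on_tendsto_compose[of UNIV "\<lambda>s::nat \<Rightarrow> real. s i" "\<lambda>n. snd (z' (\<rho> n))" "snd l" sequentially] tendsto_snd[OF l(3)]
        by (simp add: o_def)
      moreover have "\<forall>\<^sub>F n in sequentially. snd (z' (\<rho> n)) i = snd (z (\<rho> n)) i"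
        unfolding eventually_sequentially
      proof (intro exI allI impI)
        fix n assume "Suc i \<le> n"
        then have "i < \<rho> n" using seq_suble[OF l(2), of n] by linarith
        then show "snd (z' (\<rho> n)) i = snd (z (\<rho> n)) i" by (simp add: z'_def)
      qed
      ultimately show "(\<lambda>n. snd (z (\<rho> n)) i) \<longlonglongrightarrow> snd l i" by (rule Lim_transform_eventually)
    qed
    from tendsto_Pair[OF f1 this] have "(\<lambda>n. z (\<rho> n)) \<longlonglongrightarrow> l" by simp
    moreover have "z (\<rho> n) \<in> C" for n using z(1)[of "\<rho> n"] Rab(3) unfolding En by auto
    ultimately have "l \<in> C" using closed_sequentially[OF C(1), of "\<lambda>n. z (\<rho> n)" l] by simp
    then have "fst l \<in> K" using l(1) by (auto simp: K_def)
    moreover have "fst (fst l) = t"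
    proof (rule LIMSEQ_unique[OF tendsto_fst[OF f1]])
      have "(\<lambda>n. fst (fst (z n)) - t) \<longlonglongrightarrow> 0"
        by (rule LIMSEQ_norm_0) (use z(2) in \<open>simp add: dist_norm\<close>)
      then have "(\<lambda>n. fst (fst (z n))) \<longlonglongrightarrow> t" by (simp add: LIM_zero_iff)
      from LIMSEQ_subseq_LIMSEQ[OF this l(2)]
      show "(\<lambda>n. fst (fst (z (\<rho> n)))) \<longlonglongrightarrow> t" by (simp add: o_def)
    qed
    ultimately show "t \<in> fst ` K" by auto
  qed
  have "\<alpha> \<le> emeasure lebesgue (P n)" for n
  proof -
    have "\<alpha> \<le> c (E n)" using E(1)[of n] by simp
    also have "\<dots> \<le> outer_measure_of lebesgue (P n)"
      unfolding c_def P_def by (intro outer_measure_of_mono closure_subset)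
    also have "\<dots> = emeasure lebesgue (P n)" using Pc by (intro outer_measure_of_eq) auto
    finally show ?thesis .
  qed
  then have "\<alpha> \<le> (INF n. emeasure lebesgue (P n))" by (intro INF_greatest)
  also have "\<dots> = emeasure lebesgue (\<Inter>n. P n)"
  proof (rule INF_emeasure_decseq[OF _ Pdec])
    show "range P \<subseteq> sets lebesgue" using Pc by auto
    show "emeasure lebesgue (P i) \<noteq> \<infinity>" for i
    proof -
      have "compact (P i)" using Pc[of i] bounded_subset[OF bounded_closed_interval Psub[of i]] by (simp add: compact_eq_bounded_closed)
      then show ?thesis using fmeasurableD2[OF lmeasurable_compact] by auto
    qed
  qed
  finally have "emeasure lebesgue (\<Inter>n. P n) > 0" using \<alpha> by (meson less_le_trans)
  then have "\<not> negligible (\<Inter>n. P n)" by (auto simp: negligible_iff_null_sets null_sets_def)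
  then have "\<not> negligible (fst ` K)" using inter negligible_subset by blast
  moreover have "K \<subseteq> G" by (auto simp: K_def C(2))
  ultimately show ?thesis using that K by blast
qed

text \<open>The coordinates are minimized one after the other. Each step replaces a section by the
  set of its minimizers, so after all of \<open>Basis\<close> only the lexicographic minimum is
  left. Measurability is carried along in the form that the times at which the section meets a given
  closed set form a Borel set.\<close>

lemma compact_lex_min_multifunction:
  fixes K :: "(real \<times> 'u::euclidean_space) set"
  assumes K: "compact K" and B: "finite B"
  shows "\<exists>\<Phi>. (\<forall>t\<in>fst ` K. compact (\<Phi> t) \<and> \<Phi> t \<noteq> {} \<and> \<Phi> t \<subseteq> {u. (t, u) \<in> K} \<and>
             (\<forall>u\<in>\<Phi> t. \<forall>u'\<in>\<Phi> t. \<forall>b\<in>B. u \<bullet> b = u' \<bullet> b)) \<and>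
           (\<forall>C. closed C \<longrightarrow> {t\<in>fst ` K. \<Phi> t \<inter> C \<noteq> {}} \<in> sets borel)"
  using B
proof (induction B rule: finite_induct)
  case empty
  show ?case
  proof (intro exI[of _ "\<lambda>t. {u. (t, u) \<in> K}"] conjI ballI allI impI)
    fix t assume "t \<in> fst ` K"
    then show "{u. (t, u) \<in> K} \<noteq> {}" by auto
    have "compact (snd ` (K \<inter> ({t} \<times> UNIV)))"
      by (intro compact_continuous_image compact_Int_closed[OF K] closed_Times continuous_intros)
    moreover have "snd ` (K \<inter> ({t} \<times> UNIV)) = {u. (t, u) \<in> K}" by force
    ultimately show "compact {u. (t, u) \<in> K}" by simp
  next
    fix C :: "'u set" assume C: "closed C"
    \<comment> \<open>The hitting times of a closed set are the projection of a compact set.\<close>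
    have "compact (fst ` (K \<inter> (UNIV \<times> C)))"
      by (intro compact_continuous_image compact_Int_closed[OF K] closed_Times C closed_UNIV continuous_intros)
    moreover have "fst ` (K \<inter> (UNIV \<times> C)) = {t\<in>fst ` K. {u. (t, u) \<in> K} \<inter> C \<noteq> {}}"
      by (auto simp: image_iff) force
    ultimately show "{t\<in>fst ` K. {u. (t, u) \<in> K} \<inter> C \<noteq> {}} \<in> sets borel" by (metis borel_compact)
  qed auto
next
  case (insert b B)
  then obtain \<Phi> where IH: "\<forall>t\<in>fst ` K. compact (\<Phi> t) \<and> \<Phi> t \<noteq> {} \<and> \<Phi> t \<subseteq> {u. (t, u) \<in> K} \<and>
             (\<forall>u\<in>\<Phi> t. \<forall>u'\<in>\<Phi> t. \<forall>b\<in>B. u \<bullet> b = u' \<bullet> b)"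
           "\<forall>C. closed C \<longrightarrow> {t\<in>fst ` K. \<Phi> t \<inter> C \<noteq> {}} \<in> sets borel"
    by (elim exE conjE)
  have \<Phi>: "\<And>t. t \<in> fst ` K \<Longrightarrow> compact (\<Phi> t)" "\<And>t. t \<in> fst ` K \<Longrightarrow> \<Phi> t \<noteq> {}"
      "\<And>t. t \<in> fst ` K \<Longrightarrow> \<Phi> t \<subseteq> {u. (t, u) \<in> K}"
      "\<And>t u u' b. t \<in> fst ` K \<Longrightarrow> u \<in> \<Phi> t \<Longrightarrow> u' \<in> \<Phi> t \<Longrightarrow> b \<in> B \<Longrightarrow> u \<bullet> b = u' \<bullet> b"
      "\<And>C. closed C \<Longrightarrow> {t\<in>fst ` K. \<Phi> t \<inter> C \<noteq> {}} \<in> sets borel"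
    using IH by (blast, blast, blast, blast, blast)
  have T: "fst ` K \<in> sets borel" by (intro borel_compact compact_continuous_image K continuous_intros)
  define \<phi> where "\<phi> t = Inf ((\<lambda>u. u \<bullet> b) ` \<Phi> t)" for t
  have min: "\<exists>u\<in>\<Phi> t. u \<bullet> b = \<phi> t" "\<And>u. u \<in> \<Phi> t \<Longrightarrow> \<phi> t \<le> u \<bullet> b" if t: "t \<in> fst ` K" for t
  proof -
    obtain u where u: "u \<in> \<Phi> t" "\<And>v. v \<in> \<Phi> t \<Longrightarrow> u \<bullet> b \<le> v \<bullet> b"
      using continuous_attains_inf[OF \<Phi>(1,2)[OF t] continuous_on_inner[OF continuous_on_id continuous_on_const[of _ b]]] by auto
    have "\<phi> t = u \<bullet> b" unfolding \<phi>_def by (rule cInf_eq_minimum) (use u in auto)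
    then show "\<exists>u\<in>\<Phi> t. u \<bullet> b = \<phi> t" "\<And>u. u \<in> \<Phi> t \<Longrightarrow> \<phi> t \<le> u \<bullet> b" using u by auto
  qed
  define \<Psi> where "\<Psi> t = \<Phi> t \<inter> {u. u \<bullet> b \<le> \<phi> t}" for t
  have \<Psi>eq: "u \<bullet> b = \<phi> t" if "t \<in> fst ` K" "u \<in> \<Psi> t" for t u
    using that min(2)[of t u] by (auto simp: \<Psi>_def)
  have half: "closed {u. u \<bullet> b \<le> a}" for a :: real
    using closed_halfspace_le[of b a] by (simp add: inner_commute)
  show ?case
  proof (intro exI[of _ \<Psi>] conjI ballI allI impI)
    fix t assume t: "t \<in> fst ` K"
    show "compact (\<Psi> t)" unfolding \<Psi>_def by (intro compact_Int_closed half \<Phi>(1)[OF t])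
    show "\<Psi> t \<noteq> {}" using min(1)[OF t] by (auto simp: \<Psi>_def)
    show "\<Psi> t \<subseteq> {u. (t, u) \<in> K}" using \<Phi>(3)[OF t] by (auto simp: \<Psi>_def)
    fix u u' c assume u: "u \<in> \<Psi> t" "u' \<in> \<Psi> t" and c: "c \<in> insert b B"
    show "u \<bullet> c = u' \<bullet> c"
    proof (cases "c = b")
      case True
      then show ?thesis using \<Psi>eq[OF t u(1)] \<Psi>eq[OF t u(2)] by simp
    next
      case False
      show ?thesis by (rule \<Phi>(4)[OF t]) (use u c False in \<open>auto simp: \<Psi>_def\<close>)
    qed
  next
    fix C :: "'u set" assume C: "closed C"
    \<comment> \<open>The level \<open>q\<close> is reached on \<open>C\<close> and exceeds the
      minimum over the section by less than \<open>1 / Suc k\<close>. Such a rational for every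
      \<open>k\<close> means that \<open>\<Phi> t \<inter> C\<close> comes arbitrarily close to the
      minimum, and by compactness attains it.\<close>
    define X where "X k q = {t\<in>fst ` K. \<Phi> t \<inter> (C \<inter> {u. u \<bullet> b \<le> real_of_rat q}) \<noteq> {}} \<inter>
        (fst ` K - {t\<in>fst ` K. \<Phi> t \<inter> {u. u \<bullet> b \<le> real_of_rat q - 1 / Suc k} \<noteq> {}})" for k :: nat and q
    have "X k q \<in> sets borel" for k q
      unfolding X_def by (rule sets.Int[OF \<Phi>(5)[OF closed_Int[OF C half]] sets.Diff[OF T \<Phi>(5)[OF half]]])
    then have "(\<Inter>k. \<Union>q. X k q) \<in> sets borel"
      by (intro sets.countable_INT'' sets.countable_UN'') auto
    moreover have "{t\<in>fst ` K. \<Psi> t \<inter> C \<noteq> {}} = (\<Inter>k. \<Union>q. X k q)"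
    proof (intro equalityI subsetI)
      fix t assume "t \<in> {t\<in>fst ` K. \<Psi> t \<inter> C \<noteq> {}}"
      then obtain u where u: "t \<in> fst ` K" "u \<in> \<Psi> t" "u \<in> C" by auto
      have "\<exists>q. t \<in> X k q" for k
      proof -
        obtain q where q: "\<phi> t < real_of_rat q" "real_of_rat q < \<phi> t + 1 / Suc k"
          using of_rat_dense[of "\<phi> t" "\<phi> t + 1 / Suc k"] by auto
        have "u \<bullet> b \<le> real_of_rat q" using q \<Psi>eq[OF u(1,2)] by simp
        moreover have "\<Phi> t \<inter> {u. u \<bullet> b \<le> real_of_rat q - 1 / Suc k} = {}"
          using min(2)[OF u(1)] q(2) by (fastforce simp: algebra_simps)
        ultimately have "t \<in> X k q" using u by (auto simp: X_def \<Psi>_def)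
        then show ?thesis ..
      qed
      then show "t \<in> (\<Inter>k. \<Union>q. X k q)" by auto
    next
      fix t assume t: "t \<in> (\<Inter>k. \<Union>q. X k q)"
      then have tK: "t \<in> fst ` K" by (auto simp: X_def)
      have near: "\<exists>u\<in>\<Phi> t \<inter> C. u \<bullet> b < \<phi> t + 1 / Suc k" for k
      proof -
        obtain q where q: "t \<in> X k q" using t by auto
        then obtain u where u: "u \<in> \<Phi> t \<inter> C" "u \<bullet> b \<le> real_of_rat q" by (auto simp: X_def)
        obtain v where v: "v \<in> \<Phi> t" "v \<bullet> b = \<phi> t" using min(1)[OF tK] by auto
        have "\<not> v \<bullet> b \<le> real_of_rat q - 1 / Suc k" using q v(1) unfolding X_def by blast
        then show ?thesis using u v by (intro bexI[of _ u]) auto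
      qed
      then have ne: "\<Phi> t \<inter> C \<noteq> {}" by blast
      obtain u where u: "u \<in> \<Phi> t \<inter> C" "\<And>v. v \<in> \<Phi> t \<inter> C \<Longrightarrow> u \<bullet> b \<le> v \<bullet> b"
        using continuous_attains_inf[OF compact_Int_closed[OF \<Phi>(1)[OF tK] C] ne continuous_on_inner[OF continuous_on_id continuous_on_const[of _ b]]]
        by auto
      have "u \<bullet> b \<le> \<phi> t"
      proof (rule field_le_epsilon)
        fix e :: real assume "e > 0"
        then obtain k where "1 / Suc k < e" using nat_approx_posE by auto
        moreover obtain v where "v \<in> \<Phi> t \<inter> C" "v \<bullet> b < \<phi> t + 1 / Suc k" using near by blast
        ultimately show "u \<bullet> b \<le> \<phi> t + e" using u(2)[of v] by linarith
      qed
      then show "t \<in> {t\<in>fst ` K. \<Psi> t \<inter> C \<noteq> {}}" using u(1) tK by (auto simp: \<Psi>_def)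
    qed
    ultimately show "{t\<in>fst ` K. \<Psi> t \<inter> C \<noteq> {}} \<in> sets borel" by simp
  qed
qed

lemma compact_borel_selection:
  fixes K :: "(real \<times> 'u::euclidean_space) set"
  assumes K: "compact K"
  obtains v where "v \<in> borel_measurable borel" "\<And>t. t \<in> fst ` K \<Longrightarrow> (t, v t) \<in> K"
proof -
  obtain \<Phi> where \<Phi>0: "\<forall>t\<in>fst ` K. compact (\<Phi> t) \<and> \<Phi> t \<noteq> {} \<and> \<Phi> t \<subseteq> {u. (t, u) \<in> K} \<and>
             (\<forall>u\<in>\<Phi> t. \<forall>u'\<in>\<Phi> t. \<forall>b\<in>Basis. u \<bullet> b = u' \<bullet> b)"
           "\<forall>C. closed C \<longrightarrow> {t\<in>fst ` K. \<Phi> t \<inter> C \<noteq> {}} \<in> sets borel"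
    using compact_lex_min_multifunction[OF K finite_Basis] by (elim exE conjE)
  have \<Phi>: "\<And>t. t \<in> fst ` K \<Longrightarrow> \<Phi> t \<noteq> {}" "\<And>t. t \<in> fst ` K \<Longrightarrow> \<Phi> t \<subseteq> {u. (t, u) \<in> K}"
      "\<And>t u u' b. t \<in> fst ` K \<Longrightarrow> u \<in> \<Phi> t \<Longrightarrow> u' \<in> \<Phi> t \<Longrightarrow> b \<in> Basis \<Longrightarrow> u \<bullet> b = u' \<bullet> b"
      "\<And>C. closed C \<Longrightarrow> {t\<in>fst ` K. \<Phi> t \<inter> C \<noteq> {}} \<in> sets borel"
    using \<Phi>0 by (blast, blast, blast, blast)
  have T: "fst ` K \<in> sets borel" by (intro borel_compact compact_continuous_image K continuous_intros)
  have "\<forall>t\<in>fst ` K. \<exists>u. u \<in> \<Phi> t" using \<Phi>(1) by blast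
  then obtain w where w: "\<And>t. t \<in> fst ` K \<Longrightarrow> w t \<in> \<Phi> t" by metis
  define v where "v t = (if t \<in> fst ` K then w t else 0)" for t
  \<comment> \<open>Points with equal coordinates coincide, so for each time hitting a closed set
    means that the set contains \<open>v t\<close>.\<close>
  have single: "\<Phi> t = {v t}" if "t \<in> fst ` K" for t
  proof -
    have v: "v t \<in> \<Phi> t" using w[OF that] that by (simp add: v_def)
    have "u = v t" if "u \<in> \<Phi> t" for u
      by (rule euclidean_eqI) (rule \<Phi>(3)[OF \<open>t \<in> fst ` K\<close> that v])
    then show ?thesis using v by blast
  qed
  have "v \<in> borel_measurable borel"
    unfolding borel_eq_closed[where 'a='u]
  proof (rule measurable_sigma_sets)
    fix C :: "'u set" assume "C \<in> Collect closed"
    then have C: "closed C" by simp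
    \<comment> \<open>Off the projection \<open>v\<close> is 0, which adds the complement exactly
      when 0 lies in \<open>C\<close>.\<close>
    have "v -` C \<inter> space borel = {t\<in>fst ` K. \<Phi> t \<inter> C \<noteq> {}} \<union> (if 0 \<in> C then - fst ` K else {})"
    proof (rule set_eqI)
      fix t
      show "t \<in> v -` C \<inter> space borel \<longleftrightarrow> t \<in> {t\<in>fst ` K. \<Phi> t \<inter> C \<noteq> {}} \<union> (if 0 \<in> C then - fst ` K else {})"
      proof (cases "t \<in> fst ` K")
        case True
        then show ?thesis using single[OF True] by simp
      next
        case False
        then have "v t = 0" by (simp add: v_def)
        then show ?thesis using False by simp
      qed
    qed
    moreover have "\<dots> \<in> sets borel" using \<Phi>(4)[OF C] T by auto
    ultimately show "v -` C \<inter> space borel \<in> sets borel" by simp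
  qed auto
  moreover have "(t, v t) \<in> K" if "t \<in> fst ` K" for t using single[OF that] \<Phi>(2)[OF that] by auto
  ultimately show ?thesis using that by blast
qed

text \<open>Finitely valued approximations of the identity reduce Caratheodory maps to countably many
  functions of \<open>t\<close>.\<close>

lemma borel_finite_rounding:
  obtains r :: "nat \<Rightarrow> 'a::euclidean_space \<Rightarrow> 'a"
  where "\<And>n. simple_function borel (r n)" "\<And>z. (\<lambda>n. r n z) \<longlonglongrightarrow> z"
proof -
  have "(\<lambda>z::'a. z) \<in> borel_measurable borel" by simp
  from borel_measurable_implies_sequence_metric[OF this, of 0] that show ?thesis by auto
qed

lemma measurable_count_space_range:
  assumes "simple_function borel r" and "z \<in> borel_measurable M"
  shows "(\<lambda>w. r (z w)) \<in> measurable M (count_space (range r))"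
proof -
  have "r \<in> measurable borel (count_space (range r))"
    using measurable_simple_function[OF assms(1)] by (auto simp: measurable_def)
  from measurable_compose[OF assms(2) this] show ?thesis .
qed

lemma superposition_measurable:
  fixes a :: "real \<Rightarrow> 'z::euclidean_space \<Rightarrow> 'b::metric_space"
  assumes meas: "\<And>z. (\<lambda>t. a t z) \<in> borel_measurable M"
    and cont: "\<And>t. t \<in> space M \<Longrightarrow> continuous_on UNIV (a t)"
    and z: "z \<in> borel_measurable M"
  shows "(\<lambda>t. a t (z t)) \<in> borel_measurable M"
proof -
  obtain r :: "nat \<Rightarrow> 'z \<Rightarrow> 'z" where r: "\<And>n. simple_function borel (r n)" "\<And>z. (\<lambda>n. r n z) \<longlonglongrightarrow> z"
    using borel_finite_rounding by blast
  show ?thesis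
  proof (rule borel_measurable_LIMSEQ_metric)
    fix n
    show "(\<lambda>t. a t (r n (z t))) \<in> borel_measurable M"
    proof (rule measurable_compose_countable'[OF _ measurable_count_space_range[OF r(1) z]])
      have "finite (range (r n))" using simple_functionD(1)[OF r(1)[of n]] by simp
      then show "countable (range (r n))" by (rule countable_finite)
    qed (rule meas)
  next
    fix t assume t: "t \<in> space M"
    show "(\<lambda>n. a t (r n (z t))) \<longlonglongrightarrow> a t (z t)"
      by (rule continuous_on_tendsto_compose[OF cont[OF t] r(2)]) auto
  qed
qed

lemma fst_vimage_borel:
  fixes N :: "'a::topological_space set"
  assumes "N \<in> sets borel"
  shows "fst -` N \<in> sets (borel :: ('a \<times> 'b::topological_space) measure)"
proof -
  have "(fst :: 'a \<times> 'b \<Rightarrow> 'a) \<in> borel_measurable borel" by (intro borel_measurable_continuous_onI continuous_intros)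
  from measurable_sets[OF this assms] show ?thesis by simp
qed

text \<open>Prepares the joint Borel set that \<open>borel_projection_inner_compact\<close> asks
  for. The rounded controls take values in one countable set \<open>D\<close>; Borel versions of the
  countably many corresponding functions of \<open>t\<close> agree with \<open>k\<close> off a
  common null set, and continuity in the control recovers the map from them.\<close>

lemma caratheodory_borel_version:
  fixes k :: "real \<Rightarrow> 'u::euclidean_space \<Rightarrow> real"
  assumes meas: "\<And>p. (\<lambda>t. k t p) \<in> borel_measurable (lebesgue_on {0..})"
    and cont: "\<And>t. t \<ge> 0 \<Longrightarrow> continuous_on UNIV (k t)"
  obtains N k' where "N \<in> sets borel" "negligible N"
    "(\<lambda>(t,p). k' t p) \<in> borel_measurable borel" "\<And>t p. t \<ge> 0 \<Longrightarrow> t \<notin> N \<Longrightarrow> k' t p = k t p"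
proof -
  obtain r :: "nat \<Rightarrow> 'u \<Rightarrow> 'u" where r: "\<And>n. simple_function borel (r n)" "\<And>z. (\<lambda>n. r n z) \<longlonglongrightarrow> z"
    using borel_finite_rounding by blast
  have "\<exists>h\<in>borel_measurable lborel. AE t in lborel. (if t \<in> {0..} then k t p else 0) = h t" for p
  proof -
    have "(\<lambda>t. if t \<in> {0..} then k t p else 0) \<in> borel_measurable lebesgue"
      using meas[of p] by (subst borel_measurable_if) auto
    then show ?thesis by (rule completion_ex_borel_measurable_real)
  qed
  then obtain h where h: "\<And>p. h p \<in> borel_measurable borel" "\<And>p. AE t in lborel. (if t \<in> {0..} then k t p else 0) = h p t"
  proof -
    have "\<forall>p. \<exists>h. h \<in> borel_measurable borel \<and> (AE t in lborel. (if t \<in> {0..} then k t p else 0) = h t)"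
      using \<open>\<And>p. \<exists>h\<in>borel_measurable lborel. AE t in lborel. (if t \<in> {0..} then k t p else 0) = h t\<close> unfolding Bex_def measurable_lborel2 by blast
    from choice[OF this] show ?thesis using that by blast
  qed
  define D where "D = (\<Union>n. range (r n))"
  have D: "countable D"
    unfolding D_def
    by (rule countable_UN) (use simple_functionD(1)[OF r(1)] in \<open>auto intro!: countable_finite\<close>)
  have "AE t in lborel. \<forall>p\<in>D. (if t \<in> {0..} then k t p else 0) = h p t"
    using h(2) by (simp add: AE_ball_countable[OF D])
  then obtain N where N: "N \<in> null_sets lborel" "\<And>t p. t \<notin> N \<Longrightarrow> p \<in> D \<Longrightarrow> (if t \<in> {0..} then k t p else 0) = h p t"
    by (elim AE_E3) auto
  have Nb: "N \<in> sets borel" using N(1) by (metis null_setsD2 sets_lborel)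
  have Nneg: "negligible N" using N(1) by (simp add: negligible_iff_null_sets null_sets_completionI)
  define k' where "k' t p = (if t \<in> N \<or> t < 0 then 0 else k t p)" for t p
  have "(\<lambda>z. k' (fst z) (snd z)) \<in> borel_measurable borel"
  proof (rule borel_measurable_LIMSEQ_metric)
    fix n
    have "(\<lambda>z::real \<times> 'u. h (r n (snd z)) (fst z)) \<in> borel_measurable borel"
    proof (rule measurable_compose_countable'[OF _ measurable_count_space_range[OF r(1)]])
      have "finite (range (r n))" using simple_functionD(1)[OF r(1)[of n]] by simp
      then show "countable (range (r n))" by (rule countable_finite)
      show "(snd :: real \<times> 'u \<Rightarrow> 'u) \<in> borel_measurable borel" by (intro borel_measurable_continuous_onI continuous_intros)
      fix p
      have "(fst :: real \<times> 'u \<Rightarrow> real) \<in> borel_measurable borel" by (intro borel_measurable_continuous_onI continuous_intros)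
      then show "(\<lambda>z::real \<times> 'u. h p (fst z)) \<in> borel_measurable borel" using h(1)[of p] by (rule measurable_compose)
    qed
    moreover have "{z::real \<times> 'u. fst z \<in> N \<or> fst z < 0} \<in> sets borel"
    proof -
      have eq: "{z::real \<times> 'u. fst z \<in> N \<or> fst z < 0} = fst -` (N \<union> {..<0})" by auto
      show ?thesis unfolding eq by (rule fst_vimage_borel) (use Nb in auto)
    qed
    ultimately show "(\<lambda>z::real \<times> 'u. if fst z \<in> N \<or> fst z < 0 then 0 else h (r n (snd z)) (fst z)) \<in> borel_measurable borel"
      by (intro measurable_If) auto
  next
    fix z :: "real \<times> 'u"
    show "(\<lambda>n. if fst z \<in> N \<or> fst z < 0 then 0 else h (r n (snd z)) (fst z)) \<longlonglongrightarrow> k' (fst z) (snd z)"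
    proof (cases "fst z \<in> N \<or> fst z < 0")
      case False
      have "(\<lambda>n. k (fst z) (r n (snd z))) \<longlonglongrightarrow> k (fst z) (snd z)"
        by (rule continuous_on_tendsto_compose[OF cont r(2)]) (use False in auto)
      moreover have "k (fst z) (r n (snd z)) = h (r n (snd z)) (fst z)" for n
        using N(2)[of "fst z" "r n (snd z)"] False by (auto simp: D_def)
      ultimately show ?thesis using False by (simp add: k'_def)
    qed (simp add: k'_def)
  qed
  then have "(\<lambda>(t,p). k' t p) \<in> borel_measurable borel" by (simp add: split_beta)
  then show ?thesis by (intro that[of N k'] Nb Nneg) (auto simp: k'_def)
qed

text \<open>Off a null set of times, the pairs with positive value form a Borel subset of the graph.
  A compact part of it whose projection is not null provides both the Borel selection and its
  boundedness.\<close>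

lemma positive_selection:
  fixes U :: "real \<Rightarrow> 'u::euclidean_space set" and k :: "real \<Rightarrow> 'u \<Rightarrow> real"
  assumes graph: "set_graph U \<in> sets borel"
    and meas: "\<And>p. (\<lambda>t. k t p) \<in> borel_measurable (lebesgue_on {0..})"
    and cont: "\<And>t. t \<ge> 0 \<Longrightarrow> continuous_on UNIV (k t)"
    and bad: "\<not> negligible {t\<in>{0..T}. \<exists>p\<in>U t. k t p > 0}"
  obtains S v where "compact S" "S \<subseteq> {0..T}" "\<not> negligible S" "v \<in> borel_measurable borel" "bounded (v ` S)"
    "\<forall>t\<in>S. v t \<in> U t \<and> k t (v t) > 0"
proof -
  obtain N k' where N: "N \<in> sets borel" "negligible N" and k': "(\<lambda>(t,p). k' t p) \<in> borel_measurable borel"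
    "\<And>t p. t \<ge> 0 \<Longrightarrow> t \<notin> N \<Longrightarrow> k' t p = k t p"
    using caratheodory_borel_version[of k] meas cont by blast
  define G where "G = set_graph U \<inter> ({0..T} - N) \<times> UNIV \<inter> {z. (\<lambda>(t,p). k' t p) z > 0}"
  have "{z. (\<lambda>(t,p). k' t p) z > 0} \<in> sets borel"
    using borel_measurable_less[OF borel_measurable_const[of 0] k'(1)] by simp
  moreover have "({0..T} - N) \<times> (UNIV :: 'u set) \<in> sets borel"
  proof -
    have "fst -` ({0..T} - N) = ({0..T} - N) \<times> (UNIV :: 'u set)" by auto
    then show ?thesis using fst_vimage_borel[of "{0..T} - N", where 'b = 'u] N(1) by simp
  qed
  ultimately have G: "G \<in> sets borel" "G \<subseteq> {0..T} \<times> UNIV" using graph by (auto simp: G_def)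
  have "{t\<in>{0..T}. \<exists>p\<in>U t. k t p > 0} \<subseteq> fst ` G \<union> N"
  proof
    fix t assume "t \<in> {t\<in>{0..T}. \<exists>p\<in>U t. k t p > 0}"
    then obtain p where p: "t \<in> {0..T}" "p \<in> U t" "k t p > 0" by auto
    show "t \<in> fst ` G \<union> N"
    proof (cases "t \<in> N")
      case False
      then have "(t, p) \<in> G" using p k'(2)[of t p] by (auto simp: G_def set_graph_def)
      then show ?thesis by force
    qed simp
  qed
  then have "\<not> negligible (fst ` G)" using bad N(2) by (meson negligible_Un negligible_subset)
  then obtain K where K: "compact K" "K \<subseteq> G" "\<not> negligible (fst ` K)"
    using borel_projection_inner_compact[OF G] by blast
  obtain v where v: "v \<in> borel_measurable borel" "\<And>t. t \<in> fst ` K \<Longrightarrow> (t, v t) \<in> K"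
    using compact_borel_selection[OF K(1)] by blast
  have S: "compact (fst ` K)" by (intro compact_continuous_image K continuous_intros)
  have "v ` (fst ` K) \<subseteq> snd ` K" using v(2) by force
  then have "bounded (v ` (fst ` K))"
    by (rule bounded_subset[rotated]) (intro compact_imp_bounded compact_continuous_image K continuous_intros)
  moreover have "v t \<in> U t \<and> k t (v t) > 0" if "t \<in> fst ` K" for t
  proof -
    have "(t, v t) \<in> G" using v(2)[OF that] K(2) by auto
    then show ?thesis using k'(2)[of t "v t"] by (auto simp: G_def set_graph_def)
  qed
  moreover have "fst ` K \<subseteq> {0..T}" using K(2) G(2) by auto
  ultimately show ?thesis using that[of "fst ` K" v] S K(3) v(1) by blast
qed

section \<open>Trajectories\<close>

lemma AC_halfline_continuous_on: "x \<in> AC_halfline \<Longrightarrow> continuous_on {0..} x"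
  by (intro continuous_on_halflineI abs_cont_imp_continuous_on) (auto simp: AC_halfline_def)

lemma locally_integrable_continuous:
  "continuous_on {0..} h \<Longrightarrow> locally_integrable h"
  unfolding locally_integrable_def
  by (auto intro!: absolutely_integrable_continuous_real elim!: continuous_on_subset)

lemma locally_integrable_add:
  "locally_integrable h \<Longrightarrow> locally_integrable k \<Longrightarrow> locally_integrable (\<lambda>t. h t + k t)"
  by (auto simp: locally_integrable_def)

lemma locally_integrable_mult:
  "locally_integrable h \<Longrightarrow> locally_integrable (\<lambda>t. c * h t)"
  by (auto simp: locally_integrable_def)

text \<open>Glues a sequence of bounds, the one with index \<open>n + 1\<close> being used between
  \<open>n\<close> and \<open>n + 1\<close>; in \<open>ex_trajectory\<close> they belong to growing
  balls.\<close>

lemma locally_integrable_diagonal: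
  assumes W: "\<And>n::nat. locally_integrable (W n)"
  shows "locally_integrable (\<lambda>t. W (nat \<lceil>t\<rceil>) t)"
proof -
  have step: "(\<lambda>t. W (nat \<lceil>t\<rceil>) t) absolutely_integrable_on {0..real n}" for n
  proof (induction n)
    case (Suc n)
    have "W (Suc n) absolutely_integrable_on {real n..real (Suc n)}"
      using absolutely_integrable_on_subinterval[OF locally_integrableD[OF W[of "Suc n"]], of "real (Suc n)" "real n" "real (Suc n)"] by auto
    then have "(\<lambda>t. W (nat \<lceil>t\<rceil>) t) absolutely_integrable_on {real n..real (Suc n)}"
    \<comment> \<open>At the left end \<open>n\<close> the ceiling is still \<open>n\<close>, so
      this point is treated as exceptional.\<close>
    proof (rule absolutely_integrable_spike[OF _ negligible_sing[of "real n"]])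
      fix t assume "t \<in> {real n..real (Suc n)} - {real n}"
      then have "\<lceil>t\<rceil> = int (Suc n)" by (intro ceiling_unique) auto
      then have "nat \<lceil>t\<rceil> = Suc n" by (simp only: nat_int)
      then show "W (nat \<lceil>t\<rceil>) t = W (Suc n) t" by (simp only:)
    qed
    from set_integrable_Un[OF Suc this] have "(\<lambda>t. W (nat \<lceil>t\<rceil>) t) absolutely_integrable_on ({0..real n} \<union> {real n..real (Suc n)})"
      by auto
    moreover have "{0..real n} \<union> {real n..real (Suc n)} = {0..real (Suc n)}" by auto
    ultimately show ?case by simp
  qed (use absolutely_integrable_on_null[of 0 "0::real"] in simp)
  show ?thesis
    unfolding locally_integrable_def
  proof (intro allI impI)
    fix T :: real assume "0 \<le> T"
    obtain n :: nat where "T \<le> n" using real_arch_simple by blast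
    then show "(\<lambda>t. W (nat \<lceil>t\<rceil>) t) absolutely_integrable_on {0..T}"
      using absolutely_integrable_on_subinterval[OF step[of n], of 0 T] by auto
  qed
qed

text \<open>The radial retraction onto the closed ball of radius \<open>r\<close>, for
  \<open>r > 0\<close>.\<close>

definition cutoff :: "real \<Rightarrow> 'x::euclidean_space \<Rightarrow> 'x" where
  "cutoff r x = (r / max r (norm x)) *\<^sub>R x"

lemma cutoff_id: "r > 0 \<Longrightarrow> norm x \<le> r \<Longrightarrow> cutoff r x = x"
  by (simp add: cutoff_def max_def)

lemma norm_cutoff: "r > 0 \<Longrightarrow> norm (cutoff r x) \<le> r" "r > 0 \<Longrightarrow> norm (cutoff r x) \<le> norm x"
  by (auto simp: cutoff_def max_def divide_simps mult_le_cancel_right)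

text \<open>One unit of the constant comes from moving the point under a fixed factor, the other
  from the change of the factor, which is controlled by the change of the norm.\<close>

lemma cutoff_lipschitz:
  assumes r: "r > 0"
  shows "norm (cutoff r x - cutoff r y) \<le> 2 * norm (x - y)"
proof -
  define m where "m z = max r (norm z)" for z :: 'a
  have m: "m z \<ge> r" "m z \<ge> norm z" "m z > 0" for z using r by (auto simp: m_def)
  have "\<bar>m y - m x\<bar> \<le> \<bar>norm y - norm x\<bar>" by (auto simp: m_def max_def)
  also have "\<dots> \<le> norm (x - y)" by (metis norm_minus_commute norm_triangle_ineq3)
  finally have mm: "\<bar>m y - m x\<bar> \<le> norm (x - y)" .
  have "cutoff r x - cutoff r y = (r / m x) *\<^sub>R (x - y) + (r / m x * ((m y - m x) / m y)) *\<^sub>R y"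
    using m(3)[of x] m(3)[of y] unfolding cutoff_def m_def[symmetric]
    by (simp add: algebra_simps field_simps flip: scaleR_add_left)
  also have "norm \<dots> \<le> r / m x * norm (x - y) + r / m x * (\<bar>m y - m x\<bar> / m y) * norm y"
    using r m(3)[of x] m(3)[of y] by (intro order_trans[OF norm_triangle_ineq]) (auto simp: abs_mult)
  also have "\<dots> \<le> 1 * norm (x - y) + 1 * norm (x - y)"
  proof (intro add_mono mult_right_mono)
    have rm: "r / m x \<le> 1" using m[of x] r by simp
    then show "r / m x \<le> 1" .
    have "r / m x * (\<bar>m y - m x\<bar> / m y) * norm y = r / m x * (\<bar>m y - m x\<bar> * (norm y / m y))" by simp
    also have "\<dots> \<le> 1 * (norm (x - y) * 1)"
      using rm mm m[of y] r m(3)[of x] by (intro mult_mono) auto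
    finally show "r / m x * (\<bar>m y - m x\<bar> / m y) * norm y \<le> 1 * norm (x - y)" by simp
  qed auto
  finally show ?thesis by simp
qed

lemma continuous_on_cutoff:
  assumes "continuous_on S r" "continuous_on S x" "\<And>t. t \<in> S \<Longrightarrow> r t > 0"
  shows "continuous_on S (\<lambda>t. cutoff (r t) (x t))"
proof -
  have "max (r t) (norm (x t)) \<noteq> 0" if "t \<in> S" for t
    using assms(3)[OF that] by auto
  then show ?thesis unfolding cutoff_def by (intro continuous_intros assms(1,2)) auto
qed

section \<open>Superposition with admissible controls\<close>

lemma admissible_measurable:
  fixes u :: "real \<Rightarrow> 'u::euclidean_space"
  assumes "u \<in> admissible_controls U"
  shows "u \<in> borel_measurable (lebesgue_on {0..})"
proof -
  have "(\<lambda>t. indicator {0..} t *\<^sub>R u t) \<in> borel_measurable borel"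
    using assms by (subst borel_measurable_restrict_space_iff[symmetric]) (auto simp: admissible_controls_def)
  then have "(\<lambda>t. indicator {0..} t *\<^sub>R u t) \<in> borel_measurable lebesgue"
    by (auto intro: measurable_completion)
  then show ?thesis by (subst borel_measurable_restrict_space_iff) auto
qed

lemma caratheodory_superposition:
  fixes a :: "real \<Rightarrow> 'x::euclidean_space \<Rightarrow> 'u::euclidean_space \<Rightarrow> 'b::real_normed_vector"
  assumes a: "caratheodory a" and x: "continuous_on {0..} x" and u: "u \<in> admissible_controls U"
  shows "(\<lambda>t. a t (x t) (u t)) \<in> borel_measurable (lebesgue_on {0..})"
proof -
  have "(\<lambda>t. a t (fst (x t, u t)) (snd (x t, u t))) \<in> borel_measurable (lebesgue_on {0..})"
  proof (rule superposition_measurable[where a = "\<lambda>t z. a t (fst z) (snd z)" and z = "\<lambda>t. (x t, u t)"])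
    show "(\<lambda>t. (x t, u t)) \<in> borel_measurable (lebesgue_on {0..})"
      by (intro borel_measurable_Pair continuous_imp_measurable_on_sets_lebesgue x admissible_measurable[OF u]) auto
  qed (use a in \<open>auto simp: caratheodory_def split_beta\<close>)
  then show ?thesis by simp
qed

lemma regular_map_bound:
  assumes "regular_map U a" "compact K"
  obtains L where "locally_integrable L" "\<And>t x u. t \<ge> 0 \<Longrightarrow> x \<in> K \<Longrightarrow> u \<in> U t \<Longrightarrow> norm (a t x u) \<le> L t"
  using assms unfolding regular_map_def integrally_bounded_on_compacts_def by auto

text \<open>Optimality is kept out of the locale: it enters later as an inequality between pay-offs
  on a single horizon.\<close>

locale control_system =
  fixes U :: "real \<Rightarrow> 'u::euclidean_space set"
    and f :: "real \<Rightarrow> 'x::euclidean_space \<Rightarrow> 'u \<Rightarrow> 'x"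
    and g :: "real \<Rightarrow> 'x \<Rightarrow> 'u \<Rightarrow> real"
    and fx :: "real \<Rightarrow> 'x \<Rightarrow> 'u \<Rightarrow> 'x \<Rightarrow>\<^sub>L 'x"
    and gx :: "real \<Rightarrow> 'x \<Rightarrow> 'u \<Rightarrow> 'x \<Rightarrow>\<^sub>L real"
    and M :: "real \<Rightarrow> real" and xstar :: 'x
    and u0 :: "real \<Rightarrow> 'u" and x0 :: "real \<Rightarrow> 'x"
  assumes U_graph: "set_graph U \<in> sets borel"
    and f_deriv: "\<And>t x u. 0 \<le> t \<Longrightarrow> ((\<lambda>y. f t y u) has_derivative fx t x u) (at x)"
    and g_deriv: "\<And>t x u. 0 \<le> t \<Longrightarrow> ((\<lambda>y. g t y u) has_derivative gx t x u) (at x)"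
    and f_regular: "regular_map U f" and fx_regular: "regular_map U fx"
    and g_regular: "regular_map U g" and gx_regular: "regular_map U gx"
    and M_cont: "continuous_on {0..} M" and M_nonneg: "\<And>t. 0 \<le> t \<Longrightarrow> 0 \<le> M t"
    and f_growth: "\<And>t x u. 0 \<le> t \<Longrightarrow> u \<in> U t \<Longrightarrow> norm (f t x u) \<le> M t * (1 + norm x)"
    and u0_admissible: "u0 \<in> admissible_controls U"
    and traj: "trajectory f xstar u0 x0"
begin

section \<open>Integrable bounds on balls\<close>

lemma admissibleD: "u \<in> admissible_controls U \<Longrightarrow> t \<ge> 0 \<Longrightarrow> u t \<in> U t"
  by (simp add: admissible_controls_def)

text \<open>Both maps and both derivatives share one bound, so that the later estimates carry a
  single integrable function.\<close>

definition dominating :: "real \<Rightarrow> (real \<Rightarrow> real) \<Rightarrow> bool" where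
  "dominating R W \<longleftrightarrow> locally_integrable W \<and>
     (\<forall>t\<ge>0. \<forall>x\<in>cball 0 R. \<forall>u\<in>U t. norm (f t x u) \<le> W t \<and> norm (g t x u) \<le> W t \<and>
        norm (fx t x u) \<le> W t \<and> norm (gx t x u) \<le> W t)"

lemma ex_dominating:
  assumes "R \<ge> 0" shows "\<exists>W. dominating R W"
proof -
  obtain L1 where L1: "locally_integrable L1" "\<And>t x u. t \<ge> 0 \<Longrightarrow> x \<in> cball 0 R \<Longrightarrow> u \<in> U t \<Longrightarrow> norm (f t x u) \<le> L1 t"
    using regular_map_bound[OF f_regular compact_cball[of 0 R]] by blast
  obtain L2 where L2: "locally_integrable L2" "\<And>t x u. t \<ge> 0 \<Longrightarrow> x \<in> cball 0 R \<Longrightarrow> u \<in> U t \<Longrightarrow> norm (g t x u) \<le> L2 t"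
    using regular_map_bound[OF g_regular compact_cball[of 0 R]] by blast
  obtain L3 where L3: "locally_integrable L3" "\<And>t x u. t \<ge> 0 \<Longrightarrow> x \<in> cball 0 R \<Longrightarrow> u \<in> U t \<Longrightarrow> norm (fx t x u) \<le> L3 t"
    using regular_map_bound[OF fx_regular compact_cball[of 0 R]] by blast
  obtain L4 where L4: "locally_integrable L4" "\<And>t x u. t \<ge> 0 \<Longrightarrow> x \<in> cball 0 R \<Longrightarrow> u \<in> U t \<Longrightarrow> norm (gx t x u) \<le> L4 t"
    using regular_map_bound[OF gx_regular compact_cball[of 0 R]] by blast
  have "dominating R (\<lambda>t. L1 t + L2 t + L3 t + L4 t)"
    unfolding dominating_def
  proof (intro conjI ballI allI impI locally_integrable_add L1(1) L2(1) L3(1) L4(1))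
    fix t x u assume *: "0 \<le> t" "x \<in> cball (0::'x) R" "u \<in> U t"
    note b = L1(2)[OF *] L2(2)[OF *] L3(2)[OF *] L4(2)[OF *]
    then have "0 \<le> L1 t" "0 \<le> L2 t" "0 \<le> L3 t" "0 \<le> L4 t"
      by (meson norm_ge_zero order_trans)+
    then show "norm (f t x u) \<le> L1 t + L2 t + L3 t + L4 t" "norm (g t x u) \<le> L1 t + L2 t + L3 t + L4 t"
      "norm (fx t x u) \<le> L1 t + L2 t + L3 t + L4 t" "norm (gx t x u) \<le> L1 t + L2 t + L3 t + L4 t"
      using b by linarith+
  qed
  then show ?thesis by blast
qed

lemma dominatingD:
  assumes "dominating R W" "t \<ge> 0" "norm x \<le> R" "u \<in> U t"
  shows "norm (f t x u) \<le> W t" "\<bar>g t x u\<bar> \<le> W t" "norm (fx t x u) \<le> W t" "norm (gx t x u) \<le> W t" "W t \<ge> 0"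
proof -
  show *: "norm (f t x u) \<le> W t" "\<bar>g t x u\<bar> \<le> W t" "norm (fx t x u) \<le> W t" "norm (gx t x u) \<le> W t"
    using assms unfolding dominating_def by auto
  then show "W t \<ge> 0" by (meson norm_ge_zero order_trans)
qed

text \<open>On the convex ball the mean value inequality turns the bound on the derivatives into a
  Lipschitz constant that is locally integrable in \<open>t\<close>.\<close>

lemma dominating_lipschitz:
  assumes W: "dominating R W" "t \<ge> 0" "u \<in> U t" and x: "norm x \<le> R" "norm y \<le> R"
  shows "norm (f t x u - f t y u) \<le> W t * norm (x - y)" "\<bar>g t x u - g t y u\<bar> \<le> W t * norm (x - y)"
proof -
  show "norm (f t x u - f t y u) \<le> W t * norm (x - y)"
  proof (rule differentiable_bound[of "cball 0 R" "\<lambda>y. f t y u" "\<lambda>x. blinfun_apply (fx t x u)"])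
    show "((\<lambda>y. f t y u) has_derivative blinfun_apply (fx t z u)) (at z within cball 0 R)" for z
      by (rule has_derivative_at_withinI[OF f_deriv[OF W(2)]])
    show "onorm (blinfun_apply (fx t z u)) \<le> W t" if "z \<in> cball 0 R" for z
      using dominatingD(3)[OF W(1,2) _ W(3), of z] that by (simp add: norm_blinfun.rep_eq)
  qed (use x in auto)
  have "norm (g t x u - g t y u) \<le> W t * norm (x - y)"
  proof (rule differentiable_bound[of "cball 0 R" "\<lambda>y. g t y u" "\<lambda>x. blinfun_apply (gx t x u)"])
    show "((\<lambda>y. g t y u) has_derivative blinfun_apply (gx t z u)) (at z within cball 0 R)" for z
      by (rule has_derivative_at_withinI[OF g_deriv[OF W(2)]])
    show "onorm (blinfun_apply (gx t z u)) \<le> W t" if "z \<in> cball 0 R" for z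
      using dominatingD(4)[OF W(1,2) _ W(3), of z] that by (simp add: norm_blinfun.rep_eq)
  qed (use x in auto)
  then show "\<bar>g t x u - g t y u\<bar> \<le> W t * norm (x - y)" by simp
qed

text \<open>A bound for the states of all trajectories at time \<open>t\<close>; cutting off the right-hand side beyond it
  makes the equation globally Lipschitz without changing its solutions.\<close>

definition radius :: "real \<Rightarrow> real" where
  "radius t = 2 * (1 + norm xstar) * exp (2 * integral {0..t} M)"

lemma M_locally_integrable: "locally_integrable M"
  by (rule locally_integrable_continuous[OF M_cont])

lemma M_integrable: "t \<ge> 0 \<Longrightarrow> M absolutely_integrable_on {0..t}" "t \<ge> 0 \<Longrightarrow> M integrable_on {0..t}"
  using locally_integrableD[OF M_locally_integrable] set_lebesgue_integral_eq_integral(1) by auto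

lemma radius_pos: "radius t > 0"
  unfolding radius_def using norm_ge_zero[of xstar] by (simp add: add_pos_nonneg)

lemma radius_mono: "0 \<le> s \<Longrightarrow> s \<le> t \<Longrightarrow> radius s \<le> radius t"
  unfolding radius_def using M_nonneg M_integrable(2)
  by (intro mult_left_mono) (auto intro!: integral_subset_le)

lemma radius_continuous: "continuous_on {0..} radius"
  unfolding radius_def
  by (rule continuous_on_halflineI) (intro continuous_intros indefinite_integral_continuous_1 M_integrable(2))

text \<open>The integrand is an arbitrary \<open>h\<close> of linear growth, so that the bound
  covers the original equation as well as the one with the truncated right-hand side.\<close>

lemma growth_bound:
  assumes x: "continuous_on {0..} x" "\<And>t. t \<ge> 0 \<Longrightarrow> x t = xstar + integral {0..t} h"
    and h: "\<And>t. t \<ge> 0 \<Longrightarrow> h integrable_on {0..t}" "\<And>t. t \<ge> 0 \<Longrightarrow> norm (h t) \<le> M t * (1 + norm (x t))"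
    and t: "t \<ge> 0"
  shows "norm (x t) \<le> radius t"
proof -
  have "1 + norm (x t) \<le> 2 * (1 + norm xstar) * exp (2 * integral {0..t} M)"
  proof (rule gronwall[where L = M and T = t and y = "\<lambda>s. 1 + norm (x s)"])
    show "continuous_on {0..t} (\<lambda>s. 1 + norm (x s))"
      by (intro continuous_intros continuous_on_subset[OF x(1)]) auto
    fix s assume s: "s \<in> {0..t}"
    have Mc: "continuous_on {0..s} (\<lambda>r. M r * (1 + norm (x r)))"
      by (intro continuous_intros continuous_on_subset[OF x(1)] continuous_on_subset[OF M_cont]) auto
    have "norm (integral {0..s} h) \<le> integral {0..s} (\<lambda>r. M r * (1 + norm (x r)))"
      by (intro integral_norm_bound_integral h integrable_continuous_real Mc) (use s in auto)
    then show "1 + norm (x s) \<le> 1 + norm xstar + integral {0..s} (\<lambda>r. M r * (1 + norm (x r)))"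
      using x(2)[of s] s norm_triangle_ineq[of xstar "integral {0..s} h"] by auto
  qed (use t M_nonneg M_integrable in auto)
  then show ?thesis by (simp add: radius_def)
qed

lemma integrand_integrable:
  assumes x: "continuous_on {0..} x" and u: "u \<in> admissible_controls U" and T: "T \<ge> 0"
  shows "(\<lambda>t. f t (x t) (u t)) absolutely_integrable_on {0..T}"
    and "(\<lambda>t. g t (x t) (u t)) absolutely_integrable_on {0..T}"
proof -
  have "bounded (x ` {0..T})"
    by (intro compact_imp_bounded compact_continuous_image continuous_on_subset[OF x]) auto
  then obtain R where R: "R > 0" "\<And>t. t \<in> {0..T} \<Longrightarrow> norm (x t) \<le> R" unfolding bounded_pos by (auto simp del: atLeastAtMost_iff)
  obtain W where W: "dominating R W" using ex_dominating[of R] R by auto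
  have Wi: "W integrable_on {0..T}"
    using W T set_lebesgue_integral_eq_integral(1) unfolding dominating_def locally_integrable_def by blast
  have m: "(\<lambda>t. f t (x t) (u t)) \<in> borel_measurable (lebesgue_on {0..})" "(\<lambda>t. g t (x t) (u t)) \<in> borel_measurable (lebesgue_on {0..})"
    using f_regular g_regular by (auto simp: regular_map_def intro!: caratheodory_superposition[OF _ x u])
  show "(\<lambda>t. f t (x t) (u t)) absolutely_integrable_on {0..T}"
    by (rule measurable_bounded_by_integrable_imp_absolutely_integrable[OF measurable_restrict_mono[OF m(1)] _ Wi])
      (use dominatingD[OF W] R admissibleD[OF u] in auto)
  show "(\<lambda>t. g t (x t) (u t)) absolutely_integrable_on {0..T}"
    by (rule measurable_bounded_by_integrable_imp_absolutely_integrable[OF measurable_restrict_mono[OF m(2)] _ Wi])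
      (use dominatingD[OF W] R admissibleD[OF u] in auto)
qed

section \<open>Integral form and existence of trajectories\<close>

lemma trajectory_integral:
  assumes u: "u \<in> admissible_controls U" and x: "trajectory f xstar u x" and t: "t \<ge> 0"
  shows "continuous_on {0..} x" "x t = xstar + integral {0..t} (\<lambda>s. f s (x s) (u s))" "norm (x t) \<le> radius t"
proof -
  have ac: "x \<in> AC_halfline" "x 0 = xstar" and
    d: "AE t in lebesgue. t \<in> {0..} \<longrightarrow> (x has_vector_derivative f t (x t) (u t)) (at t)"
    using x by (auto simp: trajectory_def)
  show c: "continuous_on {0..} x" by (rule AC_halfline_continuous_on[OF ac(1)])
  have eq: "x t = xstar + integral {0..t} (\<lambda>s. f s (x s) (u s))" if t: "t \<ge> 0" for t
  proof -
    have "AE s in lebesgue. s \<in> {0..t} \<longrightarrow> (x has_vector_derivative f s (x s) (u s)) (at s)"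
      using d by eventually_elim auto
    from abs_cont_on_integral_AE[OF _ t this] have "((\<lambda>s. f s (x s) (u s)) has_integral (x t - x 0)) {0..t}"
      using ac(1) t by (auto simp: AC_halfline_def)
    then show ?thesis using ac(2) by (simp add: integral_unique)
  qed
  then show "x t = xstar + integral {0..t} (\<lambda>s. f s (x s) (u s))" using t by blast
  show "norm (x t) \<le> radius t"
  proof (rule growth_bound[OF c eq])
    show "(\<lambda>s. f s (x s) (u s)) integrable_on {0..t}" if "t \<ge> 0" for t
      using integrand_integrable(1)[OF c u that] set_lebesgue_integral_eq_integral(1) by blast
    show "norm (f t (x t) (u t)) \<le> M t * (1 + norm (x t))" if "t \<ge> 0" for t
      by (rule f_growth[OF that admissibleD[OF u that]])
  qed (use t in auto)
qed

lemma ex_trajectory: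
  assumes u: "u \<in> admissible_controls U"
  shows "\<exists>x. trajectory f xstar u x"
proof -
  have "\<exists>W. dominating (radius (real n)) W" for n by (intro ex_dominating less_imp_le radius_pos)
  then obtain W where W: "\<And>n. dominating (radius (real n)) (W n)" by metis
  \<comment> \<open>At time \<open>t\<close> the truncated states lie in the ball of radius
    \<open>radius t\<close>, and by monotonicity in the ball that belongs to the integer
    \<open>\<lceil>t\<rceil>\<close>.\<close>
  define L where "L t = W (nat \<lceil>t\<rceil>) t" for t
  have L: "locally_integrable L"
    unfolding L_def by (rule locally_integrable_diagonal) (use W in \<open>auto simp: dominating_def\<close>)
  define F where "F t x = f t (cutoff (radius t) x) (u t)" for t x
  \<comment> \<open>\<open>M t\<close> is added because \<open>picard_halfline\<close> wants one
    function that serves as Lipschitz constant and also bounds the value at 0.\<close>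
  have nn: "L t \<ge> 0" and lip: "norm (F t x - F t y) \<le> (2 * L t + M t) * norm (x - y)" if t: "t \<ge> 0" for t x y
  proof -
    have le: "t \<le> real (nat \<lceil>t\<rceil>)" using t by linarith
    have in_ball: "norm (cutoff (radius t) z) \<le> radius (real (nat \<lceil>t\<rceil>))" for z :: 'x
      using norm_cutoff(1)[OF radius_pos, of t z] radius_mono[OF t le] by linarith
    show nn: "L t \<ge> 0" unfolding L_def using dominatingD(5)[OF W t in_ball[of 0] admissibleD[OF u t]] .
    have "norm (F t x - F t y) \<le> L t * norm (cutoff (radius t) x - cutoff (radius t) y)"
      unfolding F_def L_def by (rule dominating_lipschitz(1)[OF W t admissibleD[OF u t] in_ball in_ball])
    also have "\<dots> \<le> L t * (2 * norm (x - y))"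
      by (intro mult_left_mono cutoff_lipschitz radius_pos nn)
    also have "\<dots> \<le> (2 * L t + M t) * norm (x - y)" using M_nonneg[OF t] by (simp add: algebra_simps)
    finally show "norm (F t x - F t y) \<le> (2 * L t + M t) * norm (x - y)" .
  qed
  have meas: "(\<lambda>t. F t (x t)) \<in> borel_measurable (lebesgue_on {0..})" if x: "continuous_on {0..} x" for x
    unfolding F_def using f_regular
    by (intro caratheodory_superposition[OF _ _ u] continuous_on_cutoff radius_continuous x radius_pos) (auto simp: regular_map_def)
  have Fbound: "norm (F t x) \<le> M t * (1 + norm x)" if t: "t \<ge> 0" for t x
  proof -
    have "norm (F t x) \<le> M t * (1 + norm (cutoff (radius t) x))"
      unfolding F_def by (rule f_growth[OF t admissibleD[OF u t]])
    also have "\<dots> \<le> M t * (1 + norm x)"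
      using norm_cutoff(2)[OF radius_pos, of t x] M_nonneg[OF t] by (intro mult_left_mono) auto
    finally show ?thesis .
  qed
  have bd: "norm (F t 0) \<le> 2 * L t + M t" if "t \<ge> 0" for t
    using Fbound[OF that, of 0] nn[OF that] by simp
  have Li: "locally_integrable (\<lambda>t. 2 * L t + M t)"
    by (intro locally_integrable_add locally_integrable_mult L M_locally_integrable)
  obtain x where x: "continuous_on {0..} x" "\<And>t. t \<ge> 0 \<Longrightarrow> x t = xstar + integral {0..t} (\<lambda>s. F s (x s))"
    using picard_halfline[OF absolutely_integrable_superposition[OF meas Li lip bd] Li lip bd, of xstar] by blast
  have Fx: "(\<lambda>s. F s (x s)) absolutely_integrable_on {0..t}" if "t \<ge> 0" for t
    by (rule absolutely_integrable_superposition[OF meas Li lip bd x(1) that])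
  \<comment> \<open>Truncation does not increase norms, so the truncated right-hand side has the
    same linear growth and its solution stays where nothing was changed.\<close>
  have "norm (x t) \<le> radius t" if "t \<ge> 0" for t
    by (rule growth_bound[OF x(1) x(2) _ Fbound that]) (use Fx set_lebesgue_integral_eq_integral(1) in blast)+
  then have "F t (x t) = f t (x t) (u t)" if "t \<ge> 0" for t
    using that by (simp add: F_def cutoff_id[OF radius_pos])
  moreover have "x \<in> AC_halfline" "AE t in lebesgue. t \<in> {0..} \<longrightarrow> (x has_vector_derivative F t (x t)) (at t)"
    using AC_halfline_integral[OF Fx x(2)] by auto
  moreover have "x 0 = xstar" using x(2)[of 0] by simp
  ultimately have "trajectory f xstar u x" unfolding trajectory_def
    by (auto elim!: eventually_mono)
  then show ?thesis by (intro exI[of _ x])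
qed

end

section \<open>The adjoint equation\<close>

lemma has_integral_reflect_shift:
  fixes h :: "real \<Rightarrow> 'a::euclidean_space"
  assumes "(h has_integral i) {a..b}"
  shows "((\<lambda>s. h (T - s)) has_integral i) {T - b..T - a}"
proof -
  have "((\<lambda>s. h (- s)) has_integral i) {-b..-a}" using assms by simp
  from has_integral_shift_real_ivl[OF this, of "- T"] show ?thesis by simp
qed

lemma absolutely_integrable_reflect_shift:
  fixes h :: "real \<Rightarrow> 'a::euclidean_space"
  assumes "h absolutely_integrable_on {0..T}"
  shows "(\<lambda>s. h (T - s)) absolutely_integrable_on {0..T}"
  using assms has_integral_reflect_shift[of h _ 0 T T] has_integral_reflect_shift[of "\<lambda>t. norm (h t)" _ 0 T T]
  unfolding absolutely_integrable_on_def integrable_on_def by auto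

context control_system
begin

text \<open>The state gradient of the Hamiltonian at the reference pair: the transpose of
  \<open>fx\<close> applied to \<open>p\<close>, plus \<open>lam\<close> times the gradient of
  \<open>g\<close>, assembled from coordinates.\<close>

definition grad :: "real \<Rightarrow> real \<Rightarrow> 'x \<Rightarrow> 'x" where
  "grad lam t p = (\<Sum>b\<in>Basis. (p \<bullet> fx t (x0 t) (u0 t) b + lam * gx t (x0 t) (u0 t) b) *\<^sub>R b)"

lemma grad_inner: "grad lam t p \<bullet> v = p \<bullet> fx t (x0 t) (u0 t) v + lam * gx t (x0 t) (u0 t) v"
proof -
  have v: "v = (\<Sum>b\<in>Basis. (v \<bullet> b) *\<^sub>R b)" by (simp add: euclidean_representation)
  have "p \<bullet> fx t (x0 t) (u0 t) v = (\<Sum>b\<in>Basis. (v \<bullet> b) * (p \<bullet> fx t (x0 t) (u0 t) b))"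
    by (subst v) (simp add: blinfun.sum_right blinfun.scaleR_right inner_sum_right)
  moreover have "gx t (x0 t) (u0 t) v = (\<Sum>b\<in>Basis. (v \<bullet> b) * gx t (x0 t) (u0 t) b)"
    by (subst v) (simp add: blinfun.sum_right blinfun.scaleR_right)
  moreover have "grad lam t p \<bullet> v = (\<Sum>b\<in>Basis. (v \<bullet> b) * (p \<bullet> fx t (x0 t) (u0 t) b) + lam * ((v \<bullet> b) * gx t (x0 t) (u0 t) b))"
    unfolding grad_def inner_sum_left by (rule sum.cong) (auto simp: algebra_simps inner_commute[of v])
  ultimately show ?thesis by (simp add: sum.distrib sum_distrib_left)
qed

text \<open>Joint linearity in \<open>(lam, p)\<close> is what allows solutions with different
  multipliers to be compared and pairs to be rescaled.\<close>

lemma grad_linear: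
  "grad lam t p - grad lam' t q = grad (lam - lam') t (p - q)" "grad (c * lam) t (c *\<^sub>R p) = c *\<^sub>R grad lam t p"
proof -
  have "(grad lam t p - grad lam' t q) \<bullet> v = grad (lam - lam') t (p - q) \<bullet> v" for v
    by (simp add: inner_diff_left grad_inner algebra_simps)
  then show "grad lam t p - grad lam' t q = grad (lam - lam') t (p - q)"
    by (meson vector_eq_rdot)
  have "grad (c * lam) t (c *\<^sub>R p) \<bullet> v = (c *\<^sub>R grad lam t p) \<bullet> v" for v
    by (simp add: grad_inner algebra_simps)
  then show "grad (c * lam) t (c *\<^sub>R p) = c *\<^sub>R grad lam t p"
    by (meson vector_eq_rdot)
qed

definition coeff_norm :: "real \<Rightarrow> real" where
  "coeff_norm t = norm (fx t (x0 t) (u0 t)) + norm (gx t (x0 t) (u0 t))"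

lemma coeff_norm_nonneg: "coeff_norm t \<ge> 0" by (simp add: coeff_norm_def)

lemma norm_grad: "norm (grad lam t p) \<le> coeff_norm t * (norm p + \<bar>lam\<bar>)"
proof -
  let ?y = "grad lam t p"
  \<comment> \<open>The gradient is paired with itself; one factor of its norm is cancelled at the
    end.\<close>
  have "norm ?y * norm ?y = p \<bullet> fx t (x0 t) (u0 t) ?y + lam * gx t (x0 t) (u0 t) ?y"
    by (metis grad_inner dot_square_norm power2_eq_square)
  also have "\<dots> \<le> norm p * (norm (fx t (x0 t) (u0 t)) * norm ?y) + \<bar>lam\<bar> * (norm (gx t (x0 t) (u0 t)) * norm ?y)"
  proof (rule add_mono)
    show "p \<bullet> fx t (x0 t) (u0 t) ?y \<le> norm p * (norm (fx t (x0 t) (u0 t)) * norm ?y)"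
      by (rule order_trans[OF norm_cauchy_schwarz mult_left_mono[OF norm_blinfun]]) simp
    have "lam * gx t (x0 t) (u0 t) ?y \<le> \<bar>lam\<bar> * norm (gx t (x0 t) (u0 t) ?y)"
      by (metis abs_ge_self abs_mult real_norm_def)
    also have "\<dots> \<le> \<bar>lam\<bar> * (norm (gx t (x0 t) (u0 t)) * norm ?y)"
      by (rule mult_left_mono[OF norm_blinfun]) simp
    finally show "lam * gx t (x0 t) (u0 t) ?y \<le> \<bar>lam\<bar> * (norm (gx t (x0 t) (u0 t)) * norm ?y)" .
  qed
  also have "\<dots> \<le> (coeff_norm t * (norm p + \<bar>lam\<bar>)) * norm ?y"
    by (simp add: coeff_norm_def algebra_simps)
  finally show ?thesis
    by (cases "norm ?y = 0") (simp_all add: coeff_norm_nonneg)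
qed

section \<open>Coefficients of the adjoint equation along the reference pair\<close>

lemmas x0_facts = trajectory_integral[OF u0_admissible traj]

lemma x0_continuous: "continuous_on {0..} x0" by (rule x0_facts(1)[of 0]) simp

lemma coeff_measurable:
  "(\<lambda>t. fx t (x0 t) (u0 t)) \<in> borel_measurable (lebesgue_on {0..})"
  "(\<lambda>t. gx t (x0 t) (u0 t)) \<in> borel_measurable (lebesgue_on {0..})"
  using fx_regular gx_regular x0_continuous u0_admissible
  by (auto simp: regular_map_def intro!: caratheodory_superposition)

lemma coeff_norm_integrable: "locally_integrable coeff_norm"
  unfolding locally_integrable_def
proof (intro allI impI)
  fix T :: real assume T: "T \<ge> 0"
  obtain W where W: "dominating (radius T) W" using ex_dominating[of "radius T"] radius_pos[of T] by auto
  have m: "coeff_norm \<in> borel_measurable (lebesgue_on {0..})"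
    unfolding coeff_norm_def[abs_def]
    by (intro borel_measurable_add measurable_compose[OF coeff_measurable(1)] measurable_compose[OF coeff_measurable(2)]
        borel_measurable_continuous_onI continuous_intros)
  show "coeff_norm absolutely_integrable_on {0..T}"
  proof (rule measurable_bounded_by_integrable_imp_absolutely_integrable[OF measurable_restrict_mono[OF m]])
    show "(\<lambda>t. 2 * W t) integrable_on {0..T}"
      using W T set_lebesgue_integral_eq_integral(1) unfolding dominating_def locally_integrable_def
      by (intro integrable_on_mult_right) blast
    fix t assume t: "t \<in> {0..T}"
    then have "norm (x0 t) \<le> radius T" using x0_facts(3)[of t] radius_mono[of t T] by auto
    then show "norm (coeff_norm t) \<le> 2 * W t"
      using dominatingD(3,4)[OF W, of t "x0 t" "u0 t"] admissibleD[OF u0_admissible, of t] t by (auto simp: coeff_norm_def)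
  qed auto
qed

text \<open>The factor involving \<open>lam\<close> makes the Lipschitz constant agree with the
  bound in \<open>grad_bound0\<close>, since \<open>picard_halfline\<close> takes one function for
  both.\<close>

lemma grad_lipschitz: "norm (grad lam t p - grad lam t q) \<le> (1 + \<bar>lam\<bar>) * coeff_norm t * norm (p - q)"
proof -
  have "norm (grad lam t p - grad lam t q) \<le> coeff_norm t * norm (p - q)"
    using norm_grad[of 0 t "p - q"] by (simp add: grad_linear)
  moreover have "0 \<le> \<bar>lam\<bar> * coeff_norm t * norm (p - q)" by (simp add: coeff_norm_nonneg)
  ultimately show ?thesis by (simp add: algebra_simps)
qed

lemma grad_bound0: "norm (grad lam t 0) \<le> (1 + \<bar>lam\<bar>) * coeff_norm t"
  using norm_grad[of lam t 0] coeff_norm_nonneg[of t] by (simp add: algebra_simps)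

lemma grad_integrable:
  assumes "continuous_on {0..} \<psi>" "T \<ge> 0"
  shows "(\<lambda>t. grad lam t (\<psi> t)) absolutely_integrable_on {0..T}"
proof (rule absolutely_integrable_superposition[OF _ locally_integrable_mult[OF coeff_norm_integrable] grad_lipschitz grad_bound0 assms])
  fix \<psi> :: "real \<Rightarrow> 'x" assume \<psi>: "continuous_on {0..} \<psi>"
  have f: "(\<lambda>t. fx t (x0 t) (u0 t) b) \<in> borel_measurable (lebesgue_on {0..})" for b
    by (rule measurable_compose[OF coeff_measurable(1)]) (intro borel_measurable_continuous_onI continuous_intros)
  have g: "(\<lambda>t. gx t (x0 t) (u0 t) b) \<in> borel_measurable (lebesgue_on {0..})" for b
    by (rule measurable_compose[OF coeff_measurable(2)]) (intro borel_measurable_continuous_onI continuous_intros)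
  have p: "\<psi> \<in> borel_measurable (lebesgue_on {0..})"
    by (intro continuous_imp_measurable_on_sets_lebesgue \<psi>) auto
  show "(\<lambda>t. grad lam t (\<psi> t)) \<in> borel_measurable (lebesgue_on {0..})"
    unfolding grad_def
    by (intro borel_measurable_sum borel_measurable_scaleR borel_measurable_add borel_measurable_times
        borel_measurable_inner borel_measurable_const f g p)
qed

lemma has_derivative_hamiltonian:
  assumes "t \<ge> 0"
  shows "((\<lambda>y. hamiltonian f g y t (u0 t) lam p) has_derivative (\<lambda>v. grad lam t p \<bullet> v)) (at (x0 t))"
  unfolding hamiltonian_def grad_inner
  by (rule derivative_eq_intros f_deriv[OF assms] g_deriv[OF assms] refl | simp)+

lemma adjoint_equation_onI:
  assumes "AE t in lebesgue. t \<in> I \<longrightarrow> (\<psi> has_vector_derivative - grad lam t (\<psi> t)) (at t)" "I \<subseteq> {0..}"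
  shows "adjoint_equation_on I f g x0 u0 lam \<psi>"
  unfolding adjoint_equation_on_def using assms(1)
proof eventually_elim
  case (elim t)
  show ?case
  proof (intro impI exI[of _ "grad lam t (\<psi> t)"] conjI)
    assume "t \<in> I"
    then have "t \<ge> 0" using assms(2) by auto
    from has_derivative_hamiltonian[OF this, of lam "\<psi> t"]
    show "GDERIV (\<lambda>y. hamiltonian f g y t (u0 t) lam (\<psi> t)) (x0 t) :> grad lam t (\<psi> t)"
      by (simp add: gderiv_def inner_commute)
  qed (use elim in auto)
qed

text \<open>Supplies the limit pair in advance, from the limiting multiplier and initial value, so
  that no limit function has to be extracted from a sequence.\<close>

lemma ex_adjoint_forward:
  "\<exists>\<psi>. \<psi> \<in> AC_halfline \<and> (\<forall>t\<ge>0. \<psi> t = p - integral {0..t} (\<lambda>s. grad lam s (\<psi> s))) \<and>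
     (AE t in lebesgue. t \<in> {0..} \<longrightarrow> (\<psi> has_vector_derivative - grad lam t (\<psi> t)) (at t))"
proof -
  have int: "(\<lambda>t. - grad lam t (\<psi> t)) absolutely_integrable_on {0..T}" if "continuous_on {0..} \<psi>" "T \<ge> 0" for \<psi> T
    using absolutely_integrable_scaleR_left[OF grad_integrable[OF that, of lam], where c = "-1"] by simp
  have "norm (- grad lam t q - - grad lam t r) \<le> (1 + \<bar>lam\<bar>) * coeff_norm t * norm (q - r)" for t q r
    using grad_lipschitz[of lam t q r] by (simp add: norm_minus_commute)
  moreover have "norm (- grad lam t 0) \<le> (1 + \<bar>lam\<bar>) * coeff_norm t" for t using grad_bound0[of lam t] by simp
  ultimately obtain \<psi> where \<psi>: "continuous_on {0..} \<psi>" "\<And>t. t \<ge> 0 \<Longrightarrow> \<psi> t = p + integral {0..t} (\<lambda>s. - grad lam s (\<psi> s))"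
    using picard_halfline[of "\<lambda>t q. - grad lam t q" "\<lambda>t. (1 + \<bar>lam\<bar>) * coeff_norm t" p] int
      locally_integrable_mult[OF coeff_norm_integrable] by blast
  from AC_halfline_integral[OF int[OF \<psi>(1)] \<psi>(2)]
  show ?thesis using \<psi>(2) by (intro exI[of _ \<psi>]) auto
qed

text \<open>The solution is extended by zero beyond \<open>T\<close>.\<close>

lemma ex_adjoint_backward:
  assumes T: "T \<ge> 0"
  shows "\<exists>\<psi>. \<psi> \<in> AC_halfline \<and> \<psi> T = 0 \<and> (\<forall>t\<in>{0..T}. \<psi> t = \<psi> 0 - integral {0..t} (\<lambda>s. grad lam s (\<psi> s))) \<and>
     (AE t in lebesgue. t \<in> {0..T} \<longrightarrow> (\<psi> has_vector_derivative - grad lam t (\<psi> t)) (at t))"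
proof -
  \<comment> \<open>Time reversal turns the terminal condition into an initial one and removes the
    minus sign; the value 0 beyond \<open>T\<close> puts the problem on the half-line.\<close>
  define F where "F s q = (if s \<in> {0..T} then grad lam (T - s) q else 0)" for s q
  define L where "L s = (if s \<in> {0..T} then (1 + \<bar>lam\<bar>) * coeff_norm (T - s) else 0)" for s
  have refl_cont: "continuous_on {0..} (\<lambda>t. x (max 0 (T - t)))" if "continuous_on {0..} x" for x :: "real \<Rightarrow> 'x"
    by (rule continuous_on_compose2[OF that]) (auto intro!: continuous_intros)
  have int: "(\<lambda>s. F s (x s)) absolutely_integrable_on {0..T'}" if x: "continuous_on {0..} x" for x T'
  proof -
    have "(\<lambda>s. (\<lambda>t. grad lam t (x (max 0 (T - t)))) (T - s)) absolutely_integrable_on {0..T}"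
      by (rule absolutely_integrable_reflect_shift[OF grad_integrable[OF refl_cont[OF x] T]])
    then have "(\<lambda>s. grad lam (T - s) (x s)) absolutely_integrable_on {0..T}"
      by (rule absolutely_integrable_spike[OF _ negligible_empty]) auto
    then have "(\<lambda>s. if s \<in> {0..T} then grad lam (T - s) (x s) else 0) absolutely_integrable_on UNIV"
      by (simp only: absolutely_integrable_restrict_UNIV)
    then show ?thesis unfolding F_def by (rule absolutely_integrable_on_subinterval) auto
  qed
  have Li: "locally_integrable L"
    unfolding locally_integrable_def
  proof (intro allI impI)
    fix T' :: real
    have "(\<lambda>s. (\<lambda>t. (1 + \<bar>lam\<bar>) * coeff_norm t) (T - s)) absolutely_integrable_on {0..T}"
      by (rule absolutely_integrable_reflect_shift[OF locally_integrableD[OF locally_integrable_mult[OF coeff_norm_integrable] T]])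
    then have "L absolutely_integrable_on UNIV"
      unfolding L_def by (simp only: absolutely_integrable_restrict_UNIV)
    then show "L absolutely_integrable_on {0..T'}" by (rule absolutely_integrable_on_subinterval) auto
  qed
  have "norm (F s q - F s r) \<le> L s * norm (q - r)" for s q r
    using grad_lipschitz[of lam "T - s" q r] by (simp add: F_def L_def)
  moreover have "norm (F s 0) \<le> L s" for s using grad_bound0[of lam "T - s"] by (simp add: F_def L_def)
  ultimately obtain \<phi> where \<phi>: "continuous_on {0..} \<phi>" "\<And>t. t \<ge> 0 \<Longrightarrow> \<phi> t = 0 + integral {0..t} (\<lambda>s. F s (\<phi> s))"
    using picard_halfline[of F L 0] int Li by blast
  define \<psi> where "\<psi> t = \<phi> (max 0 (T - t))" for t
  have \<psi>c: "continuous_on {0..} \<psi>" unfolding \<psi>_def by (rule refl_cont[OF \<phi>(1)])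
  define h where "h t = grad lam t (\<psi> t)" for t
  have h: "h absolutely_integrable_on {0..T}" unfolding h_def by (rule grad_integrable[OF \<psi>c T])
  then have hi: "h integrable_on {0..T}" using set_lebesgue_integral_eq_integral(1) by blast
  have tail: "\<psi> t = integral {t..T} h" if t: "t \<in> {0..T}" for t
  proof -
    have "(h has_integral integral {t..T} h) {t..T}"
      using integrable_on_subinterval[OF hi, of t T] t by (auto intro: integrable_integral)
    from has_integral_reflect_shift[OF this, of T]
    have "((\<lambda>s. h (T - s)) has_integral integral {t..T} h) {0..T - t}" by simp
    then have "((\<lambda>s. F s (\<phi> s)) has_integral integral {t..T} h) {0..T - t}"
      by (rule has_integral_eq[rotated]) (use t in \<open>auto simp: h_def \<psi>_def F_def\<close>)
    then show ?thesis using \<phi>(2)[of "T - t"] t by (simp add: \<psi>_def integral_unique)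
  qed
  have split: "\<psi> t = \<psi> 0 - integral {0..t} h" if t: "t \<in> {0..T}" for t
    using Henstock_Kurzweil_Integration.integral_combine[of 0 t T h] tail[of t] tail[of 0] t hi T by (auto simp: algebra_simps)
  \<comment> \<open>The derivative of the extended function; its integral representation gives
    absolute continuity on the whole half-line.\<close>
  define h' where "h' t = (if t \<in> {0..T} then - h t else 0)" for t
  have "(\<lambda>t. - h t) absolutely_integrable_on {0..T}"
    using absolutely_integrable_scaleR_left[OF h, where c = "-1"] by simp
  then have "h' absolutely_integrable_on UNIV"
    unfolding h'_def by (simp only: absolutely_integrable_restrict_UNIV)
  then have h': "h' absolutely_integrable_on {0..t}" for t by (rule absolutely_integrable_on_subinterval) auto
  have h'_int: "integral {0..t} h' = - integral {0..t} h" if "t \<in> {0..T}" for t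
    unfolding Henstock_Kurzweil_Integration.integral_neg[symmetric]
    by (rule Henstock_Kurzweil_Integration.integral_cong) (use that in \<open>auto simp: h'_def\<close>)
  have "\<psi> t = \<psi> 0 + integral {0..t} h'" if t: "t \<ge> 0" for t
  proof (cases "t \<le> T")
    case True
    then show ?thesis using split[of t] h'_int[of t] t by simp
  next
    case False
    have "integral {T..t} h' = integral {T..t} (\<lambda>s. 0 :: 'x)"
      by (rule integral_spike[of "{T}"]) (auto simp: h'_def)
    moreover have "h' integrable_on {0..t}" using h'[of t] set_lebesgue_integral_eq_integral(1) by blast
    ultimately have "integral {0..t} h' = integral {0..T} h'"
      using Henstock_Kurzweil_Integration.integral_combine[of 0 T t h'] False T by simp
    moreover have "\<psi> t = \<psi> T" using False by (simp add: \<psi>_def)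
    ultimately show ?thesis using split[of T] h'_int[of T] T by simp
  qed
  from AC_halfline_integral[OF h' this]
  have ac: "\<psi> \<in> AC_halfline" and d: "AE t in lebesgue. t \<in> {0..} \<longrightarrow> (\<psi> has_vector_derivative h' t) (at t)" by auto
  have "AE t in lebesgue. t \<in> {0..T} \<longrightarrow> (\<psi> has_vector_derivative - grad lam t (\<psi> t)) (at t)"
    using d by eventually_elim (auto simp: h'_def h_def)
  moreover have "\<psi> T = 0" using tail[of T] T by simp
  moreover have "\<forall>t\<in>{0..T}. \<psi> t = \<psi> 0 - integral {0..t} (\<lambda>s. grad lam s (\<psi> s))"
    using split unfolding h_def by blast
  ultimately show ?thesis using ac by (intro exI[of _ \<psi>] conjI)
qed

end

section \<open>The maximum principle on a finite horizon\<close>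

text \<open>Among countably many intervals of length \<open>\<eta> / 2\<close> one meets
  \<open>S\<close> in a set that is not null. A closed subset is then taken because controls must be
  Borel while \<open>S\<close> is only Lebesgue measurable.\<close>

lemma ex_small_borel_subset:
  fixes S :: "real set"
  assumes S: "S \<in> sets lebesgue" "\<not> negligible S" "S \<subseteq> {0..T}" and \<eta>: "\<eta> > 0"
  obtains B where "B \<in> sets borel" "B \<subseteq> S" "0 < measure lebesgue B" "measure lebesgue B < \<eta>"
proof -
  define h where "h = \<eta> / 2"
  have h: "h > 0" "h < \<eta>" using \<eta> by (auto simp: h_def)
  have "S \<subseteq> (\<Union>i::nat. S \<inter> {real i * h..(real i + 1) * h})"
  proof
    fix t assume t: "t \<in> S"
    then have "t \<ge> 0" using S by auto
    define i where "i = nat \<lfloor>t / h\<rfloor>"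
    have "real i \<le> t / h" "t / h \<le> real i + 1" using \<open>t \<ge> 0\<close> h by (auto simp: i_def)
    then have "t \<in> {real i * h..(real i + 1) * h}" using h by (simp add: field_simps)
    then show "t \<in> (\<Union>i::nat. S \<inter> {real i * h..(real i + 1) * h})" using t by blast
  qed
  then have "\<exists>i::nat. \<not> negligible (S \<inter> {real i * h..(real i + 1) * h})"
    using S(2) negligible_subset negligible_countable_Union[of "range (\<lambda>i::nat. S \<inter> {real i * h..(real i + 1) * h})"] by blast
  then obtain i :: nat where i: "\<not> negligible (S \<inter> {real i * h..(real i + 1) * h})" by blast
  define Q where "Q = S \<inter> {real i * h..(real i + 1) * h}"
  have Q: "Q \<in> lmeasurable"
    unfolding Q_def using S(1) by (intro bounded_set_imp_lmeasurable) (auto intro: bounded_subset[of "{real i * h..(real i + 1) * h}"])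
  have Qpos: "measure lebesgue Q > 0"
    using i Q negligible_iff_measure[of Q] by (simp add: Q_def[symmetric] zero_less_measure_iff)
  \<comment> \<open>The closed set misses less than the full measure of \<open>Q\<close>, hence has
    positive measure.\<close>
  obtain C where C: "closed C" "C \<subseteq> Q" "Q - C \<in> lmeasurable" "emeasure lebesgue (Q - C) < ennreal (measure lebesgue Q)"
    using sets_lebesgue_inner_closed[of Q "measure lebesgue Q"] Q Qpos fmeasurableD by metis
  have Cl: "C \<in> lmeasurable" by (rule fmeasurableI2[OF Q C(2)]) (use C(1) in auto)
  have "measure lebesgue (Q - C) < measure lebesgue Q"
    using C(3,4) by (metis emeasure_eq_measure2 ennreal_less_iff measure_nonneg)
  moreover have "measure lebesgue (Q - C) = measure lebesgue Q - measure lebesgue C"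
    by (rule measurable_measure_Diff[OF Q _ C(2)]) (use Cl in auto)
  ultimately have pos: "measure lebesgue C > 0" by simp
  have "measure lebesgue C \<le> measure lebesgue {real i * h..(real i + 1) * h}"
    by (rule measure_mono_fmeasurable) (use C(2) Cl in \<open>auto simp: Q_def\<close>)
  also have "\<dots> = h" using h by (simp add: algebra_simps)
  finally have "measure lebesgue C < \<eta>" using h by simp
  then show ?thesis using that[of C] C pos by (auto simp: Q_def)
qed

context control_system
begin

lemma hamiltonian_lipschitz:
  assumes "dominating R W" "t \<ge> 0" "u \<in> U t" "norm x \<le> R" "norm y \<le> R"
  shows "\<bar>hamiltonian f g x t u 1 p - hamiltonian f g y t u 1 p\<bar> \<le> (norm p + 1) * (W t * norm (x - y))"
proof -
  have "hamiltonian f g x t u 1 p - hamiltonian f g y t u 1 p = p \<bullet> (f t x u - f t y u) + (g t x u - g t y u)"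
    by (simp add: hamiltonian_def inner_diff_right)
  also have "\<bar>\<dots>\<bar> \<le> norm p * norm (f t x u - f t y u) + \<bar>g t x u - g t y u\<bar>"
    by (metis Cauchy_Schwarz_ineq2 abs_triangle_ineq add_right_mono order_trans)
  also have "\<dots> \<le> norm p * (W t * norm (x - y)) + W t * norm (x - y)"
    by (intro add_mono mult_left_mono dominating_lipschitz[OF assms]) auto
  finally show ?thesis by (simp add: algebra_simps)
qed

lemma payoff_integral:
  assumes "continuous_on {0..} x" "u \<in> admissible_controls U" "T \<ge> 0"
  shows "((\<lambda>t. g t (x t) (u t)) has_integral payoff g x u T) {0..T}"
  using set_lebesgue_integral_eq_integral[OF integrand_integrable(2)[OF assms]]
  by (simp add: payoff_def has_integral_integral)

text \<open>Integrating the derivative of $\psi \cdot (x - x_0)$, which vanishes at both ends.\<close>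

lemma payoff_difference:
  assumes T: "T \<ge> 0" and \<psi>: "\<psi> \<in> AC_halfline" "\<psi> T = 0"
    and d\<psi>: "AE t in lebesgue. t \<in> {0..T} \<longrightarrow> (\<psi> has_vector_derivative - grad 1 t (\<psi> t)) (at t)"
    and u: "u \<in> admissible_controls U" and x: "trajectory f xstar u x"
  shows "((\<lambda>t. hamiltonian f g (x t) t (u t) 1 (\<psi> t) - hamiltonian f g (x0 t) t (u0 t) 1 (\<psi> t)
            - grad 1 t (\<psi> t) \<bullet> (x t - x0 t)) has_integral (payoff g x u T - payoff g x0 u0 T)) {0..T}"
proof -
  have xac: "abs_cont_on 0 T x" "abs_cont_on 0 T x0" "abs_cont_on 0 T \<psi>"
    using x traj \<psi>(1) T by (auto simp: trajectory_def AC_halfline_def)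
  have "abs_cont_on 0 T (\<lambda>t. x t - x0 t)"
  proof (rule abs_cont_on_dominated[OF xac(1,2), of 1])
    fix a b
    have "x b - x0 b - (x a - x0 a) = (x b - x a) - (x0 b - x0 a)" by simp
    then show "norm (x b - x0 b - (x a - x0 a)) \<le> 1 * (norm (x b - x a) + norm (x0 b - x0 a))"
      by (metis mult_1 norm_triangle_ineq4)
  qed simp
  then have ac: "abs_cont_on 0 T (\<lambda>t. \<psi> t \<bullet> (x t - x0 t))" by (rule abs_cont_on_inner[OF xac(3)])
  have dx: "AE t in lebesgue. t \<in> {0..} \<longrightarrow> (x has_vector_derivative f t (x t) (u t)) (at t)"
    and dx0: "AE t in lebesgue. t \<in> {0..} \<longrightarrow> (x0 has_vector_derivative f t (x0 t) (u0 t)) (at t)"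
    using x traj by (auto simp: trajectory_def)
  have "AE t in lebesgue. t \<in> {0..T} \<longrightarrow> ((\<lambda>t. \<psi> t \<bullet> (x t - x0 t)) has_vector_derivative
      \<psi> t \<bullet> (f t (x t) (u t) - f t (x0 t) (u0 t)) + (- grad 1 t (\<psi> t)) \<bullet> (x t - x0 t)) (at t)"
    using dx dx0 d\<psi>
  proof eventually_elim
    case (elim t)
    show ?case
    proof
      assume t: "t \<in> {0..T}"
      have "((\<lambda>t. x t - x0 t) has_vector_derivative f t (x t) (u t) - f t (x0 t) (u0 t)) (at t)"
        using elim t by (intro has_vector_derivative_diff) auto
      moreover have "(\<psi> has_vector_derivative - grad 1 t (\<psi> t)) (at t)" using elim t by auto
      ultimately show "((\<lambda>t. \<psi> t \<bullet> (x t - x0 t)) has_vector_derivative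
          \<psi> t \<bullet> (f t (x t) (u t) - f t (x0 t) (u0 t)) + (- grad 1 t (\<psi> t)) \<bullet> (x t - x0 t)) (at t)"
        by (intro bounded_bilinear.has_vector_derivative[OF bounded_bilinear_inner])
    qed
  qed
  from abs_cont_on_integral_AE[OF ac T this]
  have I: "((\<lambda>t. \<psi> t \<bullet> (f t (x t) (u t) - f t (x0 t) (u0 t)) + (- grad 1 t (\<psi> t)) \<bullet> (x t - x0 t)) has_integral 0) {0..T}"
    using \<psi>(2) x traj by (simp add: trajectory_def)
  have xc: "continuous_on {0..} x" by (rule trajectory_integral(1)[OF u x T])
  have "((\<lambda>t. g t (x t) (u t) - g t (x0 t) (u0 t)) has_integral (payoff g x u T - payoff g x0 u0 T)) {0..T}"
    by (intro has_integral_diff payoff_integral xc x0_continuous u u0_admissible T)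
  \<comment> \<open>Adding an integral equal to 0 turns the difference of the running pay-offs into
    a difference of Hamiltonians.\<close>
  from has_integral_add[OF this I] show ?thesis
    unfolding add_0_right by (rule has_integral_eq[rotated]) (simp add: hamiltonian_def inner_diff_right)
qed

section \<open>Needle variations\<close>

lemma needle_control_admissible:
  assumes B: "B \<in> sets borel" "B \<subseteq> {0..}" and v: "v \<in> borel_measurable borel" "bounded (v ` B)" "\<And>t. t \<in> B \<Longrightarrow> v t \<in> U t"
  shows "(\<lambda>t. if t \<in> B then v t else u0 t) \<in> admissible_controls U"
proof -
  have u0: "u0 \<in> borel_measurable (restrict_space borel {0..})" "\<And>T. T \<ge> 0 \<Longrightarrow> bounded (u0 ` {0..T})" "\<And>t. t \<ge> 0 \<Longrightarrow> u0 t \<in> U t"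
    using u0_admissible by (auto simp: admissible_controls_def)
  have "(\<lambda>t. if t \<in> B then v t else u0 t) \<in> borel_measurable (restrict_space borel {0..})"
  proof (rule measurable_If_set[OF measurable_restrict_space1[OF v(1)] u0(1)])
    show "B \<inter> space (restrict_space borel {0..}) \<in> sets (restrict_space borel {0..})"
      using B by (auto simp: sets_restrict_space space_restrict_space intro!: image_eqI[of _ _ B])
  qed
  moreover have "bounded ((\<lambda>t. if t \<in> B then v t else u0 t) ` {0..T})" if "T \<ge> 0" for T
    by (rule bounded_subset[of "v ` B \<union> u0 ` {0..T}"]) (use v(2) u0(2)[OF that] in auto)
  ultimately show ?thesis using u0(3) v(3) by (auto simp: admissible_controls_def)
qed

text \<open>The controls differ only on \<open>B\<close>, where this costs at most
  \<open>2 * j\<close> beyond the Lipschitz term; the bound \<open>j\<close> on \<open>B\<close> is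
  what makes the displacement linear in the measure of \<open>B\<close>. The 4 is this 2 times the 2
  of \<open>gronwall\<close>.\<close>

lemma needle_state_variation:
  assumes T: "T \<ge> 0" and W: "dominating (radius T) W"
    and B: "B \<in> sets borel" "B \<subseteq> {0..T}" and j: "j \<ge> 0" "\<And>t. t \<in> B \<Longrightarrow> W t \<le> j"
    and u: "u \<in> admissible_controls U" "\<And>t. t \<in> {0..T} - B \<Longrightarrow> u t = u0 t" and x: "trajectory f xstar u x"
    and t: "t \<in> {0..T}"
  shows "norm (x t - x0 t) \<le> 4 * j * exp (2 * integral {0..T} W) * measure lebesgue B"
proof -
  have Wl: "W absolutely_integrable_on {0..T}" using W T by (auto simp: dominating_def locally_integrable_def)
  have xc: "continuous_on {0..} x" by (rule trajectory_integral(1)[OF u(1) x T])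
  have bd: "norm (x s) \<le> radius T" "norm (x0 s) \<le> radius T" if "s \<in> {0..T}" for s
    using that trajectory_integral(3)[OF u(1) x, of s] x0_facts(3)[of s] radius_mono[of s T] by auto
  have Bl: "B \<in> lmeasurable"
  proof (rule bounded_set_imp_lmeasurable)
    show "bounded B" by (rule bounded_subset[OF bounded_closed_interval B(2)])
    show "B \<in> sets lebesgue" using B(1) by auto
  qed
  then have ind: "(indicat_real B has_integral measure lebesgue B) UNIV"
    by (simp add: lmeasurable_iff_has_integral)
  then have ind_int: "indicat_real B integrable_on {a..b}" for a b
    by (auto intro: integrable_on_subinterval)
  have ind_le: "integral {0..s} (indicat_real B) \<le> measure lebesgue B" for s
    using integral_subset_le[of "{0..s}" UNIV "indicat_real B"] ind ind_int by (auto simp: integral_unique)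
  have "norm (x t - x0 t) \<le> 2 * (2 * j * measure lebesgue B) * exp (2 * integral {0..T} W)"
  proof (rule gronwall[OF Wl, where y = "\<lambda>s. norm (x s - x0 s)"])
    show "0 \<le> W s" if "s \<in> {0..T}" for s
      using dominatingD(5)[OF W _ bd(2)[OF that] admissibleD[OF u0_admissible, of s]] that by auto
    show yc: "continuous_on {0..T} (\<lambda>s. norm (x s - x0 s))"
      by (intro continuous_intros continuous_on_subset[OF xc] continuous_on_subset[OF x0_continuous]) auto
    fix s assume s: "s \<in> {0..T}"
    have s0: "s \<ge> 0" using s by simp
    have fi: "(\<lambda>r. f r (x r) (u r)) integrable_on {0..s}" "(\<lambda>r. f r (x0 r) (u0 r)) integrable_on {0..s}"
      using integrand_integrable(1)[OF xc u(1) s0] integrand_integrable(1)[OF x0_continuous u0_admissible s0]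
        set_lebesgue_integral_eq_integral(1) by blast+
    have "(\<lambda>r. W r * norm (x r - x0 r)) absolutely_integrable_on {0..s}"
    proof (rule absolutely_integrable_times_continuous)
      show "W absolutely_integrable_on {0..s}" using Wl s by (auto intro: absolutely_integrable_on_subinterval)
      show "continuous_on {0..s} (\<lambda>r. norm (x r - x0 r))" using yc s by (auto intro: continuous_on_subset)
    qed
    then have Wyi: "(\<lambda>r. W r * norm (x r - x0 r)) integrable_on {0..s}"
      by (rule set_lebesgue_integral_eq_integral(1))
    have "x s - x0 s = integral {0..s} (\<lambda>r. f r (x r) (u r) - f r (x0 r) (u0 r))"
      using trajectory_integral(2)[OF u(1) x s0] x0_facts(2)[OF s0] Henstock_Kurzweil_Integration.integral_diff[OF fi] by simp
    also have "norm \<dots> \<le> integral {0..s} (\<lambda>r. W r * norm (x r - x0 r) + 2 * j * indicat_real B r)"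
    proof (rule integral_norm_bound_integral)
      show "(\<lambda>r. f r (x r) (u r) - f r (x0 r) (u0 r)) integrable_on {0..s}" by (rule integrable_diff[OF fi])
      show "(\<lambda>r. W r * norm (x r - x0 r) + 2 * j * indicat_real B r) integrable_on {0..s}"
        by (intro integrable_add Wyi integrable_on_mult_right ind_int)
      fix r assume "r \<in> {0..s}"
      then have r: "r \<in> {0..T}" "r \<ge> 0" using s by auto
      note Ur = admissibleD[OF u(1) r(2)] admissibleD[OF u0_admissible r(2)]
      have lip: "norm (f r (x r) (u r) - f r (x0 r) (u r)) \<le> W r * norm (x r - x0 r)"
        by (rule dominating_lipschitz(1)[OF W r(2) Ur(1) bd[OF r(1)]])
      show "norm (f r (x r) (u r) - f r (x0 r) (u0 r)) \<le> W r * norm (x r - x0 r) + 2 * j * indicat_real B r"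
      proof (cases "r \<in> B")
        case True
        have "norm (f r (x r) (u r) - f r (x0 r) (u0 r)) \<le>
            norm (f r (x r) (u r) - f r (x0 r) (u r)) + (norm (f r (x0 r) (u r)) + norm (f r (x0 r) (u0 r)))"
          using norm_triangle_ineq[of "f r (x r) (u r) - f r (x0 r) (u r)" "f r (x0 r) (u r) - f r (x0 r) (u0 r)"]
            norm_triangle_ineq4[of "f r (x0 r) (u r)" "f r (x0 r) (u0 r)"] by simp
        also have "\<dots> \<le> W r * norm (x r - x0 r) + (W r + W r)"
          by (intro add_mono lip dominatingD(1)[OF W r(2) bd(2)[OF r(1)]] Ur)
        finally show ?thesis using j(2)[OF True] True by simp
      next
        case False
        then show ?thesis using lip u(2)[of r] r by simp
      qed
    qed
    also have "\<dots> = integral {0..s} (\<lambda>r. W r * norm (x r - x0 r)) + 2 * j * integral {0..s} (indicat_real B)"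
      using Henstock_Kurzweil_Integration.integral_add[OF Wyi integrable_on_mult_right[OF ind_int, of "2 * j"]] by simp
    also have "\<dots> \<le> integral {0..s} (\<lambda>r. W r * norm (x r - x0 r)) + 2 * j * measure lebesgue B"
      using j(1) by (intro add_left_mono mult_left_mono ind_le) auto
    finally show "norm (x s - x0 s) \<le> 2 * j * measure lebesgue B + integral {0..s} (\<lambda>r. W r * norm (x r - x0 r))" by simp
  qed (use j t in auto)
  then show ?thesis by (simp add: algebra_simps)
qed

text \<open>The first-order Taylor remainder of the Hamiltonian in the state, under the reference
  control.\<close>

definition remainder :: "(real \<Rightarrow> 'x) \<Rightarrow> (real \<Rightarrow> 'x) \<Rightarrow> real \<Rightarrow> real" where
  "remainder \<psi> x t = hamiltonian f g (x t) t (u0 t) 1 (\<psi> t) - hamiltonian f g (x0 t) t (u0 t) 1 (\<psi> t)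
     - grad 1 t (\<psi> t) \<bullet> (x t - x0 t)"

lemma hamiltonian_measurable:
  assumes "continuous_on {0..} x" "continuous_on {0..} \<psi>" "u \<in> admissible_controls U"
  shows "(\<lambda>t. hamiltonian f g (x t) t (u t) 1 (\<psi> t)) \<in> borel_measurable (lebesgue_on {0..})"
proof -
  have "(\<lambda>t. f t (x t) (u t)) \<in> borel_measurable (lebesgue_on {0..})" "(\<lambda>t. g t (x t) (u t)) \<in> borel_measurable (lebesgue_on {0..})"
    using f_regular g_regular caratheodory_superposition[of f, OF _ assms(1,3)] caratheodory_superposition[of g, OF _ assms(1,3)]
    by (auto simp: regular_map_def)
  moreover have "\<psi> \<in> borel_measurable (lebesgue_on {0..})"
    by (intro continuous_imp_measurable_on_sets_lebesgue assms) auto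
  ultimately show ?thesis unfolding hamiltonian_def by (intro borel_measurable_add borel_measurable_inner) simp_all
qed

lemma remainder_integrable:
  assumes x: "continuous_on {0..} x" and \<psi>: "continuous_on {0..} \<psi>" and T: "T \<ge> 0"
  shows "remainder \<psi> x absolutely_integrable_on {0..T}"
proof -
  have inner: "(\<lambda>t. h t \<bullet> k t) absolutely_integrable_on {0..T}"
    if k: "k absolutely_integrable_on {0..T}" and h: "continuous_on {0..} h" for h k :: "real \<Rightarrow> 'x"
  proof (rule absolutely_integrable_bounded_measurable_product[OF bilinear_conv_bounded_bilinear[THEN iffD2, OF bounded_bilinear_inner] _ _ _ k])
    have c: "continuous_on {0..T} h" using h by (rule continuous_on_subset) auto
    show "h \<in> borel_measurable (lebesgue_on {0..T})" by (rule continuous_imp_measurable_on_sets_lebesgue[OF c]) auto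
    show "bounded (h ` {0..T})" by (intro compact_imp_bounded compact_continuous_image c) auto
  qed auto
  have H: "(\<lambda>t. hamiltonian f g (y t) t (u0 t) 1 (\<psi> t)) absolutely_integrable_on {0..T}" if y: "continuous_on {0..} y" for y
    unfolding hamiltonian_def
    using inner[OF integrand_integrable(1)[OF y u0_admissible T] \<psi>] integrand_integrable(2)[OF y u0_admissible T] by simp
  have "(\<lambda>t. (x t - x0 t) \<bullet> grad 1 t (\<psi> t)) absolutely_integrable_on {0..T}"
    by (rule inner[OF grad_integrable[OF \<psi> T]]) (intro continuous_intros x x0_continuous)
  then show ?thesis
    unfolding remainder_def using H[OF x] H[OF x0_continuous] by (simp add: inner_commute)
qed

text \<open>Gives the dominating function for the limit in \<open>no_hamiltonian_gain\<close>. The 3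
  counts the Lipschitz constant of the Hamiltonian once and \<open>W\<close> twice for the gradient,
  since \<open>coeff_norm\<close> is a sum of two norms.\<close>

lemma remainder_bound:
  assumes W: "dominating R W" and t: "t \<ge> 0" and x: "norm (x t) \<le> R" "norm (x0 t) \<le> R"
  shows "\<bar>remainder \<psi> x t\<bar> \<le> 3 * (norm (\<psi> t) + 1) * (W t * norm (x t - x0 t))"
proof -
  have U: "u0 t \<in> U t" by (rule admissibleD[OF u0_admissible t])
  have "\<bar>grad 1 t (\<psi> t) \<bullet> (x t - x0 t)\<bar> \<le> norm (grad 1 t (\<psi> t)) * norm (x t - x0 t)"
    by (rule Cauchy_Schwarz_ineq2)
  also have "\<dots> \<le> (coeff_norm t * (norm (\<psi> t) + 1)) * norm (x t - x0 t)"
    using norm_grad[of 1 t "\<psi> t"] by (intro mult_right_mono) auto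
  also have "\<dots> \<le> ((2 * W t) * (norm (\<psi> t) + 1)) * norm (x t - x0 t)"
    using dominatingD(3,4)[OF W t x(2) U] unfolding coeff_norm_def by (intro mult_right_mono) auto
  finally have "\<bar>grad 1 t (\<psi> t) \<bullet> (x t - x0 t)\<bar> \<le> 2 * ((norm (\<psi> t) + 1) * (W t * norm (x t - x0 t)))"
    by (simp only: mult_ac)
  then show ?thesis
    using hamiltonian_lipschitz[OF W t U x, of "\<psi> t"] unfolding remainder_def by linarith
qed

text \<open>Differentiability at \<open>x0 t\<close> is used for each \<open>t\<close> separately,
  so the neighbourhood may depend on \<open>t\<close>; a displacement of order
  \<open>\<mu> n\<close> makes the remainder of smaller order than \<open>\<mu> n\<close>.\<close>

lemma remainder_small:
  assumes t: "t \<ge> 0" and \<mu>: "\<And>n. \<mu> n > 0" "\<mu> \<longlonglongrightarrow> (0::real)" and C: "C \<ge> 0"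
    and x: "\<And>n. norm (x n t - x0 t) \<le> C * \<mu> n"
  shows "(\<lambda>n. \<bar>remainder \<psi> (x n) t\<bar> / \<mu> n) \<longlonglongrightarrow> 0"
  unfolding tendsto_iff
proof (intro allI impI)
  fix e :: real assume e: "e > 0"
  define e' where "e' = e / (2 * (C + 1))"
  have e': "e' > 0" "e' * C < e"
  proof -
    show "e' > 0" using e C by (simp add: e'_def)
    have "e' * (C + 1) = e / 2" using C by (simp add: e'_def divide_simps)
    then show "e' * C < e" using e \<open>e' > 0\<close> by (simp add: algebra_simps)
  qed
  obtain d where d: "d > 0" "\<And>y. norm (y - x0 t) < d \<Longrightarrow> norm (hamiltonian f g y t (u0 t) 1 (\<psi> t)
      - hamiltonian f g (x0 t) t (u0 t) 1 (\<psi> t) - grad 1 t (\<psi> t) \<bullet> (y - x0 t)) \<le> e' * norm (y - x0 t)"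
    using has_derivative_hamiltonian[OF t, of 1 "\<psi> t"] e'(1) unfolding has_derivative_at_alt by meson
  have "(\<lambda>n. C * \<mu> n) \<longlonglongrightarrow> C * 0" by (intro tendsto_intros \<mu>(2))
  then have "\<forall>\<^sub>F n in sequentially. C * \<mu> n < d" using d(1) by (auto dest: order_tendstoD(2))
  then show "\<forall>\<^sub>F n in sequentially. dist (\<bar>remainder \<psi> (x n) t\<bar> / \<mu> n) 0 < e"
  proof eventually_elim
    case (elim n)
    then have "norm (x n t - x0 t) < d" using x[of n] by linarith
    then have "\<bar>remainder \<psi> (x n) t\<bar> \<le> e' * norm (x n t - x0 t)" using d(2) by (simp add: remainder_def)
    also have "\<dots> \<le> e' * (C * \<mu> n)" using x[of n] e' by (intro mult_left_mono) auto
    also have "\<dots> < e * \<mu> n" using e'(2) \<mu>(1)[of n] by (simp add: mult.assoc[symmetric])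
    finally show ?case using \<mu>(1)[of n] by (simp add: divide_less_eq)
  qed
qed

text \<open>If the Hamiltonian could be increased on a set of positive measure, then needles supported on
  ever smaller subsets of it would increase the pay-off: the gain is of the order of the measure of
  the support, the error from the displacement of the state is of smaller order.\<close>

lemma no_hamiltonian_gain:
  assumes T: "T \<ge> 0" and \<psi>: "\<psi> \<in> AC_halfline" "\<psi> T = 0"
    and d\<psi>: "AE t in lebesgue. t \<in> {0..T} \<longrightarrow> (\<psi> has_vector_derivative - grad 1 t (\<psi> t)) (at t)"
    and opt: "\<And>u x. u \<in> admissible_controls U \<Longrightarrow> trajectory f xstar u x \<Longrightarrow> payoff g x u T \<le> payoff g x0 u0 T"
    and S: "S \<in> sets borel" "S \<subseteq> {0..T}" "\<not> negligible S"
    and v: "v \<in> borel_measurable borel" "bounded (v ` S)" "\<And>t. t \<in> S \<Longrightarrow> v t \<in> U t"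
    and gain: "\<And>t. t \<in> S \<Longrightarrow> hamiltonian f g (x0 t) t (v t) 1 (\<psi> t) - hamiltonian f g (x0 t) t (u0 t) 1 (\<psi> t) > 0"
  shows False
proof -
  define k where "k t = hamiltonian f g (x0 t) t (v t) 1 (\<psi> t) - hamiltonian f g (x0 t) t (u0 t) 1 (\<psi> t)" for t
  have \<psi>c: "continuous_on {0..} \<psi>" by (rule AC_halfline_continuous_on[OF \<psi>(1)])
  obtain W where W: "dominating (radius T) W" using ex_dominating[of "radius T"] radius_pos[of T] by auto
  have Wl: "W absolutely_integrable_on {0..T}" using W T by (auto simp: dominating_def locally_integrable_def)
  then have Wi: "W integrable_on {0..T}" using set_lebesgue_integral_eq_integral(1) by blast
  have x0b: "norm (x0 t) \<le> radius T" if "t \<in> {0..T}" for t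
    using that x0_facts(3)[of t] radius_mono[of t T] by auto
  have Wnn: "W t \<ge> 0" if "t \<in> {0..T}" for t
    using dominatingD(5)[OF W _ x0b[OF that] admissibleD[OF u0_admissible, of t]] that by auto
  have "bounded (\<psi> ` {0..T})"
    by (intro compact_imp_bounded compact_continuous_image continuous_on_subset[OF \<psi>c]) auto
  then obtain P where P: "P > 0" "\<And>t. t \<in> {0..T} \<Longrightarrow> norm (\<psi> t) \<le> P" unfolding bounded_pos by (auto simp del: atLeastAtMost_iff)
  define Sj where "Sj j = {t\<in>S. k t \<ge> 1 / Suc j \<and> W t \<le> real j}" for j
  have w: "(\<lambda>t. if t \<in> S then v t else u0 t) \<in> admissible_controls U"
    by (rule needle_control_admissible[OF S(1) _ v]) (use S(2) in auto)
  have Sj_meas: "Sj j \<in> sets lebesgue" for j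
  proof -
    \<comment> \<open>Agrees with \<open>k\<close> on \<open>S\<close> but uses an admissible
      control, so that \<open>hamiltonian_measurable\<close> applies.\<close>
    define k' where "k' t = hamiltonian f g (x0 t) t (if t \<in> S then v t else u0 t) 1 (\<psi> t) - hamiltonian f g (x0 t) t (u0 t) 1 (\<psi> t)" for t
    have k': "k' \<in> borel_measurable (lebesgue_on {0..T})"
      unfolding k'_def
      by (rule measurable_restrict_mono[of _ _ "{0..}"])
        (intro borel_measurable_diff hamiltonian_measurable x0_continuous \<psi>c w u0_admissible, auto)
    have W': "W \<in> borel_measurable (lebesgue_on {0..T})" using Wl absolutely_integrable_measurable[of "{0..T}" W] by auto
    have "{t \<in> space (lebesgue_on {0..T}). k' t \<ge> 1 / Suc j} \<inter> {t \<in> space (lebesgue_on {0..T}). W t \<le> real j} \<in> sets (lebesgue_on {0..T})"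
      by (intro sets.Int borel_measurable_le borel_measurable_const k' W')
    then have "({t\<in>{0..T}. k' t \<ge> 1 / Suc j} \<inter> {t\<in>{0..T}. W t \<le> real j}) \<in> sets lebesgue"
      by (simp add: sets_restrict_space_iff)
    moreover have "Sj j = S \<inter> ({t\<in>{0..T}. k' t \<ge> 1 / Suc j} \<inter> {t\<in>{0..T}. W t \<le> real j})"
      using S(2) by (auto simp: Sj_def k_def k'_def)
    moreover have "S \<in> sets lebesgue" using S(1) by auto
    ultimately show ?thesis by auto
  qed
  have "S \<subseteq> (\<Union>j. Sj j)"
  proof
    fix t assume t: "t \<in> S"
    then have "k t > 0" using gain by (simp add: k_def)
    then obtain j1 where j1: "1 / Suc j1 < k t" using nat_approx_posE by blast
    obtain j2 :: nat where j2: "W t \<le> j2" using real_arch_simple by blast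
    have "1 / Suc (max j1 j2) \<le> 1 / Suc j1" by (intro divide_left_mono) auto
    then have "t \<in> Sj (max j1 j2)" using t j1 j2 by (simp add: Sj_def)
    then show "t \<in> (\<Union>j. Sj j)" by blast
  qed
  then have "\<exists>j. \<not> negligible (Sj j)"
    using S(3) negligible_subset negligible_countable_Union[of "range Sj"] by blast
  then obtain j where j: "\<not> negligible (Sj j)" by blast
  have SjS: "Sj j \<subseteq> S" by (auto simp: Sj_def)
  define \<delta> where "\<delta> = 1 / Suc j"
  have \<delta>: "\<delta> > 0" by (simp add: \<delta>_def)
  have "\<exists>B. B \<in> sets borel \<and> B \<subseteq> Sj j \<and> 0 < measure lebesgue B \<and> measure lebesgue B < 1 / Suc n" for n
    using ex_small_borel_subset[OF Sj_meas j, of T "1 / Suc n"] S(2) SjS by (metis divide_pos_pos of_nat_0_less_iff order_trans zero_less_Suc zero_less_one)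
  then obtain B where B: "\<And>n. B n \<in> sets borel" "\<And>n. B n \<subseteq> Sj j" "\<And>n. 0 < measure lebesgue (B n)" "\<And>n. measure lebesgue (B n) < 1 / Suc n"
    by metis
  define \<mu> where "\<mu> n = measure lebesgue (B n)" for n
  have \<mu>: "\<mu> n > 0" "\<mu> \<longlonglongrightarrow> 0" for n
  proof -
    show "\<mu> n > 0" using B(3) by (simp add: \<mu>_def)
    show "\<mu> \<longlonglongrightarrow> 0" by (rule LIMSEQ_norm_0) (use B(4) in \<open>simp add: \<mu>_def\<close>)
  qed
  have BS: "B n \<subseteq> S" "B n \<subseteq> {0..T}" "B n \<subseteq> {0..}" for n
  proof -
    show "B n \<subseteq> S" using B(2)[of n] SjS by blast
    then show "B n \<subseteq> {0..T}" using S(2) by blast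
    then show "B n \<subseteq> {0..}" by auto
  qed
  have Bk: "k t \<ge> \<delta>" "W t \<le> real j" if "t \<in> B n" for n t using that B(2)[of n] by (auto simp: Sj_def \<delta>_def)
  define u where "u n t = (if t \<in> B n then v t else u0 t)" for n t
  have u: "u n \<in> admissible_controls U" for n
    unfolding u_def by (rule needle_control_admissible[OF B(1) BS(3) v(1)]) (use v(2,3) BS(1)[of n] in \<open>auto intro: bounded_subset\<close>)
  have "\<forall>n. \<exists>x. trajectory f xstar (u n) x" using ex_trajectory[OF u] by blast
  then obtain x where x: "\<And>n. trajectory f xstar (u n) (x n)" by metis
  have xc: "continuous_on {0..} (x n)" for n by (rule trajectory_integral(1)[OF u x T])
  have xb: "norm (x n t) \<le> radius T" if "t \<in> {0..T}" for n t
    using that trajectory_integral(3)[OF u x, of t n] radius_mono[of t T] by auto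
  define C where "C = 4 * real j * exp (2 * integral {0..T} W)"
  have C: "C \<ge> 0" by (simp add: C_def)
  have dx: "norm (x n t - x0 t) \<le> C * \<mu> n" if t: "t \<in> {0..T}" for n t
    unfolding C_def \<mu>_def
    by (rule needle_state_variation[OF T W B(1) BS(2) _ _ u _ x t]) (use Bk(2) in \<open>auto simp: u_def\<close>)
  \<comment> \<open>The remainder per unit of measure of the needle: it tends to 0 pointwise and is
    dominated by a multiple of \<open>W\<close>.\<close>
  define \<rho> where "\<rho> n t = \<bar>remainder \<psi> (x n) t\<bar> / \<mu> n" for n t
  have \<rho>i: "\<rho> n integrable_on {0..T}" for n
  proof -
    have "(\<lambda>t. norm (remainder \<psi> (x n) t)) integrable_on {0..T}"
      using remainder_integrable[OF xc \<psi>c T, of n] by (simp add: absolutely_integrable_on_def)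
    then show ?thesis unfolding \<rho>_def[abs_def] real_norm_def by (rule integrable_on_divide)
  qed
  have \<rho>lim: "(\<lambda>n. integral {0..T} (\<rho> n)) \<longlonglongrightarrow> integral {0..T} (\<lambda>t. 0)"
  proof (rule dominated_convergence(2)[OF \<rho>i])
    show "(\<lambda>t. 3 * (P + 1) * C * W t) integrable_on {0..T}" by (intro integrable_on_mult_right Wi)
    fix n t assume t: "t \<in> {0..T}"
    have "\<bar>remainder \<psi> (x n) t\<bar> \<le> 3 * (norm (\<psi> t) + 1) * (W t * norm (x n t - x0 t))"
      by (rule remainder_bound[where x = "x n" and t = t, OF W _ xb[OF t] x0b[OF t]]) (use t in auto)
    also have "\<dots> \<le> 3 * (P + 1) * (W t * (C * \<mu> n))"
      using P(2)[OF t] Wnn[OF t] dx[OF t, of n] P(1) by (intro mult_mono mult_nonneg_nonneg) auto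
    finally show "norm (\<rho> n t) \<le> 3 * (P + 1) * C * W t"
      using \<mu>(1)[of n] by (simp add: \<rho>_def divide_le_eq mult_ac)
  next
    fix t assume t: "t \<in> {0..T}"
    show "(\<lambda>n. \<rho> n t) \<longlonglongrightarrow> 0"
      unfolding \<rho>_def by (rule remainder_small[where x = x and t = t and \<mu> = \<mu>, OF _ \<mu> C dx[OF t]]) (use t in auto)
  qed
  \<comment> \<open>On \<open>B n\<close> the displacement of the state changes the Hamiltonian by
    at most \<open>c * \<mu> n / 2\<close> for each of the two controls \<open>v t\<close> and
    \<open>u0 t\<close>.\<close>
  define c where "c = 2 * (P + 1) * real j * C"
  have key: "\<delta> \<le> c * \<mu> n + integral {0..T} (\<rho> n)" for n
  proof -
    let ?E = "\<lambda>t. hamiltonian f g (x n t) t (u n t) 1 (\<psi> t) - hamiltonian f g (x0 t) t (u0 t) 1 (\<psi> t)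
            - grad 1 t (\<psi> t) \<bullet> (x n t - x0 t)"
    have Bl: "B n \<in> lmeasurable"
    proof (rule bounded_set_imp_lmeasurable)
      show "bounded (B n)" by (rule bounded_subset[OF bounded_closed_interval BS(2)])
      show "B n \<in> sets lebesgue" using B(1) by auto
    qed
    then have "(indicat_real (B n) has_integral \<mu> n) UNIV"
      by (simp add: lmeasurable_iff_has_integral \<mu>_def)
    then have "((\<lambda>t. if t \<in> {0..T} then indicat_real (B n) t else 0) has_integral \<mu> n) UNIV"
      by (rule has_integral_eq[rotated]) (use BS(2)[of n] in \<open>auto simp: indicator_def\<close>)
    then have ind: "(indicat_real (B n) has_integral \<mu> n) {0..T}" by (simp only: has_integral_restrict_UNIV)
    \<comment> \<open>Integral of a lower bound for the integrand in
      \<open>payoff_difference\<close>: the remainder is charged everywhere, the gain less its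
      correction is credited on \<open>B n\<close>.\<close>
    have I: "((\<lambda>t. (\<delta> - c * \<mu> n) * indicat_real (B n) t - \<mu> n * \<rho> n t) has_integral
        (\<delta> - c * \<mu> n) * \<mu> n - \<mu> n * integral {0..T} (\<rho> n)) {0..T}"
      by (intro has_integral_diff has_integral_mult_right ind integrable_integral \<rho>i)
    have "(\<delta> - c * \<mu> n) * \<mu> n - \<mu> n * integral {0..T} (\<rho> n) \<le> payoff g (x n) (u n) T - payoff g x0 u0 T"
    proof (rule has_integral_le[OF I payoff_difference[OF T \<psi> d\<psi> u x]])
      fix t assume t: "t \<in> {0..T}"
      have \<mu>\<rho>: "\<mu> n * \<rho> n t = \<bar>remainder \<psi> (x n) t\<bar>" using \<mu>(1)[of n] by (simp add: \<rho>_def)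
      show "(\<delta> - c * \<mu> n) * indicat_real (B n) t - \<mu> n * \<rho> n t \<le> ?E t"
      proof (cases "t \<in> B n")
        case False
        then have "?E t = remainder \<psi> (x n) t" by (simp add: u_def remainder_def)
        then show ?thesis using False unfolding \<mu>\<rho> by simp
      next
        case True
        have lip: "\<bar>hamiltonian f g (x n t) t q 1 (\<psi> t) - hamiltonian f g (x0 t) t q 1 (\<psi> t)\<bar> \<le> c * \<mu> n / 2" if "q \<in> U t" for q
        proof -
          have "\<bar>hamiltonian f g (x n t) t q 1 (\<psi> t) - hamiltonian f g (x0 t) t q 1 (\<psi> t)\<bar> \<le> (norm (\<psi> t) + 1) * (W t * norm (x n t - x0 t))"
            by (rule hamiltonian_lipschitz[OF W _ that xb[OF t] x0b[OF t]]) (use t in auto)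
          also have "\<dots> \<le> (P + 1) * (real j * (C * \<mu> n))"
            using P(2)[OF t] Wnn[OF t] dx[OF t, of n] P(1) Bk(2)[OF True] by (intro mult_mono mult_nonneg_nonneg) auto
          finally show ?thesis by (simp add: c_def algebra_simps)
        qed
        have "v t \<in> U t" "u0 t \<in> U t" using v(3) BS(1)[of n] True admissibleD[OF u0_admissible, of t] t by auto
        note l = lip[OF this(1)] lip[OF this(2)]
        define p where "p = hamiltonian f g (x n t) t (v t) 1 (\<psi> t) - hamiltonian f g (x0 t) t (v t) 1 (\<psi> t)"
        define q where "q = hamiltonian f g (x n t) t (u0 t) 1 (\<psi> t) - hamiltonian f g (x0 t) t (u0 t) 1 (\<psi> t)"
        have "\<bar>p\<bar> \<le> c * \<mu> n / 2" "\<bar>q\<bar> \<le> c * \<mu> n / 2" using l by (auto simp: p_def q_def)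
        then have pq: "- (c * \<mu> n / 2) \<le> p" "q \<le> c * \<mu> n / 2" by (auto simp: abs_le_iff)
        \<comment> \<open>The gain \<open>k t\<close> is taken at the reference state;
          \<open>p\<close> and \<open>q\<close> account for the displaced state under either
          control.\<close>
        have "?E t = remainder \<psi> (x n) t + k t + p - q"
          using True by (simp add: u_def remainder_def k_def p_def q_def)
        moreover have "- \<bar>remainder \<psi> (x n) t\<bar> \<le> remainder \<psi> (x n) t" by (rule abs_ge_minus_self[THEN minus_le_iff[THEN iffD1]])
        moreover have "(\<delta> - c * \<mu> n) * indicat_real (B n) t = \<delta> - c * \<mu> n" using True by simp
        ultimately show ?thesis using pq Bk(1)[OF True] unfolding \<mu>\<rho> by linarith
      qed
    qed
    also have "\<dots> \<le> 0" using opt[OF u x, of n] by simp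
    finally have "\<mu> n * \<delta> \<le> \<mu> n * (c * \<mu> n + integral {0..T} (\<rho> n))" by (simp add: algebra_simps)
    then show ?thesis using \<mu>(1)[of n] by simp
  qed
  have "(\<lambda>n. c * \<mu> n + integral {0..T} (\<rho> n)) \<longlonglongrightarrow> c * 0 + integral {0..T} (\<lambda>t. 0)"
    by (intro tendsto_intros \<mu>(2) \<rho>lim)
  from LIMSEQ_le_const[OF this] key have "\<delta> \<le> 0" by auto
  then show False using \<delta> by simp
qed

lemma maximum_principle_free_end:
  assumes T: "T \<ge> 0" and \<psi>: "\<psi> \<in> AC_halfline" "\<psi> T = 0"
    and d\<psi>: "AE t in lebesgue. t \<in> {0..T} \<longrightarrow> (\<psi> has_vector_derivative - grad 1 t (\<psi> t)) (at t)"
    and opt: "\<And>u x. u \<in> admissible_controls U \<Longrightarrow> trajectory f xstar u x \<Longrightarrow> payoff g x u T \<le> payoff g x0 u0 T"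
  shows "AE t in lebesgue. t \<in> {0..T} \<longrightarrow>
    (\<forall>p\<in>U t. hamiltonian f g (x0 t) t p 1 (\<psi> t) \<le> hamiltonian f g (x0 t) t (u0 t) 1 (\<psi> t))"
proof -
  define k where "k t p = hamiltonian f g (x0 t) t p 1 (\<psi> t) - hamiltonian f g (x0 t) t (u0 t) 1 (\<psi> t)" for t p
  have \<psi>c: "continuous_on {0..} \<psi>" by (rule AC_halfline_continuous_on[OF \<psi>(1)])
  have "negligible {t\<in>{0..T}. \<exists>p\<in>U t. k t p > 0}"
  proof (rule ccontr)
    assume bad: "\<not> ?thesis"
    have km: "(\<lambda>t. k t p) \<in> borel_measurable (lebesgue_on {0..})" for p
    proof -
      \<comment> \<open>The constant \<open>p\<close> need not lie in every \<open>U t\<close>.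
        Admissibility only carries measurability here, so it is taken with respect to the constant
        map \<open>{p}\<close>.\<close>
      have "(\<lambda>t::real. p) \<in> admissible_controls (\<lambda>t. {p})"
        by (auto simp: admissible_controls_def image_constant_conv)
      then have "(\<lambda>t. f t (x0 t) p) \<in> borel_measurable (lebesgue_on {0..})" "(\<lambda>t. g t (x0 t) p) \<in> borel_measurable (lebesgue_on {0..})"
        using f_regular g_regular caratheodory_superposition[of f, OF _ x0_continuous, of "\<lambda>t. p" "\<lambda>t. {p}"]
          caratheodory_superposition[of g, OF _ x0_continuous, of "\<lambda>t. p" "\<lambda>t. {p}"]
        by (auto simp: regular_map_def)
      moreover have "\<psi> \<in> borel_measurable (lebesgue_on {0..})"
        by (intro continuous_imp_measurable_on_sets_lebesgue \<psi>c) auto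
      ultimately have H: "(\<lambda>t. hamiltonian f g (x0 t) t p 1 (\<psi> t)) \<in> borel_measurable (lebesgue_on {0..})"
        unfolding hamiltonian_def by (intro borel_measurable_add borel_measurable_inner) simp_all
      show ?thesis unfolding k_def
        by (rule borel_measurable_diff[OF H hamiltonian_measurable[OF x0_continuous \<psi>c u0_admissible]])
    qed
    have kc: "continuous_on UNIV (k t)" if t: "t \<ge> 0" for t
    proof -
      have "continuous_on UNIV (\<lambda>z. f t (fst z) (snd z))" "continuous_on UNIV (\<lambda>z. g t (fst z) (snd z))"
        using f_regular g_regular t by (auto simp: regular_map_def caratheodory_def split_beta)
      moreover have "continuous_on UNIV (\<lambda>p::'u. (x0 t, p))" by (intro continuous_intros)
      ultimately have "continuous_on UNIV (\<lambda>p. f t (x0 t) p)" "continuous_on UNIV (\<lambda>p. g t (x0 t) p)"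
        using continuous_on_compose2[of UNIV "\<lambda>z. f t (fst z) (snd z)" UNIV "\<lambda>p. (x0 t, p)"]
          continuous_on_compose2[of UNIV "\<lambda>z. g t (fst z) (snd z)" UNIV "\<lambda>p. (x0 t, p)"]
        by simp_all
      then show ?thesis unfolding k_def hamiltonian_def by (intro continuous_intros) simp_all
    qed
    obtain S v where S: "compact S" "S \<subseteq> {0..T}" "\<not> negligible S" "v \<in> borel_measurable borel" "bounded (v ` S)"
        "\<forall>t\<in>S. v t \<in> U t \<and> k t (v t) > 0"
      by (rule positive_selection[OF U_graph km kc bad])
    show False
      by (rule no_hamiltonian_gain[OF T \<psi> d\<psi> opt borel_compact[OF S(1)] S(2-5)]) (use S(6) in \<open>auto simp: k_def\<close>)
  qed
  then show ?thesis
    by (intro AE_I'[of "{t\<in>{0..T}. \<exists>p\<in>U t. k t p > 0}"]) (auto simp: negligible_iff_null_sets k_def not_le)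
qed

end

section \<open>Passage to the limit\<close>

context control_system
begin

text \<open>The maximum condition is handled as a pointwise inequality, the form that passes to
  limits. Since \<open>u0 t\<close> belongs to \<open>U t\<close>, the supremum of reals is a
  genuine maximum.\<close>

lemma maximum_condition_onI:
  assumes "AE t in lebesgue. t \<in> I \<longrightarrow>
      (\<forall>p\<in>U t. hamiltonian f g (x0 t) t p lam (\<psi> t) \<le> hamiltonian f g (x0 t) t (u0 t) lam (\<psi> t))"
    and "I \<subseteq> {0..}"
  shows "maximum_condition_on I U f g x0 u0 lam \<psi>"
  unfolding maximum_condition_on_def using assms(1)
proof eventually_elim
  case (elim t)
  show ?case
  proof
    assume t: "t \<in> I"
    then have "u0 t \<in> U t" using assms(2) admissibleD[OF u0_admissible, of t] by auto
    then show "(SUP p\<in>U t. hamiltonian f g (x0 t) t p lam (\<psi> t)) = hamiltonian f g (x0 t) t (u0 t) lam (\<psi> t)"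
      by (intro cSup_eq_maximum) (use elim t in auto)
  qed
qed

text \<open>Gronwall for the difference of the integral equations, where the multipliers contribute
  their distance times the integral of \<open>coeff_norm\<close>. As the horizons tend to infinity,
  a fixed interval is eventually covered by the equation for \<open>\<psi>s n\<close>.\<close>

lemma adjoint_convergence:
  assumes \<psi>s: "\<And>n. \<psi>s n \<in> AC_halfline"
    and eqs: "\<And>n t. t \<in> {0..\<tau>' n} \<Longrightarrow> \<psi>s n t = \<psi>s n 0 - integral {0..t} (\<lambda>s. grad (lams n) s (\<psi>s n s))"
    and \<psi>0: "\<psi>0 \<in> AC_halfline" "\<And>t. t \<ge> 0 \<Longrightarrow> \<psi>0 t = p - integral {0..t} (\<lambda>s. grad lam0 s (\<psi>0 s))"
    and lim: "lams \<longlonglongrightarrow> lam0" "(\<lambda>n. \<psi>s n 0) \<longlonglongrightarrow> p" "filterlim \<tau>' at_top sequentially"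
    and T: "T \<ge> 0"
  shows "uniform_limit {0..T} \<psi>s \<psi>0 sequentially"
proof (rule uniform_limitI)
  fix e :: real assume e: "e > 0"
  define \<kappa> where "\<kappa> = integral {0..T} coeff_norm"
  have Kl: "coeff_norm absolutely_integrable_on {0..T}" by (rule locally_integrableD[OF coeff_norm_integrable T])
  then have Ki: "coeff_norm integrable_on {0..T}" using set_lebesgue_integral_eq_integral(1) by blast
  define a where "a n = norm (\<psi>s n 0 - p) + \<bar>lams n - lam0\<bar> * \<kappa>" for n
  have "(\<lambda>n. 2 * a n * exp (2 * \<kappa>)) \<longlonglongrightarrow> 2 * (norm (p - p) + \<bar>lam0 - lam0\<bar> * \<kappa>) * exp (2 * \<kappa>)"
    unfolding a_def by (intro tendsto_intros lim)
  then have "\<forall>\<^sub>F n in sequentially. 2 * a n * exp (2 * \<kappa>) < e" by (rule order_tendstoD(2)) (use e in simp)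
  moreover have "\<forall>\<^sub>F n in sequentially. \<tau>' n \<ge> T" using lim(3) by (simp add: filterlim_at_top)
  ultimately show "\<forall>\<^sub>F n in sequentially. \<forall>t\<in>{0..T}. dist (\<psi>s n t) (\<psi>0 t) < e"
  proof eventually_elim
    case (elim n)
    have c: "continuous_on {0..} (\<psi>s n)" "continuous_on {0..} \<psi>0" by (intro AC_halfline_continuous_on \<psi>s \<psi>0)+
    show ?case
    proof
      fix t assume t: "t \<in> {0..T}"
      have "norm (\<psi>s n t - \<psi>0 t) \<le> 2 * a n * exp (2 * integral {0..T} coeff_norm)"
      proof (rule gronwall[OF Kl coeff_norm_nonneg, where y = "\<lambda>s. norm (\<psi>s n s - \<psi>0 s)"])
        show yc: "continuous_on {0..T} (\<lambda>s. norm (\<psi>s n s - \<psi>0 s))"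
          by (intro continuous_intros continuous_on_subset[OF c(1)] continuous_on_subset[OF c(2)]) auto
        have "\<kappa> \<ge> 0" unfolding \<kappa>_def by (intro integral_nonneg Ki coeff_norm_nonneg)
        then show "0 \<le> a n" by (simp add: a_def)
        fix s assume s: "s \<in> {0..T}"
        have s0: "s \<ge> 0" using s by simp
        have gi: "(\<lambda>r. grad (lams n) r (\<psi>s n r)) integrable_on {0..s}" "(\<lambda>r. grad lam0 r (\<psi>0 r)) integrable_on {0..s}"
          using grad_integrable[OF c(1) s0] grad_integrable[OF c(2) s0] set_lebesgue_integral_eq_integral(1) by blast+
        have Ks: "coeff_norm integrable_on {0..s}" using integrable_on_subinterval[OF Ki, of 0 s] s by auto
        have "(\<lambda>r. coeff_norm r * norm (\<psi>s n r - \<psi>0 r)) absolutely_integrable_on {0..s}"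
          by (rule absolutely_integrable_times_continuous[OF locally_integrableD[OF coeff_norm_integrable s0]])
            (use yc s in \<open>auto intro: continuous_on_subset\<close>)
        then have Kyi: "(\<lambda>r. coeff_norm r * norm (\<psi>s n r - \<psi>0 r)) integrable_on {0..s}"
          by (rule set_lebesgue_integral_eq_integral(1))
        have "\<psi>s n s - \<psi>0 s = (\<psi>s n 0 - p) - integral {0..s} (\<lambda>r. grad (lams n) r (\<psi>s n r) - grad lam0 r (\<psi>0 r))"
          using eqs[of s n] \<psi>0(2)[OF s0] s elim(2) Henstock_Kurzweil_Integration.integral_diff[OF gi] by simp
        then have "norm (\<psi>s n s - \<psi>0 s) \<le> norm (\<psi>s n 0 - p) + norm (integral {0..s} (\<lambda>r. grad (lams n) r (\<psi>s n r) - grad lam0 r (\<psi>0 r)))"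
          by (metis norm_triangle_ineq4)
        also have "norm (integral {0..s} (\<lambda>r. grad (lams n) r (\<psi>s n r) - grad lam0 r (\<psi>0 r)))
            \<le> integral {0..s} (\<lambda>r. coeff_norm r * norm (\<psi>s n r - \<psi>0 r) + \<bar>lams n - lam0\<bar> * coeff_norm r)"
        proof (rule integral_norm_bound_integral)
          show "(\<lambda>r. grad (lams n) r (\<psi>s n r) - grad lam0 r (\<psi>0 r)) integrable_on {0..s}" by (rule integrable_diff[OF gi])
          show "(\<lambda>r. coeff_norm r * norm (\<psi>s n r - \<psi>0 r) + \<bar>lams n - lam0\<bar> * coeff_norm r) integrable_on {0..s}"
            by (intro integrable_add Kyi integrable_on_mult_right Ks)
          fix r
          show "norm (grad (lams n) r (\<psi>s n r) - grad lam0 r (\<psi>0 r))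
              \<le> coeff_norm r * norm (\<psi>s n r - \<psi>0 r) + \<bar>lams n - lam0\<bar> * coeff_norm r"
            using norm_grad[of "lams n - lam0" r "\<psi>s n r - \<psi>0 r"] by (simp add: grad_linear algebra_simps)
        qed
        also have "\<dots> = integral {0..s} (\<lambda>r. coeff_norm r * norm (\<psi>s n r - \<psi>0 r)) + \<bar>lams n - lam0\<bar> * integral {0..s} coeff_norm"
          using Henstock_Kurzweil_Integration.integral_add[OF Kyi integrable_on_mult_right[OF Ks, of "\<bar>lams n - lam0\<bar>"]] by simp
        also have "\<bar>lams n - lam0\<bar> * integral {0..s} coeff_norm \<le> \<bar>lams n - lam0\<bar> * \<kappa>"
          unfolding \<kappa>_def using s by (intro mult_left_mono integral_subset_le Ks Ki) (auto simp: coeff_norm_nonneg)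
        finally show "norm (\<psi>s n s - \<psi>0 s) \<le> a n + integral {0..s} (\<lambda>r. coeff_norm r * norm (\<psi>s n r - \<psi>0 r))"
          by (simp add: a_def)
      qed (use t in auto)
      then show "dist (\<psi>s n t) (\<psi>0 t) < e" using elim(1) by (simp add: dist_norm \<kappa>_def)
    qed
  qed
qed

text \<open>Serves both cases of the theorem. The factor \<open>c n\<close> is also the new
  multiplier, because scaling a pair with multiplier 1 by \<open>c n\<close> gives multiplier
  \<open>c n\<close>; it is 1 in the normal case and the reciprocal of a norm otherwise.\<close>

lemma vanishing_limit:
  assumes \<Psi>: "\<And>n. \<Psi> n \<in> AC_halfline" "\<And>n. \<Psi> n (\<tau> n) = 0"
    "\<And>n. \<forall>t\<in>{0..\<tau> n}. \<Psi> n t = \<Psi> n 0 - integral {0..t} (\<lambda>s. grad 1 s (\<Psi> n s))"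
    "\<And>n. AE t in lebesgue. t \<in> {0..\<tau> n} \<longrightarrow> (\<Psi> n has_vector_derivative - grad 1 t (\<Psi> n t)) (at t)"
    "\<And>n. AE t in lebesgue. t \<in> {0..\<tau> n} \<longrightarrow>
      (\<forall>p\<in>U t. hamiltonian f g (x0 t) t p 1 (\<Psi> n t) \<le> hamiltonian f g (x0 t) t (u0 t) 1 (\<Psi> n t))"
    and \<tau>: "filterlim \<tau> at_top sequentially" and r: "strict_mono r"
    and c: "\<And>n. 0 < c n" "\<And>n. c n \<le> 1" "c \<longlonglongrightarrow> lam0" "(\<lambda>n. c n *\<^sub>R \<Psi> (r n) 0) \<longlonglongrightarrow> p"
  shows "\<exists>\<psi>0. \<psi>0 \<in> AC_halfline \<and> \<psi>0 0 = p \<and> adjoint_equation_on {0..} f g x0 u0 lam0 \<psi>0 \<and>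
    maximum_condition_on {0..} U f g x0 u0 lam0 \<psi>0 \<and>
    vanishing_witness U f g x0 u0 (\<tau> \<circ> r) c (\<lambda>n t. c n *\<^sub>R \<Psi> (r n) t) lam0 \<psi>0"
proof -
  obtain \<psi>0 where \<psi>0: "\<psi>0 \<in> AC_halfline" "\<And>t. t \<ge> 0 \<Longrightarrow> \<psi>0 t = p - integral {0..t} (\<lambda>s. grad lam0 s (\<psi>0 s))"
     "AE t in lebesgue. t \<in> {0..} \<longrightarrow> (\<psi>0 has_vector_derivative - grad lam0 t (\<psi>0 t)) (at t)"
    using ex_adjoint_forward[of p lam0] by blast
  define \<psi>s where "\<psi>s n t = c n *\<^sub>R \<Psi> (r n) t" for n t
  have gs: "grad (c n) t (\<psi>s n t) = c n *\<^sub>R grad 1 t (\<Psi> (r n) t)" for n t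
    using grad_linear(2)[of "c n" 1 t "\<Psi> (r n) t"] by (simp add: \<psi>s_def)
  have hs: "hamiltonian f g y t q (c n) (\<psi>s n t) = c n * hamiltonian f g y t q 1 (\<Psi> (r n) t)" for n t q y
    by (simp add: hamiltonian_def \<psi>s_def algebra_simps)
  have \<tau>r: "filterlim (\<tau> \<circ> r) at_top sequentially"
    unfolding o_def by (rule filterlim_compose[OF \<tau> filterlim_subseq[OF r]])
  have ac: "\<psi>s n \<in> AC_halfline" for n
    unfolding AC_halfline_def
  proof (intro CollectI allI impI)
    fix T :: real assume "T \<ge> 0"
    then have a: "abs_cont_on 0 T (\<Psi> (r n))" using \<Psi>(1) by (auto simp: AC_halfline_def)
    show "abs_cont_on 0 T (\<psi>s n)"
    proof (rule abs_cont_on_dominated[OF a a, of "c n"])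
      fix u v
      have "norm (\<psi>s n v - \<psi>s n u) = c n * norm (\<Psi> (r n) v - \<Psi> (r n) u)"
        using c(1)[of n] unfolding \<psi>s_def scaleR_diff_right[symmetric] by simp
      also have "\<dots> \<le> c n * (norm (\<Psi> (r n) v - \<Psi> (r n) u) + norm (\<Psi> (r n) v - \<Psi> (r n) u))"
        using c(1)[of n] by (intro mult_left_mono) auto
      finally show "norm (\<psi>s n v - \<psi>s n u) \<le> c n * (norm (\<Psi> (r n) v - \<Psi> (r n) u) + norm (\<Psi> (r n) v - \<Psi> (r n) u))" .
    qed (use c(1)[of n] in auto)
  qed
  have eqs: "\<psi>s n t = \<psi>s n 0 - integral {0..t} (\<lambda>s. grad (c n) s (\<psi>s n s))" if "t \<in> {0..(\<tau> \<circ> r) n}" for n t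
    unfolding gs using bspec[OF \<Psi>(3)[of "r n"], of t] that by (simp add: \<psi>s_def scaleR_diff_right)
  have unif: "uniform_limit {0..T} \<psi>s \<psi>0 sequentially" if "T \<ge> 0" for T
    by (rule adjoint_convergence[OF ac eqs \<psi>0(1,2) c(3) _ \<tau>r that]) (use c(4) in \<open>auto simp: \<psi>s_def\<close>)
  have dn: "AE t in lebesgue. t \<in> {0..(\<tau> \<circ> r) n} \<longrightarrow> (\<psi>s n has_vector_derivative - grad (c n) t (\<psi>s n t)) (at t)" for n
    using \<Psi>(4)[of "r n"]
  proof eventually_elim
    case (elim t)
    show ?case
    proof
      assume "t \<in> {0..(\<tau> \<circ> r) n}"
      then have "(\<Psi> (r n) has_vector_derivative - grad 1 t (\<Psi> (r n) t)) (at t)" using elim by simp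
      then have "((\<lambda>t. c n *\<^sub>R \<Psi> (r n) t) has_vector_derivative c n *\<^sub>R - grad 1 t (\<Psi> (r n) t)) (at t)"
        by (rule bounded_linear.has_vector_derivative[OF bounded_linear_scaleR_right])
      then show "(\<psi>s n has_vector_derivative - grad (c n) t (\<psi>s n t)) (at t)"
        unfolding gs by (simp add: \<psi>s_def[abs_def])
    qed
  qed
  have mn: "AE t in lebesgue. t \<in> {0..(\<tau> \<circ> r) n} \<longrightarrow>
      (\<forall>p\<in>U t. hamiltonian f g (x0 t) t p (c n) (\<psi>s n t) \<le> hamiltonian f g (x0 t) t (u0 t) (c n) (\<psi>s n t))" for n
    using \<Psi>(5)[of "r n"] unfolding hs by eventually_elim (use c(1)[of n] in simp)
  \<comment> \<open>One null set for all \<open>n\<close>, so that the limit can be taken at a fixed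
    time.\<close>
  have "AE t in lebesgue. \<forall>n. t \<in> {0..(\<tau> \<circ> r) n} \<longrightarrow>
      (\<forall>p\<in>U t. hamiltonian f g (x0 t) t p (c n) (\<psi>s n t) \<le> hamiltonian f g (x0 t) t (u0 t) (c n) (\<psi>s n t))"
    using mn by (simp add: AE_all_countable)
  then have m0: "AE t in lebesgue. t \<in> {0..} \<longrightarrow>
      (\<forall>p\<in>U t. hamiltonian f g (x0 t) t p lam0 (\<psi>0 t) \<le> hamiltonian f g (x0 t) t (u0 t) lam0 (\<psi>0 t))"
  proof eventually_elim
    case (elim t)
    show ?case
    proof (intro impI ballI)
      fix q assume t: "t \<in> {0..}" and q: "q \<in> U t"
      have "(\<lambda>n. \<psi>s n t) \<longlonglongrightarrow> \<psi>0 t" using t by (intro tendsto_uniform_limitI[OF unif[of t]]) auto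
      then have "(\<lambda>n. hamiltonian f g (x0 t) t w (c n) (\<psi>s n t)) \<longlonglongrightarrow> hamiltonian f g (x0 t) t w lam0 (\<psi>0 t)" for w
        unfolding hamiltonian_def by (intro tendsto_intros c(3))
      moreover have "\<forall>\<^sub>F n in sequentially. (\<tau> \<circ> r) n \<ge> t" using \<tau>r by (simp add: filterlim_at_top)
      then have "\<forall>\<^sub>F n in sequentially. hamiltonian f g (x0 t) t q (c n) (\<psi>s n t) \<le> hamiltonian f g (x0 t) t (u0 t) (c n) (\<psi>s n t)"
        by eventually_elim (use elim t q in auto)
      ultimately show "hamiltonian f g (x0 t) t q lam0 (\<psi>0 t) \<le> hamiltonian f g (x0 t) t (u0 t) lam0 (\<psi>0 t)"
        by (intro tendsto_le[OF sequentially_bot]) auto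
    qed
  qed
  have "converges_locally_uniformly c \<psi>s lam0 \<psi>0"
    unfolding converges_locally_uniformly_def
  proof (intro conjI allI impI c(3))
    fix K :: "real set" assume K: "compact K \<and> K \<subseteq> {0..}"
    then obtain T where T: "\<And>t. t \<in> K \<Longrightarrow> \<bar>t\<bar> \<le> T" using compact_imp_bounded[of K] unfolding bounded_iff by auto
    have "K \<subseteq> {0..max 0 T}" using T K by fastforce
    then show "uniform_limit K \<psi>s \<psi>0 sequentially" by (rule uniform_limit_on_subset[OF unif, rotated]) simp
  qed
  then have "vanishing_witness U f g x0 u0 (\<tau> \<circ> r) c \<psi>s lam0 \<psi>0"
    unfolding vanishing_witness_def
  proof (intro conjI allI)
    fix n
    show "c n \<in> {0..1}" using c(1,2)[of n] by simp
    show "adjoint_equation_on {0..(\<tau> \<circ> r) n} f g x0 u0 (c n) (\<psi>s n)" by (rule adjoint_equation_onI[OF dn]) auto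
    show "maximum_condition_on {0..(\<tau> \<circ> r) n} U f g x0 u0 (c n) (\<psi>s n)" by (rule maximum_condition_onI[OF mn]) auto
    show "\<psi>s n ((\<tau> \<circ> r) n) = 0" using \<Psi>(2)[of "r n"] by (simp add: \<psi>s_def)
  qed (rule ac)
  moreover have "\<psi>0 0 = p" using \<psi>0(2)[of 0] by simp
  ultimately show ?thesis
    using \<psi>0(1) adjoint_equation_onI[OF \<psi>0(3)] maximum_condition_onI[OF m0] unfolding \<psi>s_def[abs_def]
    by (intro exI[of _ \<psi>0] conjI) auto
qed

end

theorem mainTheorem1:
  fixes U :: "real \<Rightarrow> 'u::euclidean_space set"
    and f :: "real \<Rightarrow> 'x::euclidean_space \<Rightarrow> 'u \<Rightarrow> 'x"
    and g :: "real \<Rightarrow> 'x \<Rightarrow> 'u \<Rightarrow> real"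
    and fx :: "real \<Rightarrow> 'x \<Rightarrow> 'u \<Rightarrow> 'x \<Rightarrow>\<^sub>L 'x"
    and gx :: "real \<Rightarrow> 'x \<Rightarrow> 'u \<Rightarrow> 'x \<Rightarrow>\<^sub>L real"
    and M :: "real \<Rightarrow> real" and xstar :: 'x
    and \<tau> :: "nat \<Rightarrow> real" and u0 :: "real \<Rightarrow> 'u" and x0 :: "real \<Rightarrow> 'x"
  assumes U_compact: "\<And>t. 0 \<le> t \<Longrightarrow> compact (U t)"
    and U_bounded: "locally_integrally_bounded U"
    and U_graph: "set_graph U \<in> sets borel"
    and f_deriv: "\<And>t x u. 0 \<le> t \<Longrightarrow> ((\<lambda>y. f t y u) has_derivative fx t x u) (at x)"
    and g_deriv: "\<And>t x u. 0 \<le> t \<Longrightarrow> ((\<lambda>y. g t y u) has_derivative gx t x u) (at x)"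
    and f_regular: "regular_map U f" and fx_regular: "regular_map U fx"
    and g_regular: "regular_map U g" and gx_regular: "regular_map U gx"
    and M_cont: "continuous_on {0..} M" and M_nonneg: "\<And>t. 0 \<le> t \<Longrightarrow> 0 \<le> M t"
    and f_growth: "\<And>t x u. 0 \<le> t \<Longrightarrow> u \<in> U t \<Longrightarrow> norm (f t x u) \<le> M t * (1 + norm x)"
    and \<tau>_nonneg: "\<And>n. 0 \<le> \<tau> n" and \<tau>_inc: "incseq \<tau>"
    and \<tau>_unbounded: "filterlim \<tau> at_top sequentially"
    and optimal: "strictly_optimal U f g xstar \<tau> u0"
    and traj: "trajectory f xstar u0 x0"
  shows "\<exists>lam0 \<psi>0. lam0 \<in> {0, 1} \<and> normalized lam0 \<psi>0 \<and>
           strictly_vanishing U f g x0 u0 \<tau> lam0 \<psi>0 \<and>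
           (\<exists>r lams \<psi>s. strict_mono r \<and> vanishing_witness U f g x0 u0 (\<tau> \<circ> r) lams \<psi>s lam0 \<psi>0 \<and>
              (\<forall>n. normalized_up_to_scaling (lams n) (\<psi>s n)) \<and>
              (lam0 = 0 \<longrightarrow> (\<forall>n. norm (\<psi>s n 0) = 1)) \<and>
              (lam0 = 1 \<longrightarrow> (\<forall>n. lams n = 1)))"
proof -
  interpret control_system U f g fx gx M xstar u0 x0
    by unfold_locales (use assms in \<open>auto simp: strictly_optimal_def\<close>)
  have "\<forall>n. \<exists>\<psi>. \<psi> \<in> AC_halfline \<and> \<psi> (\<tau> n) = 0 \<and>
      (\<forall>t\<in>{0..\<tau> n}. \<psi> t = \<psi> 0 - integral {0..t} (\<lambda>s. grad 1 s (\<psi> s))) \<and>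
      (AE t in lebesgue. t \<in> {0..\<tau> n} \<longrightarrow> (\<psi> has_vector_derivative - grad 1 t (\<psi> t)) (at t))"
    using ex_adjoint_backward[OF \<tau>_nonneg] by blast
  from choice[OF this] obtain \<Psi> where \<Psi>: "\<And>n. \<Psi> n \<in> AC_halfline" "\<And>n. \<Psi> n (\<tau> n) = 0"
    "\<And>n. \<forall>t\<in>{0..\<tau> n}. \<Psi> n t = \<Psi> n 0 - integral {0..t} (\<lambda>s. grad 1 s (\<Psi> n s))"
    "\<And>n. AE t in lebesgue. t \<in> {0..\<tau> n} \<longrightarrow> (\<Psi> n has_vector_derivative - grad 1 t (\<Psi> n t)) (at t)"
    by blast
  have max: "AE t in lebesgue. t \<in> {0..\<tau> n} \<longrightarrow>
      (\<forall>p\<in>U t. hamiltonian f g (x0 t) t p 1 (\<Psi> n t) \<le> hamiltonian f g (x0 t) t (u0 t) 1 (\<Psi> n t))" for n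
    by (rule maximum_principle_free_end[OF \<tau>_nonneg \<Psi>(1,2,4)])
      (use optimal traj in \<open>auto simp: strictly_optimal_def\<close>)
  note limit = vanishing_limit[OF \<Psi> max \<tau>_unbounded]
  show ?thesis
  \<comment> \<open>Failure to tend to infinity is exactly boundedness along a subsequence.\<close>
  proof (cases "filterlim (\<lambda>n. norm (\<Psi> n 0)) at_top sequentially")
    case False
    then obtain Z where Z: "\<not> (\<forall>\<^sub>F n in sequentially. Z \<le> norm (\<Psi> n 0))" by (auto simp: filterlim_at_top)
    then have "infinite {n. norm (\<Psi> n 0) \<le> Z}"
      by (auto simp: eventually_sequentially infinite_nat_iff_unbounded_le not_le intro: less_imp_le)
    from infinite_enumerate[OF this] obtain r :: "nat \<Rightarrow> nat"
      where r: "strict_mono r" "\<forall>n. r n \<in> {n. norm (\<Psi> n 0) \<le> Z}" by (elim exE conjE)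
    then have "\<forall>n. \<Psi> (r n) 0 \<in> cball 0 Z" by simp
    from seq_compactE[OF compact_imp_seq_compact[OF compact_cball] this]
    obtain p q where q: "strict_mono q" "((\<lambda>n. \<Psi> (r n) 0) \<circ> q) \<longlonglongrightarrow> p"
      by blast
    have rq: "strict_mono (r \<circ> q)" using r(1) q(1) by (rule strict_mono_o)
    have "(\<lambda>n. 1 *\<^sub>R \<Psi> ((r \<circ> q) n) 0) \<longlonglongrightarrow> p" using q(2) by (simp add: o_def)
    from limit[where c = "\<lambda>n. 1", OF rq zero_less_one order_refl tendsto_const this] obtain \<psi>0 where \<psi>0: "\<psi>0 \<in> AC_halfline" "adjoint_equation_on {0..} f g x0 u0 1 \<psi>0"
      "maximum_condition_on {0..} U f g x0 u0 1 \<psi>0"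
      "vanishing_witness U f g x0 u0 (\<tau> \<circ> (r \<circ> q)) (\<lambda>n. 1) (\<lambda>n t. 1 *\<^sub>R \<Psi> ((r \<circ> q) n) t) 1 \<psi>0"
      by blast
    have sv: "strictly_vanishing U f g x0 u0 \<tau> 1 \<psi>0"
      unfolding strictly_vanishing_def nontrivial_pair_def using \<psi>0 rq by auto
    show ?thesis
    proof (intro exI[of _ "1::real"] exI[of _ \<psi>0] conjI)
      show "\<exists>r lams \<psi>s. strict_mono r \<and> vanishing_witness U f g x0 u0 (\<tau> \<circ> r) lams \<psi>s 1 \<psi>0 \<and>
          (\<forall>n. normalized_up_to_scaling (lams n) (\<psi>s n)) \<and>
          ((1::real) = 0 \<longrightarrow> (\<forall>n. norm (\<psi>s n 0) = 1)) \<and> ((1::real) = 1 \<longrightarrow> (\<forall>n. lams n = 1))"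
        using rq \<psi>0(4)
        by (intro exI[of _ "r \<circ> q"] exI[of _ "\<lambda>n. 1"] exI[of _ "\<lambda>n t. 1 *\<^sub>R \<Psi> ((r \<circ> q) n) t"])
          (auto simp: normalized_up_to_scaling_def normalized_def intro!: exI[of _ 1])
    qed (use sv in \<open>auto simp: normalized_def\<close>)
  next
    case True
    then have "\<forall>\<^sub>F n in sequentially. 1 \<le> norm (\<Psi> n 0)" by (simp add: filterlim_at_top)
    \<comment> \<open>Dropping the first \<open>N\<close> horizons makes the norms at least 1, so
      that the scaling factors are positive and at most 1.\<close>
    then obtain N where N: "\<And>n. n \<ge> N \<Longrightarrow> 1 \<le> norm (\<Psi> n 0)" by (auto simp: eventually_sequentially)
    have "\<forall>n. (1 / norm (\<Psi> (n + N) 0)) *\<^sub>R \<Psi> (n + N) 0 \<in> sphere 0 1"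
    proof
      fix n
      have "\<Psi> (n + N) 0 \<noteq> 0" using N[of "n + N"] by auto
      then show "(1 / norm (\<Psi> (n + N) 0)) *\<^sub>R \<Psi> (n + N) 0 \<in> sphere 0 1" by simp
    qed
    from seq_compactE[OF compact_imp_seq_compact[OF compact_sphere] this]
    obtain p q where p: "p \<in> sphere 0 1" and q: "strict_mono q"
      "((\<lambda>n. (1 / norm (\<Psi> (n + N) 0)) *\<^sub>R \<Psi> (n + N) 0) \<circ> q) \<longlonglongrightarrow> p"
      by blast
    define r where "r n = q n + N" for n
    have r: "strict_mono r" using q(1) by (auto simp: strict_mono_def r_def)
    define c where "c n = 1 / norm (\<Psi> (r n) 0)" for n
    have ge1: "1 \<le> norm (\<Psi> (r n) 0)" for n using N[of "r n"] by (simp add: r_def)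
    have c: "0 < c n" "c n \<le> 1" for n
    proof -
      have pos: "0 < norm (\<Psi> (r n) 0)" using ge1[of n] by linarith
      show "0 < c n" unfolding c_def by (rule divide_pos_pos[OF zero_less_one pos])
      show "c n \<le> 1" unfolding c_def divide_le_eq_1_pos[OF pos] by (rule ge1)
    qed
    have unit: "norm (c n *\<^sub>R \<Psi> (r n) 0) = 1" for n using ge1[of n] by (auto simp: c_def)
    have "filterlim (\<lambda>n. norm (\<Psi> (r n) 0)) at_top sequentially"
      by (rule filterlim_compose[OF True filterlim_subseq[OF r]])
    then have c0: "c \<longlonglongrightarrow> 0"
      unfolding c_def[abs_def] by (intro tendsto_divide_0[OF tendsto_const] filterlim_at_top_imp_at_infinity)
    have "(\<lambda>n. c n *\<^sub>R \<Psi> (r n) 0) \<longlonglongrightarrow> p" using q(2) by (simp add: o_def c_def r_def)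
    from limit[OF r c c0 this] obtain \<psi>0 where \<psi>0: "\<psi>0 \<in> AC_halfline" "\<psi>0 0 = p" "adjoint_equation_on {0..} f g x0 u0 0 \<psi>0"
      "maximum_condition_on {0..} U f g x0 u0 0 \<psi>0"
      "vanishing_witness U f g x0 u0 (\<tau> \<circ> r) c (\<lambda>n t. c n *\<^sub>R \<Psi> (r n) t) 0 \<psi>0"
      by blast
    \<comment> \<open>The sphere is compact, so the limit keeps a unit initial value; with
      multiplier 0 this is what excludes the trivial pair.\<close>
    have n0: "norm (\<psi>0 0) = 1" using p \<psi>0(2) by simp
    then have "\<psi>0 0 \<noteq> 0" by auto
    then have sv: "strictly_vanishing U f g x0 u0 \<tau> 0 \<psi>0"
      unfolding strictly_vanishing_def nontrivial_pair_def using \<psi>0 r by auto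
    show ?thesis
    proof (intro exI[of _ "0::real"] exI[of _ \<psi>0] conjI)
      \<comment> \<open>Rescaling by \<open>1 / c n\<close>, the norm of the original initial value,
        restores multiplier 1.\<close>
      have "normalized_up_to_scaling (c n) (\<lambda>t. c n *\<^sub>R \<Psi> (r n) t)" for n
        unfolding normalized_up_to_scaling_def normalized_def using c(1)[of n] by (intro exI[of _ "1 / c n"]) auto
      then show "\<exists>r lams \<psi>s. strict_mono r \<and> vanishing_witness U f g x0 u0 (\<tau> \<circ> r) lams \<psi>s 0 \<psi>0 \<and>
          (\<forall>n. normalized_up_to_scaling (lams n) (\<psi>s n)) \<and>
          ((0::real) = 0 \<longrightarrow> (\<forall>n. norm (\<psi>s n 0) = 1)) \<and> ((0::real) = 1 \<longrightarrow> (\<forall>n. lams n = 1))"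
        using r \<psi>0(5) unit by (intro exI[of _ r] exI[of _ c] exI[of _ "\<lambda>n t. c n *\<^sub>R \<Psi> (r n) t"]) auto
    qed (use sv n0 in \<open>auto simp: normalized_def\<close>)
  qed
qed

end
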